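(* Let $N\geq 2$ be an integer and consider a quantum system composed of $N$ units, the unit $i\in[N]=\{1,\ldots,N\}$ having the full complex matrix algebra $\mathcal A_i=M_{d_i}$, $d_i\in\mathbb N$, with total algebra $\mathcal A=\bigotimes_{i\in[N]}\mathcal A_i$ and state space $\mathcal M(\mathcal A)$. For $k\in[N]$ let $\mathcal H_k$ be the real vector space of $k$-local Hamiltonians and $\mathcal E(\mathcal H_k)=\{e^H/\operatorname{tr}(e^H)\mid H\in\mathcal H_k\}$ the corresponding Gibbs family. Let ${\rm d}_{\mathcal E(\mathcal H_k)}$ be the divergence from $\mathcal E(\mathcal H_k)$, let $C_k$ ($k=2,\ldots,N$) be the $k$-body irreducible correlation, and let $I$ be the total correlation. Then the following equalities of functions on $\mathcal M(\mathcal A)$ hold: $$C_k={\rm d}_{\mathcal E(\mathcal H_{k-1})}-{\rm d}_{\mathcal E(\mathcal H_k)}\quad (k=2,\ldots,N-1),\qquad C_N={\rm d}_{\mathcal E(\mathcal H_{N-1})},\qquad I=C_2+\cdots+C_N.$$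
   Context: For $d\in\mathbb N$, $M_d$ is the algebra of complex $d\times d$ matrices, and $M_d^{\rm h}$ is the real Euclidean space of Hermitian matrices in $M_d$ with scalar product $\langle a,b\rangle=\operatorname{tr}(ab)$. For a non-zero orthogonal projection $p=p^2=p^*\in M_d$ let $\mathcal M(pM_dp)=\{\rho\in pM_dp\mid \rho\succeq 0,\ \operatorname{tr}(\rho)=1\}$. The tensor product $\mathcal A=\bigotimes_{i\in[N]}M_{d_i}$ is identified with $M_d$, $d=d_1\cdots d_N$, so that $\mathcal M(\mathcal A)=\mathcal M_d:=\mathcal M(M_d)$ is the set of all density matrices (states). For $A\subset[N]$ let $\mathcal A_A=\bigotimes_{i\in A}\mathcal A_i$ with identity $\mathbb 1_A$. A $k$-local Hamiltonian is a sum of terms of the form $\mathbb 1_{[N]\setminus A}\otimes b$ (tensor factors placed in their respective positions) with $b\in\mathcal A_A$ Hermitian and $A\subset[N]$ of cardinality $|A|\leq k$. The marginal $\rho_A\in\mathcal M(\mathcal A_A)$ of $\rho\in\mathcal M(\mathcal A)$ is defined by $\langle X,\rho_A\rangle=\langle X\otimes\mathbb 1_{[N]\setminus A},\rho\rangle$ for all Hermitian $X\in\mathcal A_A$. The von Neumann entropy of a state is $H(\rho)=-\operatorname{tr}\rho\log(\rho)$ (with $0\log 0=0$). The relative entropy (divergence) is $D(\rho,\sigma)=\operatorname{tr}\rho(\log(\rho)-\log(\sigma))$ if $\ker(\sigma)\subset\ker(\rho)$ and $D(\rho,\sigma)=+\infty$ otherwise. The divergence from a subset $X$ of states is ${\rm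 d}_X(\rho)=\inf\{D(\rho,\sigma)\mid\sigma\in X\}$. The total correlation is $I(\rho)=\sum_{i\in[N]}H(\rho_{\{i\}})-H(\rho)$. The projection $\pi_{\mathcal E(\mathcal H)}$: let $\mathcal H\subset M_d^{\rm h}$ be a real subspace with basis $H_1,\ldots,H_r$, and let $\mathbb E:M_d^{\rm h}\to\mathbb R^r$, $\mathbb E(a)=(\langle H_1,a\rangle,\ldots,\langle H_r,a\rangle)$, with convex support $\mathbb L=\mathbb E(\mathcal M_d)$. A face of a compact convex set $C$ is a convex subset $F\subset C$ such that every segment in $C$ whose relative interior meets $F$ is contained in $F$. Let $\mathcal P$ be the set of projections $p$ such that $\mathcal M(pM_dp)=\mathbb E|_{\mathcal M_d}^{-1}(F)$ for some non-empty face $F$ of $\mathbb L$. For a non-zero projection $p$ let $\mathcal E_p=\{pe^{pHp}/\operatorname{tr}(pe^{pHp})\mid H\in\mathcal H\}$, and let $\operatorname{ext}(\mathcal E(\mathcal H))=\bigcup_{p\in\mathcal P}\mathcal E_p$. It is known that $\mathbb E$ restricts to a bijection $\operatorname{ext}(\mathcal E(\mathcal H))\to\mathbb L$; for $\rho\in\mathcal M_d$, $\pi_{\mathcal E(\mathcal H)}(\rho)$ is the unique state in $\operatorname{ext}(\mathcal E(\mathcal H))$ with $\mathbb E(\pi_{\mathcal E(\mathcal H)}(\rho))=\mathbb E(\rho)$. It does not depend on the chosen basis. It is known that, equivalently, $\pi_{\mathcal E(\mathcal H)}(\rho)$ is the unique state of maximal von Neumann entropy among all states $\tau\in\mathcal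 M_d$ with $\mathbb E(\tau)=\mathbb E(\rho)$; for $\mathcal H=\mathcal H_k$ this condition means that $\tau$ and $\rho$ have the same marginals $\tau_A=\rho_A$ for all $A\subset[N]$ with $|A|=k$. The $k$-body irreducible correlation is $C_k(\rho)=H(\pi_{\mathcal E(\mathcal H_{k-1})}(\rho))-H(\pi_{\mathcal E(\mathcal H_k)}(\rho))$ for $\rho\in\mathcal M(\mathcal A)$ and $k=2,\ldots,N$. *)

theory Defs
  imports
    "HOL-Library.Extended_Real"
    "Jordan_Normal_Form.Schur_Decomposition"
    "Jordan_Normal_Form.Matrix_Kernel"
begin

section \<open>Hermitian matrices and states\<close>

definition mtrace :: "complex mat \<Rightarrow> complex" where
  "mtrace A = (\<Sum>i<dim_row A. A $$ (i, i))"

definition herm :: "nat \<Rightarrow> complex mat set" where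
  "herm n = {A \<in> carrier_mat n n. mat_adjoint A = A}"

text \<open>For Hermitian arguments the trace of the product is real, so taking the real part
  loses nothing.\<close>

definition hs_inner :: "complex mat \<Rightarrow> complex mat \<Rightarrow> real" where
  "hs_inner A B = Re (mtrace (A * B))"

definition psd :: "nat \<Rightarrow> complex mat \<Rightarrow> bool" where
  "psd n A \<longleftrightarrow> A \<in> herm n \<and> (\<forall>v \<in> carrier_vec n. 0 \<le> Re ((A *\<^sub>v v) \<bullet>c v))"

definition states :: "nat \<Rightarrow> complex mat set" where
  "states n = {\<rho> \<in> carrier_mat n n. psd n \<rho> \<and> mtrace \<rho> = 1}"

definition projections :: "nat \<Rightarrow> complex mat set" where
  "projections n = {p \<in> carrier_mat n n. p * p = p \<and> mat_adjoint p = p \<and> p \<noteq> 0\<^sub>m n n}"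

definition corner_states :: "nat \<Rightarrow> complex mat \<Rightarrow> complex mat set" where
  "corner_states n p = {\<rho> \<in> states n. \<exists>a \<in> carrier_mat n n. \<rho> = p * a * p}"

section \<open>Exponential and logarithm\<close>

definition mexp :: "complex mat \<Rightarrow> complex mat" where
  "mexp A = mat (dim_row A) (dim_row A) (\<lambda>(i, j). \<Sum>k. (A ^\<^sub>m k) $$ (i, j) / fact k)"

text \<open>Functional calculus: \<open>f(A) = U diag(f(l\<^sub>0), \<dots>) U\<^sup>*\<close> for a unitary
  diagonalization \<open>A = U diag(l\<^sub>0, \<dots>) U\<^sup>*\<close> of a Hermitian matrix.\<close>

definition herm_fun :: "(real \<Rightarrow> real) \<Rightarrow> complex mat \<Rightarrow> complex mat" where
  "herm_fun f A = (THE B. \<exists>U \<in> carrier_mat (dim_row A) (dim_row A). \<exists>l :: nat \<Rightarrow> real.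
     U * mat_adjoint U = 1\<^sub>m (dim_row A) \<and>
     A = U * mat_diag (dim_row A) (\<lambda>i. complex_of_real (l i)) * mat_adjoint U \<and>
     B = U * mat_diag (dim_row A) (\<lambda>i. complex_of_real (f (l i))) * mat_adjoint U)"

text \<open>Since \<open>ln 0 = 0\<close>, the logarithm of a positive semidefinite matrix vanishes on its kernel.
  This realizes the convention \<open>0 log 0 = 0\<close>.\<close>

definition mlog :: "complex mat \<Rightarrow> complex mat" where
  "mlog = herm_fun ln"

section \<open>Entropy and divergence\<close>

definition vn_entropy :: "complex mat \<Rightarrow> real" where
  "vn_entropy \<rho> = - Re (mtrace (\<rho> * mlog \<rho>))"

definition rel_entropy :: "complex mat \<Rightarrow> complex mat \<Rightarrow> ereal" where
  "rel_entropy \<rho> \<sigma> =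
     (if mat_kernel \<sigma> \<subseteq> mat_kernel \<rho> then ereal (Re (mtrace (\<rho> * (mlog \<rho> - mlog \<sigma>)))) else \<infinity>)"

definition divergence_from :: "complex mat set \<Rightarrow> complex mat \<Rightarrow> ereal" where
  "divergence_from X \<rho> = (INF \<sigma> \<in> X. rel_entropy \<rho> \<sigma>)"

section \<open>Gibbs families, convex support and the projection onto the extension\<close>

definition gibbs_family :: "complex mat set \<Rightarrow> complex mat set" where
  "gibbs_family \<H> = {(1 / mtrace (mexp H)) \<cdot>\<^sub>m mexp H | H. H \<in> \<H>}"

definition gibbs_corner :: "complex mat set \<Rightarrow> complex mat \<Rightarrow> complex mat set" where
  "gibbs_corner \<H> p =
     {(1 / mtrace (p * mexp (p * H * p))) \<cdot>\<^sub>m (p * mexp (p * H * p)) | H. H \<in> \<H>}"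

definition real_comb :: "nat \<Rightarrow> complex mat list \<Rightarrow> (nat \<Rightarrow> real) \<Rightarrow> complex mat" where
  "real_comb n Hs c =
     mat n n (\<lambda>(i, j). \<Sum>l<length Hs. complex_of_real (c l) * (Hs ! l) $$ (i, j))"

definition real_basis :: "nat \<Rightarrow> complex mat set \<Rightarrow> complex mat list \<Rightarrow> bool" where
  "real_basis n \<H> Hs \<longleftrightarrow>
     set Hs \<subseteq> \<H> \<and>
     \<H> = range (real_comb n Hs) \<and>
     (\<forall>c. real_comb n Hs c = 0\<^sub>m n n \<longrightarrow> (\<forall>l<length Hs. c l = 0))"

definition expectation_map :: "complex mat list \<Rightarrow> complex mat \<Rightarrow> real vec" where
  "expectation_map Hs a = vec (length Hs) (\<lambda>j. hs_inner (Hs ! j) a)"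

definition convex_support :: "nat \<Rightarrow> complex mat list \<Rightarrow> real vec set" where
  "convex_support n Hs = expectation_map Hs ` states n"

definition seg_point :: "real vec \<Rightarrow> real vec \<Rightarrow> real \<Rightarrow> real vec" where
  "seg_point x y t = (1 - t) \<cdot>\<^sub>v x + t \<cdot>\<^sub>v y"

definition is_face :: "real vec set \<Rightarrow> real vec set \<Rightarrow> bool" where
  "is_face C F \<longleftrightarrow>
     F \<subseteq> C \<and>
     (\<forall>x \<in> F. \<forall>y \<in> F. \<forall>t \<in> {0..1}. seg_point x y t \<in> F) \<and>
     (\<forall>x \<in> C. \<forall>y \<in> C. (\<exists>t \<in> {0<..<1}. seg_point x y t \<in> F) \<longrightarrow>
        (\<forall>t \<in> {0..1}. seg_point x y t \<in> F))"

definition face_projections :: "nat \<Rightarrow> complex mat list \<Rightarrow> complex mat set" where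
  "face_projections n Hs =
     {p \<in> projections n. \<exists>F. F \<noteq> {} \<and> is_face (convex_support n Hs) F \<and>
        corner_states n p = {\<rho> \<in> states n. expectation_map Hs \<rho> \<in> F}}"

definition ext_gibbs :: "nat \<Rightarrow> complex mat set \<Rightarrow> complex mat list \<Rightarrow> complex mat set" where
  "ext_gibbs n \<H> Hs = (\<Union>p \<in> face_projections n Hs. gibbs_corner \<H> p)"

definition gibbs_proj :: "nat \<Rightarrow> complex mat set \<Rightarrow> complex mat \<Rightarrow> complex mat" where
  "gibbs_proj n \<H> \<rho> =
     (let Hs = (SOME Hs. real_basis n \<H> Hs)
      in THE \<tau>. \<tau> \<in> ext_gibbs n \<H> Hs \<and> expectation_map Hs \<tau> = expectation_map Hs \<rho>)"

section \<open>Multipartite systems\<close>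

text \<open>The unit \<open>i\<close> has the algebra of \<open>d i \<times> d i\<close> matrices. For a finite set \<open>A\<close> of units the
  tensor product of their algebras is the algebra of square matrices of size \<open>tdim d A\<close>. The
  index of the product basis vector with components \<open>x i < d i\<close> is
  \<open>\<Sum>i\<in>A. x i * (\<Prod>j\<in>A, j>i. d j)\<close>. This is the lexicographic order, as for the Kronecker
  product with the factors in increasing order of the units.\<close>

definition tdim :: "(nat \<Rightarrow> nat) \<Rightarrow> nat set \<Rightarrow> nat" where
  "tdim d A = (\<Prod>i\<in>A. d i)"

definition place :: "(nat \<Rightarrow> nat) \<Rightarrow> nat set \<Rightarrow> nat \<Rightarrow> nat" where
  "place d A i = (\<Prod>j\<in>{j \<in> A. i < j}. d j)"

definition digit :: "(nat \<Rightarrow> nat) \<Rightarrow> nat set \<Rightarrow> nat \<Rightarrow> nat \<Rightarrow> nat" where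
  "digit d A x i = (x div place d A i) mod d i"

definition encode :: "(nat \<Rightarrow> nat) \<Rightarrow> nat set \<Rightarrow> (nat \<Rightarrow> nat) \<Rightarrow> nat" where
  "encode d A f = (\<Sum>i\<in>A. f i * place d A i)"

text \<open>The operator \<open>b \<otimes> 1\<close>, with \<open>b\<close> acting on the units in \<open>A\<close> and the identity on those in
  \<open>{1..N} - A\<close>, tensor factors in their respective positions.\<close>

definition embed :: "nat \<Rightarrow> (nat \<Rightarrow> nat) \<Rightarrow> nat set \<Rightarrow> complex mat \<Rightarrow> complex mat" where
  "embed N d A b =
     mat (tdim d {1..N}) (tdim d {1..N}) (\<lambda>(x, y).
       if \<forall>i \<in> {1..N} - A. digit d {1..N} x i = digit d {1..N} y i
       then b $$ (encode d A (digit d {1..N} x), encode d A (digit d {1..N} y))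
       else 0)"

definition local_terms :: "nat \<Rightarrow> (nat \<Rightarrow> nat) \<Rightarrow> nat \<Rightarrow> complex mat set" where
  "local_terms N d k =
     {embed N d A b | A b. A \<subseteq> {1..N} \<and> card A \<le> k \<and> b \<in> herm (tdim d A)}"

definition local_hams :: "nat \<Rightarrow> (nat \<Rightarrow> nat) \<Rightarrow> nat \<Rightarrow> complex mat set" where
  "local_hams N d k =
     {foldr (+) hs (0\<^sub>m (tdim d {1..N}) (tdim d {1..N})) | hs. set hs \<subseteq> local_terms N d k}"

definition marginal :: "nat \<Rightarrow> (nat \<Rightarrow> nat) \<Rightarrow> nat set \<Rightarrow> complex mat \<Rightarrow> complex mat" where
  "marginal N d A \<rho> =
     (THE m. m \<in> states (tdim d A) \<and>
        (\<forall>X \<in> herm (tdim d A). hs_inner X m = hs_inner (embed N d A X) \<rho>))"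

definition total_correlation :: "nat \<Rightarrow> (nat \<Rightarrow> nat) \<Rightarrow> complex mat \<Rightarrow> real" where
  "total_correlation N d \<rho> =
     (\<Sum>i\<in>{1..N}. vn_entropy (marginal N d {i} \<rho>)) - vn_entropy \<rho>"

definition irreducible_correlation ::
    "nat \<Rightarrow> (nat \<Rightarrow> nat) \<Rightarrow> nat \<Rightarrow> complex mat \<Rightarrow> real" where
  "irreducible_correlation N d k \<rho> =
     vn_entropy (gibbs_proj (tdim d {1..N}) (local_hams N d (k - 1)) \<rho>) -
     vn_entropy (gibbs_proj (tdim d {1..N}) (local_hams N d k) \<rho>)"

end

theory Submission
  imports Defs "HOL-Computational_Algebra.Fundamental_Theorem_Algebra"
begin

text \<open>Since \<open>D(\<rho>, e\<^sup>X / tr e\<^sup>X) = ln tr e\<^sup>X - \<langle>X, \<rho>\<rangle> - H(\<rho>)\<close>, Klein's inequality shows that the divergence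
  of \<open>\<rho>\<close> from the Gibbs family of \<open>\<H>\<close> is at least \<open>H(\<sigma>) - H(\<rho>)\<close>, where \<open>\<sigma>\<close> maximizes the entropy among
  the states with the same expectation values on \<open>\<H>\<close> as \<open>\<rho>\<close>. The maximizer has the largest support \<open>s\<close>
  among these states, which makes the states supported in \<open>s\<close> the preimage of a face, and stationarity
  of the entropy puts \<open>ln \<sigma>\<close> into \<open>s \<H> s\<close>; hence \<open>\<sigma>\<close> is the projection of \<open>\<rho>\<close>. Mixing \<open>\<rho>\<close> with the
  maximally mixed state makes the maximizer invertible, that is, a member of the Gibbs family, and
  letting the mixing parameter tend to zero shows that the lower bound is attained.

  For \<open>N\<close>-local Hamiltonians the maximizer is \<open>\<rho>\<close>. For one-local Hamiltonians \<open>ln tr e\<^sup>X - \<langle>X, \<rho>\<rangle>\<close> is a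
  sum over the units, so its infimum, the entropy of the maximizer, is the sum of the entropies of the
  marginals. The three claims follow by telescoping.\<close>

section \<open>Adjoints and unitary conjugation of diagonal matrices\<close>

text \<open>Two states need not commute, so inequalities between functions of them cannot be read
  off from the eigenvalues alone. Traces are therefore written as double sums weighted by
  \<open>ov U V i j\<close>, the squared overlaps of two eigenbases. These weights are doubly
  stochastic, so Klein's inequality, its quadratic converse and the continuity of the entropy all
  reduce to scalar estimates, and the entropy is never differentiated.

  The obstacle is the boundary of the state space, where the entropy has infinite slope and the
  infimum of the divergence need not be attained. The support of the maximizer must be known before
  stationarity can be used, since only directions inside its corner can be followed to both sides.
  For the same reason the infimum is only approached, by compactness and an explicit modulus of
  continuity.

  \<open>gibbs_proj\<close> is a definite description. Besides exhibiting the maximizer as a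
  candidate, one must show that any competitor in the extension maximizes the entropy, among states
  with its expectation values, in a corner containing the maximizer; the equality case of Klein's
  inequality then identifies the two.\<close>

lemma mult_square_carrier [simp]: "A \<in> carrier_mat n n \<Longrightarrow> B \<in> carrier_mat n n \<Longrightarrow> A * B \<in> carrier_mat n n"
  by (rule mult_carrier_mat)

lemma assoc_mult_square:
  "A \<in> carrier_mat n n \<Longrightarrow> B \<in> carrier_mat n n \<Longrightarrow> C \<in> carrier_mat n n \<Longrightarrow>
    A * B * C = A * (B * (C :: 'a :: semiring_0 mat))"
  by (rule assoc_mult_mat)

lemma mat_adjoint_carrier [simp, intro]: "A \<in> carrier_mat m n \<Longrightarrow> mat_adjoint A \<in> carrier_mat n m"
  unfolding mat_adjoint_def by auto

lemma dim_mat_adjoint [simp]: "dim_row (mat_adjoint A) = dim_col A" "dim_col (mat_adjoint A) = dim_row A"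
  unfolding mat_adjoint_def by auto

lemma mat_adjoint_index [simp]:
  "i < dim_col A \<Longrightarrow> j < dim_row A \<Longrightarrow> mat_adjoint A $$ (i, j) = cnj ((A :: complex mat) $$ (j, i))"
  unfolding mat_adjoint_def by (simp add: mat_of_rows_index)

lemma index_mult_sum:
  assumes "A \<in> carrier_mat m n" "B \<in> carrier_mat n l" "i < m" "j < l"
  shows "(A * B) $$ (i, j) = (\<Sum>k<n. A $$ (i, k) * B $$ (k, j))"
  using assms by (auto simp: scalar_prod_def lessThan_atLeast0 intro!: sum.cong)

lemma mat_adjoint_mult:
  assumes A: "(A :: complex mat) \<in> carrier_mat m n" and B: "B \<in> carrier_mat n l"
  shows "mat_adjoint (A * B) = mat_adjoint B * mat_adjoint A"
proof (rule eq_matI)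
  fix i j assume "i < dim_row (mat_adjoint B * mat_adjoint A)" "j < dim_col (mat_adjoint B * mat_adjoint A)"
  then have i: "i < l" and j: "j < m" using A B by auto
  have "mat_adjoint (A * B) $$ (i, j) = cnj ((A * B) $$ (j, i))" using A B i j by simp
  also have "\<dots> = (\<Sum>k<n. cnj (A $$ (j, k)) * cnj (B $$ (k, i)))"
    by (subst index_mult_sum[OF A B j i]) (simp add: cnj_sum)
  also have "\<dots> = (\<Sum>k<n. mat_adjoint B $$ (i, k) * mat_adjoint A $$ (k, j))"
    using A B i j by (intro sum.cong) auto
  also have "\<dots> = (mat_adjoint B * mat_adjoint A) $$ (i, j)"
    by (rule index_mult_sum[symmetric]) (use A B i j in auto)
  finally show "mat_adjoint (A * B) $$ (i, j) = (mat_adjoint B * mat_adjoint A) $$ (i, j)" .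
qed (use A B in auto)

lemma mat_adjoint_adjoint [simp]: "mat_adjoint (mat_adjoint A) = (A :: complex mat)"
  by (rule eq_matI) auto

lemma mat_adjoint_one [simp]: "mat_adjoint (1\<^sub>m n) = (1\<^sub>m n :: complex mat)"
  by (rule eq_matI) auto

lemma mat_adjoint_add:
  "(A :: complex mat) \<in> carrier_mat m n \<Longrightarrow> B \<in> carrier_mat m n \<Longrightarrow>
    mat_adjoint (A + B) = mat_adjoint A + mat_adjoint B"
  by (rule eq_matI) auto

lemma mat_adjoint_smult: "mat_adjoint (c \<cdot>\<^sub>m A) = cnj c \<cdot>\<^sub>m mat_adjoint A"
  by (rule eq_matI) auto

lemma herm_carrier: "A \<in> herm n \<Longrightarrow> A \<in> carrier_mat n n"
  by (simp add: herm_def)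

lemma herm_adjoint: "A \<in> herm n \<Longrightarrow> mat_adjoint A = A"
  by (simp add: herm_def)

lemma herm_iff: "A \<in> herm n \<longleftrightarrow> A \<in> carrier_mat n n \<and> (\<forall>i<n. \<forall>j<n. A $$ (i, j) = cnj (A $$ (j, i)))"
proof
  assume A: "A \<in> herm n"
  show "A \<in> carrier_mat n n \<and> (\<forall>i<n. \<forall>j<n. A $$ (i, j) = cnj (A $$ (j, i)))"
  proof (intro conjI allI impI)
    show c: "A \<in> carrier_mat n n" by (rule herm_carrier[OF A])
    fix i j assume "i < n" "j < n"
    then show "A $$ (i, j) = cnj (A $$ (j, i))"
      using mat_adjoint_index[of i A j] herm_adjoint[OF A] c by simp
  qed
next
  assume "A \<in> carrier_mat n n \<and> (\<forall>i<n. \<forall>j<n. A $$ (i, j) = cnj (A $$ (j, i)))"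
  then have c: "A \<in> carrier_mat n n" and e: "\<And>i j. i < n \<Longrightarrow> j < n \<Longrightarrow> cnj (A $$ (j, i)) = A $$ (i, j)"
    by (metis carrier_matD)+
  have "mat_adjoint A = A" by (rule eq_matI) (use c e in auto)
  with c show "A \<in> herm n" by (simp add: herm_def)
qed

lemma hermI:
  "A \<in> carrier_mat n n \<Longrightarrow> (\<And>i j. i < n \<Longrightarrow> j < n \<Longrightarrow> A $$ (i, j) = cnj (A $$ (j, i))) \<Longrightarrow> A \<in> herm n"
  by (simp only: herm_iff) blast

text \<open>Both one-sided identities are recorded because orthonormality of rows and of columns is
  used separately; for square matrices either one yields the other.\<close>

definition unitary_mat :: "nat \<Rightarrow> complex mat \<Rightarrow> bool" where
  "unitary_mat n U \<longleftrightarrow> U \<in> carrier_mat n n \<and> U * mat_adjoint U = 1\<^sub>m n \<and> mat_adjoint U * U = 1\<^sub>m n"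

lemma unitary_matD:
  assumes "unitary_mat n U"
  shows "U \<in> carrier_mat n n" "U * mat_adjoint U = 1\<^sub>m n" "mat_adjoint U * U = 1\<^sub>m n"
  using assms by (auto simp: unitary_mat_def)

lemma unitary_matI_left:
  assumes U: "U \<in> carrier_mat n n" and "mat_adjoint U * U = 1\<^sub>m n"
  shows "unitary_mat n U"
  using assms mat_mult_left_right_inverse[of "mat_adjoint U" n U] by (auto simp: unitary_mat_def)

lemma unitary_matI_right:
  assumes U: "U \<in> carrier_mat n n" and "U * mat_adjoint U = 1\<^sub>m n"
  shows "unitary_mat n U"
  using assms mat_mult_left_right_inverse[of U n "mat_adjoint U"] by (auto simp: unitary_mat_def)

lemma unitary_mat_one: "unitary_mat n (1\<^sub>m n)"
  by (simp add: unitary_mat_def)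

lemma unitary_mat_adjoint: "unitary_mat n U \<Longrightarrow> unitary_mat n (mat_adjoint U)"
  by (auto simp: unitary_mat_def)

lemma unitary_mat_mult:
  assumes U: "unitary_mat n U" and V: "unitary_mat n V"
  shows "unitary_mat n (U * V)"
proof (rule unitary_matI_right)
  note u = unitary_matD[OF U] and v = unitary_matD[OF V]
  have c: "mat_adjoint U \<in> carrier_mat n n" "mat_adjoint V \<in> carrier_mat n n" using u v by auto
  show "U * V \<in> carrier_mat n n" using u v by auto
  have "(U * V) * mat_adjoint (U * V) = (U * V) * (mat_adjoint V * mat_adjoint U)"
    by (simp add: mat_adjoint_mult[OF u(1) v(1)])
  also have "\<dots> = U * (V * (mat_adjoint V * mat_adjoint U))"
    by (rule assoc_mult_mat) (use u(1) v(1) c in auto)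
  also have "V * (mat_adjoint V * mat_adjoint U) = V * mat_adjoint V * mat_adjoint U"
    by (rule assoc_mult_mat[symmetric]) (use u(1) v(1) c in auto)
  finally show "(U * V) * mat_adjoint (U * V) = 1\<^sub>m n" using u v c by simp
qed

lemma unitary_rows:
  assumes "unitary_mat n U" "i < n" "j < n"
  shows "(\<Sum>k<n. U $$ (i, k) * cnj (U $$ (j, k))) = (if i = j then 1 else 0)"
proof -
  have U: "U \<in> carrier_mat n n" using assms unitary_matD by auto
  have "(U * mat_adjoint U) $$ (i, j) = (\<Sum>k<n. U $$ (i, k) * mat_adjoint U $$ (k, j))"
    by (rule index_mult_sum) (use U assms in auto)
  also have "\<dots> = (\<Sum>k<n. U $$ (i, k) * cnj (U $$ (j, k)))"
    by (rule sum.cong) (use U assms in auto)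
  finally show ?thesis using unitary_matD(2)[OF assms(1)] assms by simp
qed

lemma unitary_cols:
  assumes "unitary_mat n U" "i < n" "j < n"
  shows "(\<Sum>k<n. cnj (U $$ (k, i)) * U $$ (k, j)) = (if i = j then 1 else 0)"
proof -
  have U: "U \<in> carrier_mat n n" using assms unitary_matD by auto
  have "(mat_adjoint U * U) $$ (i, j) = (\<Sum>k<n. mat_adjoint U $$ (i, k) * U $$ (k, j))"
    by (rule index_mult_sum) (use U assms in auto)
  also have "\<dots> = (\<Sum>k<n. cnj (U $$ (k, i)) * U $$ (k, j))"
    by (rule sum.cong) (use U assms in auto)
  finally show ?thesis using unitary_matD(3)[OF assms(1)] assms by simp
qed

text \<open>The normal form of the development: a Hermitian matrix and every function of it are
  written with the same \<open>U\<close>, so that algebra and functional calculus act on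
  \<open>f\<close> alone. \<open>U\<close> may fail to be unitary; \<open>psd_sandwich\<close> uses
  the frame \<open>p * X\<close>.\<close>

definition udiag :: "complex mat \<Rightarrow> (nat \<Rightarrow> real) \<Rightarrow> complex mat" where
  "udiag U f = U * mat_diag (dim_row U) (\<lambda>i. complex_of_real (f i)) * mat_adjoint U"

lemma udiag_carrier [simp, intro]: "U \<in> carrier_mat n n \<Longrightarrow> udiag U f \<in> carrier_mat n n"
  unfolding udiag_def by auto

lemma dim_udiag [simp]: "dim_row (udiag U f) = dim_row U" "dim_col (udiag U f) = dim_row U"
  by (auto simp: udiag_def)

lemma udiag_index:
  assumes U: "U \<in> carrier_mat n n" and i: "i < n" and j: "j < n"
  shows "udiag U f $$ (i, j) = (\<Sum>k<n. U $$ (i, k) * f k * cnj (U $$ (j, k)))"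
proof -
  have e: "U * mat_diag (dim_row U) (\<lambda>i. complex_of_real (f i)) = mat n n (\<lambda>(i, j). U $$ (i, j) * f j)"
    using U by (subst mat_diag_mult_right[of U n]) auto
  show ?thesis unfolding udiag_def e
    by (subst index_mult_sum[of _ n n]) (use U i j in \<open>auto intro!: sum.cong\<close>)
qed

lemma udiag_cong: "(\<And>i. i < dim_row U \<Longrightarrow> f i = g i) \<Longrightarrow> udiag U f = udiag U g"
  unfolding udiag_def mat_diag_def by (intro arg_cong2[where f="(*)"] eq_matI refl) auto

lemma udiag_herm:
  assumes U: "U \<in> carrier_mat n n"
  shows "udiag U f \<in> herm n"
  unfolding herm_iff using U by (auto simp: udiag_index cnj_sum intro!: sum.cong)

lemma udiag_mult:
  assumes U: "unitary_mat n U"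
  shows "udiag U f * udiag U g = udiag U (\<lambda>i. f i * g i)"
proof -
  note u = unitary_matD[OF U]
  let ?D = "mat_diag n (\<lambda>i. complex_of_real (f i))" and ?E = "mat_diag n (\<lambda>i. complex_of_real (g i))"
  let ?U = "mat_adjoint U"
  have c: "?U \<in> carrier_mat n n" "?D \<in> carrier_mat n n" "?E \<in> carrier_mat n n" "U \<in> carrier_mat n n"
    using u by auto
  have "udiag U f * udiag U g = U * ?D * ?U * (U * ?E * ?U)" using u by (simp add: udiag_def)
  also have "\<dots> = U * ?D * (?U * (U * ?E * ?U))"
    using c by (simp add: assoc_mult_square[of _ n])
  also have "?U * (U * ?E * ?U) = ?U * U * (?E * ?U)"
    using c by (simp add: assoc_mult_square[of _ n])
  also have "\<dots> = ?E * ?U" unfolding u(3) by (rule left_mult_one_mat[of _ n n]) (use c in simp)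
  also have "U * ?D * (?E * ?U) = U * (?D * ?E) * ?U"
    using c by (simp add: assoc_mult_square[of _ n] del: mat_diag_diag)
  finally show ?thesis using u by (simp add: udiag_def)
qed

lemma udiag_add:
  assumes U: "U \<in> carrier_mat n n"
  shows "udiag U f + udiag U g = udiag U (\<lambda>i. f i + g i)"
  by (rule eq_matI) (use U in \<open>auto simp: udiag_index algebra_simps sum.distrib\<close>)

lemma udiag_smult:
  assumes U: "U \<in> carrier_mat n n"
  shows "complex_of_real c \<cdot>\<^sub>m udiag U f = udiag U (\<lambda>i. c * f i)"
  by (rule eq_matI) (use U in \<open>auto simp: udiag_index algebra_simps sum_distrib_left\<close>)

lemma udiag_minus:
  assumes U: "U \<in> carrier_mat n n"
  shows "udiag U f - udiag U g = udiag U (\<lambda>i. f i - g i)"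
  by (rule eq_matI) (use U in \<open>auto simp: udiag_index algebra_simps sum_subtractf\<close>)

lemma udiag_const_one: "unitary_mat n U \<Longrightarrow> udiag U (\<lambda>_. 1) = 1\<^sub>m n"
  using unitary_matD[of n U] by (simp add: udiag_def)

section \<open>The spectral theorem\<close>

text \<open>Gram-Schmidt applied to a basis that starts with \<open>v\<close> keeps \<open>v\<close>
  as its first vector; dividing each vector by its norm gives the columns of
  \<open>W\<close>.\<close>

lemma unitary_first_column:
  assumes v: "(v :: complex vec) \<in> carrier_vec n" and v0: "v \<noteq> 0\<^sub>v n" and n: "0 < n"
  shows "\<exists>W c. unitary_mat n W \<and> c \<noteq> 0 \<and> col W 0 = c \<cdot>\<^sub>v v"
proof -
  interpret cof_vec_space n "TYPE(complex)" .
  define b where "b = basis_completion v"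
  define ws where "ws = gram_schmidt n b"
  from basis_completion[OF v v0, folded b_def]
  have dist_b: "distinct b" and indep: "\<not> lin_dep (set b)" and b: "set b \<subseteq> carrier_vec n"
    and hdb: "hd b = v" and len_b: "length b = n" by auto
  from hdb len_b n obtain vs where bv: "b = v # vs" by (cases b, auto)
  from gram_schmidt_result[OF b dist_b indep refl, folded ws_def]
  have ws: "set ws \<subseteq> carrier_vec n" "corthogonal ws" "length ws = n"
    by (auto simp: len_b)
  from gram_schmidt_hd[OF v, of vs, folded bv] have "hd ws = v" unfolding ws_def .
  then have ws0: "ws ! 0 = v" using ws n by (metis hd_conv_nth length_greater_0_conv)
  have wc: "ws ! i \<in> carrier_vec n" if "i < n" for i using ws that by auto
  define r where "r i = (\<Sum>k<n. (cmod (ws ! i $ k))\<^sup>2)" for i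
  have cs: "ws ! i \<bullet>c ws ! j = (\<Sum>k<n. ws ! i $ k * cnj (ws ! j $ k))" if "i < n" "j < n" for i j
    using wc[OF that(1)] wc[OF that(2)] by (auto simp: scalar_prod_def lessThan_atLeast0 intro!: sum.cong)
  have rr: "ws ! i \<bullet>c ws ! i = complex_of_real (r i)" if "i < n" for i
    using cs[OF that that] by (simp only: r_def complex_norm_square of_real_sum)
  have r0: "0 < r i" if "i < n" for i
  proof -
    have "ws ! i \<bullet>c ws ! i \<noteq> 0" using corthogonalD[OF ws(2), of i i] ws(3) that by auto
    then have "r i \<noteq> 0" using rr[OF that] by auto
    moreover have "0 \<le> r i" unfolding r_def by (rule sum_nonneg) auto
    ultimately show ?thesis by simp
  qed
  have orth: "(\<Sum>k<n. ws ! i $ k * cnj (ws ! j $ k)) = (if i = j then complex_of_real (r i) else 0)"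
    if "i < n" "j < n" for i j
    using cs[OF that] rr[OF that(1)] corthogonalD[OF ws(2), of i j] ws(3) that by (cases "i = j") auto
  define W where "W = mat n n (\<lambda>(k, i). ws ! i $ k / complex_of_real (sqrt (r i)))"
  have Wc: "W \<in> carrier_mat n n" by (simp add: W_def)
  have "unitary_mat n W"
  proof (rule unitary_matI_left[OF Wc], rule eq_matI)
    fix i j assume "i < dim_row (1\<^sub>m n :: complex mat)" "j < dim_col (1\<^sub>m n :: complex mat)"
    then have i: "i < n" and j: "j < n" by auto
    have "(mat_adjoint W * W) $$ (i, j) = (\<Sum>k<n. mat_adjoint W $$ (i, k) * W $$ (k, j))"
      by (rule index_mult_sum) (use Wc i j in auto)
    also have "\<dots> = (\<Sum>k<n. ws ! j $ k * cnj (ws ! i $ k) / (complex_of_real (sqrt (r i)) * complex_of_real (sqrt (r j))))"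
      using i j Wc by (intro sum.cong) (auto simp: W_def)
    also have "\<dots> = (if j = i then complex_of_real (r j) else 0) / (complex_of_real (sqrt (r i)) * complex_of_real (sqrt (r j)))"
      unfolding sum_divide_distrib[symmetric] orth[OF j i] ..
    also have "\<dots> = (if i = j then 1 else 0)"
    proof (cases "i = j")
      case True
      have "complex_of_real (sqrt (r j)) * complex_of_real (sqrt (r j)) = complex_of_real (r j)"
        using r0[OF j] by (simp flip: of_real_mult)
      then show ?thesis using True r0[OF j] by simp
    qed simp
    finally show "(mat_adjoint W * W) $$ (i, j) = 1\<^sub>m n $$ (i, j)" using i j by simp
  qed (use Wc in auto)
  moreover have "col W 0 = complex_of_real (1 / sqrt (r 0)) \<cdot>\<^sub>v v"
    using n v ws0 by (intro eq_vecI) (auto simp: W_def)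
  moreover have "complex_of_real (1 / sqrt (r 0)) \<noteq> 0" using r0[OF n] by simp
  ultimately show ?thesis by blast
qed

lemma complex_eigenvector_exists:
  assumes A: "(A :: complex mat) \<in> carrier_mat n n" and n: "0 < n"
  shows "\<exists>v e. v \<in> carrier_vec n \<and> v \<noteq> 0\<^sub>v n \<and> A *\<^sub>v v = e \<cdot>\<^sub>v v"
proof -
  have "degree (char_poly A) = n" using degree_monic_char_poly[OF A] by simp
  then have "\<not> constant (poly (char_poly A))" using n constant_degree[of "char_poly A"] by simp
  then obtain e where "poly (char_poly A) e = 0" using fundamental_theorem_of_algebra by blast
  then have "eigenvalue A e" using eigenvalue_root_char_poly[OF A] by simp
  then show ?thesis using A unfolding eigenvalue_def eigenvector_def by auto
qed

lemma unitary_conj_herm: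
  assumes W: "W \<in> carrier_mat n n" and A: "A \<in> herm n"
  shows "mat_adjoint W * A * W \<in> herm n"
proof -
  have Ac: "A \<in> carrier_mat n n" using A by (rule herm_carrier)
  have "mat_adjoint (mat_adjoint W * A * W) = mat_adjoint W * (A * W)"
    using W Ac herm_adjoint[OF A] by (simp add: mat_adjoint_mult[where m=n and n=n and l=n])
  also have "\<dots> = mat_adjoint W * A * W" using W Ac by (intro assoc_mult_mat[symmetric]) auto
  finally show ?thesis using W Ac by (auto simp: herm_def)
qed

lemma unitary_conj_udiag:
  assumes W: "unitary_mat n W" and A: "A \<in> carrier_mat n n" and U: "unitary_mat n U"
    and eq: "mat_adjoint W * A * W = udiag U l"
  shows "A = udiag (W * U) l"
proof -
  note w = unitary_matD[OF W] and u = unitary_matD[OF U]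
  let ?D = "mat_diag n (\<lambda>i. complex_of_real (l i))"
  have c: "W \<in> carrier_mat n n" "U \<in> carrier_mat n n" "mat_adjoint W \<in> carrier_mat n n"
    "mat_adjoint U \<in> carrier_mat n n" "?D \<in> carrier_mat n n" using w u by auto
  note as = assoc_mult_square[of _ n]
  have "udiag (W * U) l = W * U * ?D * (mat_adjoint U * mat_adjoint W)"
    using c by (simp add: udiag_def mat_adjoint_mult[where m=n and n=n and l=n])
  also have "\<dots> = W * (U * ?D * mat_adjoint U) * mat_adjoint W"
    using c by (simp add: as)
  also have "U * ?D * mat_adjoint U = mat_adjoint W * A * W" using eq u by (simp add: udiag_def)
  also have "W * (mat_adjoint W * A * W) * mat_adjoint W = (W * mat_adjoint W) * A * (W * mat_adjoint W)"
    using c A by (simp add: as)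
  also have "\<dots> = A" using w(2) A by simp
  finally show ?thesis by simp
qed

text \<open>Deflation. Conjugation with a unitary whose first column is an eigenvector clears the
  first column below the diagonal, Hermitian symmetry clears the first row, and the remaining block
  is Hermitian of smaller size. The eigenbasis of the block is extended by a leading 1.\<close>

theorem herm_spectral:
  "A \<in> herm n \<Longrightarrow> \<exists>U l. unitary_mat n U \<and> A = udiag U l"
proof (induction n arbitrary: A)
  case 0
  then have "A = udiag (1\<^sub>m 0) (\<lambda>_. 0)" by (intro eq_matI) (auto simp: herm_def)
  then show ?case using unitary_mat_one by blast
next
  case (Suc m)
  let ?n = "Suc m"
  have Ac: "A \<in> carrier_mat ?n ?n" using Suc.prems by (rule herm_carrier)
  obtain v e where v: "v \<in> carrier_vec ?n" "v \<noteq> 0\<^sub>v ?n" and Av: "A *\<^sub>v v = e \<cdot>\<^sub>v v"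
    using complex_eigenvector_exists[OF Ac] by auto
  obtain W c where W: "unitary_mat ?n W" and c: "col W 0 = c \<cdot>\<^sub>v v"
    using unitary_first_column[OF v] by auto
  have Wc: "W \<in> carrier_mat ?n ?n" using unitary_matD[OF W] by auto
  have ev: "A *\<^sub>v col W 0 = e \<cdot>\<^sub>v col W 0"
    unfolding c using v Av Ac by (simp add: mult_mat_vec smult_smult_assoc mult.commute)
  define A' where "A' = mat_adjoint W * A * W"
  have A'h: "A' \<in> herm ?n" unfolding A'_def by (rule unitary_conj_herm[OF Wc Suc.prems])
  have A'c: "A' \<in> carrier_mat ?n ?n" using A'h by (rule herm_carrier)
  have A'0: "A' $$ (i, 0) = (if i = 0 then e else 0)" if i: "i < ?n" for i
  proof -
    have "A' $$ (i, 0) = (mat_adjoint W * (A * W)) $$ (i, 0)"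
      unfolding A'_def using Wc Ac by (subst assoc_mult_mat[of _ ?n ?n _ ?n _ ?n]) auto
    also have "\<dots> = (\<Sum>k<?n. mat_adjoint W $$ (i, k) * (A * W) $$ (k, 0))"
      by (rule index_mult_sum) (use Wc Ac i in auto)
    also have "\<dots> = (\<Sum>k<?n. cnj (W $$ (k, i)) * (e * W $$ (k, 0)))"
    proof (rule sum.cong[OF refl])
      fix k assume "k \<in> {..<?n}"
      then have k: "k < ?n" by simp
      have "(A * W) $$ (k, 0) = (A *\<^sub>v col W 0) $ k" using Ac Wc k by auto
      also have "\<dots> = e * W $$ (k, 0)" unfolding ev using Wc k by auto
      finally show "mat_adjoint W $$ (i, k) * (A * W) $$ (k, 0) = cnj (W $$ (k, i)) * (e * W $$ (k, 0))"
        using Wc i k by simp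
    qed
    also have "\<dots> = e * (\<Sum>k<?n. cnj (W $$ (k, i)) * W $$ (k, 0))"
      by (simp add: sum_distrib_left mult_ac del: sum.lessThan_Suc)
    also have "\<dots> = (if i = 0 then e else 0)" using unitary_cols[OF W i, of 0] by simp
    finally show ?thesis .
  qed
  have A'sym: "A' $$ (i, j) = cnj (A' $$ (j, i))" if "i < ?n" "j < ?n" for i j
    using A'h that unfolding herm_iff by blast
  have A'0': "A' $$ (0, i) = (if i = 0 then e else 0)" if i: "i < ?n" for i
    using A'sym[of 0 i] A'0[OF i] A'0[of 0] i by auto
  \<comment> \<open>A diagonal entry of a Hermitian matrix is real; \<open>udiag\<close> accepts
    real eigenvalues only.\<close>
  have er: "e = complex_of_real (Re e)"
    using A'sym[of 0 0] A'0[of 0] by (simp add: complex_eq_iff)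
  define B where "B = mat m m (\<lambda>(i, j). A' $$ (Suc i, Suc j))"
  have "B $$ (i, j) = cnj (B $$ (j, i))" if "i < m" "j < m" for i j
    using A'sym[of "Suc i" "Suc j"] that by (simp add: B_def)
  then have "B \<in> herm m" by (rule hermI[rotated]) (simp_all add: B_def)
  then obtain U l where U: "unitary_mat m U" and B: "B = udiag U l" using Suc.IH by blast
  have Uc: "U \<in> carrier_mat m m" using unitary_matD[OF U] by auto
  define U' where "U' = mat ?n ?n (\<lambda>(i, j). case i of 0 \<Rightarrow> (case j of 0 \<Rightarrow> 1 | Suc j \<Rightarrow> 0)
     | Suc i \<Rightarrow> (case j of 0 \<Rightarrow> 0 | Suc j \<Rightarrow> U $$ (i, j)))"
  define l' where "l' i = (case i of 0 \<Rightarrow> Re e | Suc i \<Rightarrow> l i)" for i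
  have U'c: "U' \<in> carrier_mat ?n ?n" by (simp add: U'_def)
  have U'e: "U' $$ (0, 0) = 1" "\<And>j. j < m \<Longrightarrow> U' $$ (0, Suc j) = 0" "\<And>j. j < m \<Longrightarrow> U' $$ (Suc j, 0) = 0"
    "\<And>i j. i < m \<Longrightarrow> j < m \<Longrightarrow> U' $$ (Suc i, Suc j) = U $$ (i, j)"
    by (auto simp: U'_def)
  have "unitary_mat ?n U'"
  proof (rule unitary_matI_right[OF U'c], rule eq_matI)
    fix i j assume "i < dim_row (1\<^sub>m ?n :: complex mat)" "j < dim_col (1\<^sub>m ?n :: complex mat)"
    then have i: "i < ?n" and j: "j < ?n" by auto
    have "(U' * mat_adjoint U') $$ (i, j) = (\<Sum>k<?n. U' $$ (i, k) * mat_adjoint U' $$ (k, j))"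
      by (rule index_mult_sum) (use U'c i j in auto)
    also have "\<dots> = (\<Sum>k<?n. U' $$ (i, k) * cnj (U' $$ (j, k)))"
      by (rule sum.cong) (use U'c i j in auto)
    also have "\<dots> = U' $$ (i, 0) * cnj (U' $$ (j, 0)) + (\<Sum>k<m. U' $$ (i, Suc k) * cnj (U' $$ (j, Suc k)))"
      by (rule sum.lessThan_Suc_shift)
    also have "\<dots> = (if i = j then 1 else 0)"
      using i j by (cases i; cases j) (auto simp: U'e unitary_rows[OF U])
    finally show "(U' * mat_adjoint U') $$ (i, j) = 1\<^sub>m ?n $$ (i, j)" using i j by simp
  qed (use U'c in auto)
  moreover have "A' = udiag U' l'"
  proof (rule eq_matI)
    fix i j assume "i < dim_row (udiag U' l')" "j < dim_col (udiag U' l')"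
    then have i: "i < ?n" and j: "j < ?n" using U'c by auto
    have "udiag U' l' $$ (i, j) = U' $$ (i, 0) * l' 0 * cnj (U' $$ (j, 0)) +
        (\<Sum>k<m. U' $$ (i, Suc k) * l' (Suc k) * cnj (U' $$ (j, Suc k)))"
      unfolding udiag_index[OF U'c i j] by (rule sum.lessThan_Suc_shift)
    also have "\<dots> = A' $$ (i, j)"
    proof (cases i)
      case 0
      then show ?thesis using j er A'0'[OF j] by (cases j) (auto simp: U'e l'_def)
    next
      case (Suc i')
      show ?thesis
      proof (cases j)
        case 0
        then show ?thesis using i Suc A'0[OF i] by (auto simp: U'e)
      next
        case (Suc j')
        have "B $$ (i', j') = (\<Sum>k<m. U $$ (i', k) * l k * cnj (U $$ (j', k)))"
          unfolding B by (rule udiag_index) (use Uc i j \<open>i = Suc i'\<close> Suc in auto)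
        then show ?thesis using i j \<open>i = Suc i'\<close> Suc by (auto simp: U'e l'_def B_def)
      qed
    qed
    finally show "A' $$ (i, j) = udiag U' l' $$ (i, j)" by simp
  qed (use U'c A'c in auto)
  ultimately have "A = udiag (W * U') l'" "unitary_mat ?n (W * U')"
    using unitary_conj_udiag[OF W Ac] unitary_mat_mult[OF W] by (auto simp: A'_def)
  then show ?case by blast
qed

section \<open>The trace inner product\<close>

lemma mtrace_mult:
  assumes "A \<in> carrier_mat n n" "B \<in> carrier_mat n n"
  shows "mtrace (A * B) = (\<Sum>i<n. \<Sum>k<n. A $$ (i, k) * B $$ (k, i))"
proof -
  have "(A * B) $$ (i, i) = (\<Sum>k<n. A $$ (i, k) * B $$ (k, i))" if "i < n" for i
    using assms that by (intro index_mult_sum) auto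
  then show ?thesis unfolding mtrace_def using assms by (auto intro!: sum.cong simp del: index_mult_mat(1))
qed

lemma hs_inner_sum:
  assumes "A \<in> carrier_mat n n" "B \<in> carrier_mat n n"
  shows "hs_inner A B = (\<Sum>i<n. \<Sum>k<n. Re (A $$ (i, k) * B $$ (k, i)))"
  unfolding hs_inner_def mtrace_mult[OF assms] by simp

lemma hs_inner_commute:
  assumes "A \<in> carrier_mat n n" "B \<in> carrier_mat n n"
  shows "hs_inner A B = hs_inner B A"
  unfolding hs_inner_sum[OF assms] hs_inner_sum[OF assms(2,1)]
  by (subst sum.swap) (simp add: mult.commute)

lemma hs_inner_add_right:
  assumes "A \<in> carrier_mat n n" "B \<in> carrier_mat n n" "C \<in> carrier_mat n n"
  shows "hs_inner A (B + C) = hs_inner A B + hs_inner A C"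
proof -
  have "hs_inner A (B + C) = (\<Sum>i<n. \<Sum>k<n. Re (A $$ (i, k) * (B + C) $$ (k, i)))"
    using assms by (intro hs_inner_sum) auto
  also have "\<dots> = (\<Sum>i<n. \<Sum>k<n. Re (A $$ (i, k) * B $$ (k, i)) + Re (A $$ (i, k) * C $$ (k, i)))"
    using assms by (intro sum.cong refl) (simp add: algebra_simps)
  finally show ?thesis unfolding hs_inner_sum[OF assms(1,2)] hs_inner_sum[OF assms(1,3)]
    by (simp only: sum.distrib)
qed

lemma hs_inner_minus_right:
  assumes "A \<in> carrier_mat n n" "B \<in> carrier_mat n n" "C \<in> carrier_mat n n"
  shows "hs_inner A (B - C) = hs_inner A B - hs_inner A C"
proof -
  have "hs_inner A (B - C) = (\<Sum>i<n. \<Sum>k<n. Re (A $$ (i, k) * (B - C) $$ (k, i)))"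
    using assms by (intro hs_inner_sum) auto
  also have "\<dots> = (\<Sum>i<n. \<Sum>k<n. Re (A $$ (i, k) * B $$ (k, i)) - Re (A $$ (i, k) * C $$ (k, i)))"
    using assms by (intro sum.cong refl) (simp add: algebra_simps)
  finally show ?thesis unfolding hs_inner_sum[OF assms(1,2)] hs_inner_sum[OF assms(1,3)]
    by (simp only: sum_subtractf)
qed

lemma hs_inner_smult_right:
  assumes "A \<in> carrier_mat n n" "B \<in> carrier_mat n n"
  shows "hs_inner A (complex_of_real c \<cdot>\<^sub>m B) = c * hs_inner A B"
proof -
  have "hs_inner A (complex_of_real c \<cdot>\<^sub>m B) = (\<Sum>i<n. \<Sum>k<n. Re (A $$ (i, k) * (complex_of_real c \<cdot>\<^sub>m B) $$ (k, i)))"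
    using assms by (intro hs_inner_sum) auto
  also have "\<dots> = (\<Sum>i<n. \<Sum>k<n. c * Re (A $$ (i, k) * B $$ (k, i)))"
    using assms by (intro sum.cong refl) (simp add: algebra_simps)
  finally show ?thesis unfolding hs_inner_sum[OF assms] by (simp only: sum_distrib_left)
qed

lemma hs_inner_add_left:
  assumes "A \<in> carrier_mat n n" "B \<in> carrier_mat n n" "C \<in> carrier_mat n n"
  shows "hs_inner (B + C) A = hs_inner B A + hs_inner C A"
  using hs_inner_add_right[OF assms] assms by (simp add: hs_inner_commute[of _ n A])

lemma hs_inner_minus_left:
  assumes "A \<in> carrier_mat n n" "B \<in> carrier_mat n n" "C \<in> carrier_mat n n"
  shows "hs_inner (B - C) A = hs_inner B A - hs_inner C A"
  using hs_inner_minus_right[OF assms] assms by (simp add: hs_inner_commute[of _ n A] minus_carrier_mat)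

lemma hs_inner_smult_left:
  assumes "A \<in> carrier_mat n n" "B \<in> carrier_mat n n"
  shows "hs_inner (complex_of_real c \<cdot>\<^sub>m B) A = c * hs_inner B A"
  using hs_inner_smult_right[OF assms] assms by (simp add: hs_inner_commute[of _ n A])

text \<open>Cyclicity of the trace: the symmetry of \<open>hs_inner\<close> is used once, with the
  product regrouped before and after.\<close>

lemma hs_inner_sandwich:
  assumes "p \<in> carrier_mat n n" "A \<in> carrier_mat n n" "B \<in> carrier_mat n n"
  shows "hs_inner (p * A * p) B = hs_inner A (p * B * p)"
proof -
  have "hs_inner (p * A * p) B = hs_inner p (A * p * B)"
    unfolding hs_inner_def using assms by (simp add: assoc_mult_square[of _ n])
  also have "\<dots> = hs_inner (A * p * B) p" by (rule hs_inner_commute[of _ n]) (use assms in \<open>auto intro!: mult_square_carrier\<close>)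
  also have "\<dots> = hs_inner A (p * B * p)"
    unfolding hs_inner_def using assms by (simp add: assoc_mult_square[of _ n])
  finally show ?thesis .
qed

text \<open>On Hermitian matrices the trace form is the squared Frobenius norm. This gives
  definiteness and links \<open>hs_inner\<close> to entrywise convergence.\<close>

lemma hs_inner_self:
  assumes "A \<in> herm n"
  shows "hs_inner A A = (\<Sum>i<n. \<Sum>k<n. (cmod (A $$ (i, k)))\<^sup>2)"
proof -
  have A: "A \<in> carrier_mat n n" using assms by (rule herm_carrier)
  have "Re (A $$ (i, k) * A $$ (k, i)) = (cmod (A $$ (i, k)))\<^sup>2" if "i < n" "k < n" for i k
  proof -
    have "A $$ (k, i) = cnj (A $$ (i, k))" using assms that unfolding herm_iff by blast
    then show ?thesis by (simp add: complex_norm_square[symmetric] flip: of_real_power)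
  qed
  then show ?thesis unfolding hs_inner_sum[OF A A] by simp
qed

lemma hs_inner_self_nonneg: "A \<in> herm n \<Longrightarrow> 0 \<le> hs_inner A A"
  by (simp add: hs_inner_self sum_nonneg)

lemma hs_inner_self_eq_0:
  assumes "A \<in> herm n" "hs_inner A A = 0"
  shows "A = 0\<^sub>m n n"
proof (rule eq_matI)
  fix i j assume "i < dim_row (0\<^sub>m n n :: complex mat)" "j < dim_col (0\<^sub>m n n :: complex mat)"
  then have ij: "i < n" "j < n" by auto
  have "(\<Sum>i<n. \<Sum>k<n. (cmod (A $$ (i, k)))\<^sup>2) = 0" using assms hs_inner_self by simp
  then have "\<forall>i\<in>{..<n}. (\<Sum>k<n. (cmod (A $$ (i, k)))\<^sup>2) = 0"
    by (subst (asm) sum_nonneg_eq_0_iff) (auto intro: sum_nonneg)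
  then have "(\<Sum>k<n. (cmod (A $$ (i, k)))\<^sup>2) = 0" using ij by simp
  then have "\<forall>k\<in>{..<n}. (cmod (A $$ (i, k)))\<^sup>2 = 0"
    by (subst (asm) sum_nonneg_eq_0_iff) auto
  then show "A $$ (i, j) = 0\<^sub>m n n $$ (i, j)" using ij by simp
qed (use herm_carrier[OF assms(1)] in auto)

lemma herm_add: "A \<in> herm n \<Longrightarrow> B \<in> herm n \<Longrightarrow> A + B \<in> herm n"
  by (simp add: herm_def mat_adjoint_add[of _ n n])

lemma herm_smult: "A \<in> herm n \<Longrightarrow> complex_of_real c \<cdot>\<^sub>m A \<in> herm n"
  by (simp add: herm_def mat_adjoint_smult)

lemma herm_minus: "A \<in> herm n \<Longrightarrow> B \<in> herm n \<Longrightarrow> A - B \<in> herm n"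
proof (rule hermI)
  assume h: "A \<in> herm n" "B \<in> herm n"
  note c = herm_carrier[OF h(1)] herm_carrier[OF h(2)]
  show "A - B \<in> carrier_mat n n" using c by auto
  fix i j assume ij: "i < n" "j < n"
  have "A $$ (i, j) = cnj (A $$ (j, i))" "B $$ (i, j) = cnj (B $$ (j, i))"
    using h ij unfolding herm_iff by blast+
  then show "(A - B) $$ (i, j) = cnj ((A - B) $$ (j, i))" using c ij by (simp del: complex_cnj_cancel_iff)
qed

lemma herm_one [simp]: "1\<^sub>m n \<in> herm n"
  by (simp add: herm_def)

lemma herm_zero [simp]: "0\<^sub>m n n \<in> herm n"
  by (rule hermI) auto

lemma herm_sandwich: "p \<in> herm n \<Longrightarrow> A \<in> herm n \<Longrightarrow> p * A * p \<in> herm n"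
  using unitary_conj_herm[of p n A] by (simp add: herm_def)

section \<open>Overlaps of two eigenbases\<close>

text \<open>The squared overlap of column \<open>i\<close> of \<open>U\<close> with column
  \<open>j\<close> of \<open>V\<close>. For unitary matrices it is doubly stochastic and serves as a
  coupling of two spectra.\<close>

definition ov :: "complex mat \<Rightarrow> complex mat \<Rightarrow> nat \<Rightarrow> nat \<Rightarrow> real" where
  "ov U V i j = (cmod ((mat_adjoint U * V) $$ (i, j)))\<^sup>2"

lemma ov_nonneg [simp]: "0 \<le> ov U V i j"
  by (simp add: ov_def)

lemma adj_mult_index:
  assumes "U \<in> carrier_mat n n" "V \<in> carrier_mat n n" "i < n" "j < n"
  shows "(mat_adjoint U * V) $$ (i, j) = (\<Sum>k<n. cnj (U $$ (k, i)) * V $$ (k, j))"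
  by (subst index_mult_sum[of _ n n]) (use assms in \<open>auto intro!: sum.cong\<close>)

text \<open>In the fourfold sum the two row indices occur only in a product
  \<open>cnj M * M\<close>, where \<open>M\<close> is an entry of \<open>mat_adjoint U * V\<close>.
  Summing over them first leaves the overlap.\<close>

lemma hs_inner_udiag:
  assumes U: "U \<in> carrier_mat n n" and V: "V \<in> carrier_mat n n"
  shows "hs_inner (udiag U f) (udiag V g) = (\<Sum>i<n. \<Sum>j<n. f i * g j * ov U V i j)"
proof -
  let ?M = "\<lambda>i j. \<Sum>k<n. cnj (U $$ (k, i)) * V $$ (k, j)"
  let ?t = "\<lambda>x y i j. U $$ (x, i) * f i * cnj (U $$ (y, i)) * (V $$ (y, j) * g j * cnj (V $$ (x, j)))"
  have "mtrace (udiag U f * udiag V g) = (\<Sum>x<n. \<Sum>y<n. \<Sum>i<n. \<Sum>j<n. ?t x y i j)"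
    unfolding mtrace_mult[OF udiag_carrier[OF U] udiag_carrier[OF V]]
    by (auto simp: udiag_index[OF U] udiag_index[OF V] sum_product intro!: sum.cong)
  also have "\<dots> = (\<Sum>x<n. \<Sum>i<n. \<Sum>y<n. \<Sum>j<n. ?t x y i j)"
    by (rule sum.cong[OF refl], rule sum.swap)
  also have "\<dots> = (\<Sum>i<n. \<Sum>x<n. \<Sum>y<n. \<Sum>j<n. ?t x y i j)" by (rule sum.swap)
  also have "\<dots> = (\<Sum>i<n. \<Sum>x<n. \<Sum>j<n. \<Sum>y<n. ?t x y i j)"
    by (intro sum.cong[OF refl] sum.swap)
  also have "\<dots> = (\<Sum>i<n. \<Sum>j<n. \<Sum>x<n. \<Sum>y<n. ?t x y i j)"
    by (rule sum.cong[OF refl], rule sum.swap)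
  also have "\<dots> = (\<Sum>i<n. \<Sum>j<n. complex_of_real (f i * g j * ov U V i j))"
  proof (intro sum.cong refl)
    fix i j assume "i \<in> {..<n}" "j \<in> {..<n}"
    then have ij: "i < n" "j < n" by auto
    have "(\<Sum>x<n. \<Sum>y<n. ?t x y i j) = (\<Sum>x<n. \<Sum>y<n. complex_of_real (f i * g j) *
        (cnj (cnj (U $$ (x, i)) * V $$ (x, j)) * (cnj (U $$ (y, i)) * V $$ (y, j))))"
      by (simp add: mult_ac)
    also have "\<dots> = complex_of_real (f i * g j) * (cnj (?M i j) * ?M i j)"
      unfolding cnj_sum sum_product by (simp only: sum_distrib_left)
    also have "cnj (?M i j) * ?M i j = complex_of_real (ov U V i j)"
      unfolding ov_def adj_mult_index[OF U V ij] by (simp only: complex_norm_square mult.commute)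
    finally show "(\<Sum>x<n. \<Sum>y<n. ?t x y i j) = complex_of_real (f i * g j * ov U V i j)" by simp
  qed
  finally show ?thesis by (simp add: hs_inner_def)
qed

lemma ov_sum_left:
  assumes U: "unitary_mat n U" and V: "unitary_mat n V" and j: "j < n"
  shows "(\<Sum>i<n. ov U V i j) = 1"
proof -
  have "unitary_mat n (mat_adjoint U * V)" using U V by (intro unitary_mat_mult unitary_mat_adjoint)
  from unitary_cols[OF this j j]
  have "complex_of_real (\<Sum>i<n. ov U V i j) = 1"
    unfolding ov_def of_real_sum complex_norm_square by (simp add: mult.commute)
  then show ?thesis by (simp only: of_real_eq_1_iff)
qed

lemma ov_sum_right:
  assumes U: "unitary_mat n U" and V: "unitary_mat n V" and i: "i < n"
  shows "(\<Sum>j<n. ov U V i j) = 1"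
proof -
  have "unitary_mat n (mat_adjoint U * V)" using U V by (intro unitary_mat_mult unitary_mat_adjoint)
  from unitary_rows[OF this i i]
  have "complex_of_real (\<Sum>j<n. ov U V i j) = 1"
    unfolding ov_def of_real_sum complex_norm_square by simp
  then show ?thesis by (simp only: of_real_eq_1_iff)
qed

lemma ov_self:
  assumes U: "unitary_mat n U" and "i < n" "j < n"
  shows "ov U U i j = (if i = j then 1 else 0)"
  using unitary_matD(3)[OF U] assms by (simp add: ov_def)

lemma ov_sums:
  assumes U: "unitary_mat n U" and V: "unitary_mat n V"
  shows "(\<Sum>i<n. \<Sum>j<n. f i * ov U V i j) = (\<Sum>i<n. f i)"
    and "(\<Sum>i<n. \<Sum>j<n. g j * ov U V i j) = (\<Sum>j<n. g j)"
proof -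
  show "(\<Sum>i<n. \<Sum>j<n. f i * ov U V i j) = (\<Sum>i<n. f i)"
    by (auto simp: sum_distrib_left[symmetric] ov_sum_right[OF U V])
  show "(\<Sum>i<n. \<Sum>j<n. g j * ov U V i j) = (\<Sum>j<n. g j)"
    by (subst sum.swap) (auto simp: sum_distrib_left[symmetric] ov_sum_left[OF U V])
qed

lemma hs_inner_udiag_same:
  assumes U: "unitary_mat n U"
  shows "hs_inner (udiag U f) (udiag U g) = (\<Sum>i<n. f i * g i)"
proof -
  have "hs_inner (udiag U f) (udiag U g) = (\<Sum>i<n. \<Sum>j<n. if i = j then f i * g j else 0)"
    unfolding hs_inner_udiag[OF unitary_matD(1)[OF U] unitary_matD(1)[OF U]]
    by (intro sum.cong refl) (auto simp: ov_self[OF U])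
  then show ?thesis by simp
qed

lemma hs_inner_one_udiag:
  assumes U: "unitary_mat n U"
  shows "hs_inner (1\<^sub>m n) (udiag U f) = (\<Sum>i<n. f i)"
  using hs_inner_udiag_same[OF U, of "\<lambda>_. 1" f] udiag_const_one[OF U] by simp

lemma hs_inner_one: "A \<in> carrier_mat n n \<Longrightarrow> hs_inner (1\<^sub>m n) A = Re (mtrace A)"
  by (simp add: hs_inner_def)

lemma mtrace_herm_real: "A \<in> herm n \<Longrightarrow> mtrace A = complex_of_real (Re (mtrace A))"
proof -
  assume A: "A \<in> herm n"
  have "Im (A $$ (i, i)) = 0" if "i < n" for i
  proof -
    have "A $$ (i, i) = cnj (A $$ (i, i))" using A that unfolding herm_iff by blast
    then show ?thesis by (metis complex_cnj_cnj Im_complex_of_real Reals_cases Reals_cnj_iff)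
  qed
  then show ?thesis using herm_carrier[OF A] by (simp add: mtrace_def complex_eq_iff)
qed

lemma mtrace_udiag:
  assumes U: "unitary_mat n U"
  shows "mtrace (udiag U f) = complex_of_real (\<Sum>i<n. f i)"
proof -
  have "mtrace (udiag U f) = complex_of_real (Re (mtrace (udiag U f)))"
    by (rule mtrace_herm_real[OF udiag_herm]) (rule unitary_matD(1)[OF U])
  then show ?thesis
    using hs_inner_one_udiag[OF U, of f] unitary_matD(1)[OF U] by (simp add: hs_inner_one)
qed

text \<open>Rows and columns of \<open>ov\<close> sum to one, so the two pure squares can be spread
  over all pairs, where they complete the square with the mixed term.\<close>

lemma hs_norm_udiag_diff:
  assumes U: "unitary_mat n U" and V: "unitary_mat n V"
  shows "hs_inner (udiag U f - udiag V g) (udiag U f - udiag V g) =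
    (\<Sum>i<n. \<Sum>j<n. ov U V i j * (f i - g j)\<^sup>2)"
proof -
  note u = unitary_matD(1)[OF U] and v = unitary_matD(1)[OF V]
  have "hs_inner (udiag U f - udiag V g) (udiag U f - udiag V g) =
      (\<Sum>i<n. f i * f i) + (\<Sum>i<n. g i * g i) - 2 * (\<Sum>i<n. \<Sum>j<n. f i * g j * ov U V i j)"
    using u v
    by (simp add: hs_inner_minus_left[of _ n] hs_inner_minus_right[of _ n] minus_carrier_mat
        hs_inner_udiag_same[OF U] hs_inner_udiag_same[OF V] hs_inner_udiag[OF u v]
        hs_inner_commute[of "udiag V g" n "udiag U f"])
  also have "\<dots> = (\<Sum>i<n. \<Sum>j<n. ov U V i j * (f i - g j)\<^sup>2)"
    unfolding ov_sums(1)[OF U V, of "\<lambda>i. f i * f i", symmetric] ov_sums(2)[OF U V, of "\<lambda>i. g i * g i", symmetric]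
      sum_distrib_left sum.distrib[symmetric] sum_subtractf[symmetric]
    by (simp add: power2_eq_square algebra_simps)
  finally show ?thesis .
qed

text \<open>Equality of two spectral expressions has to be tested only on overlapping pairs of
  eigenvectors. Together with the converse below, this replaces any comparison of
  eigenspaces.\<close>

lemma udiag_eq_ov:
  assumes U: "unitary_mat n U" and V: "unitary_mat n V"
    and "\<And>i j. i < n \<Longrightarrow> j < n \<Longrightarrow> ov U V i j \<noteq> 0 \<Longrightarrow> f i = g j"
  shows "udiag U f = udiag V g"
proof -
  note u = unitary_matD(1)[OF U] and v = unitary_matD(1)[OF V]
  have "hs_inner (udiag U f - udiag V g) (udiag U f - udiag V g) = 0"
    unfolding hs_norm_udiag_diff[OF U V] by (intro sum.neutral ballI) (use assms(3) in auto)
  then have "udiag U f - udiag V g = 0\<^sub>m n n"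
    by (intro hs_inner_self_eq_0 herm_minus udiag_herm u v)
  then have "(udiag U f - udiag V g) $$ (i, j) = 0" if "i < n" "j < n" for i j using that by simp
  then show ?thesis using u v by (intro eq_matI) auto
qed

lemma udiag_eq_imp_ov:
  assumes U: "unitary_mat n U" and V: "unitary_mat n V" and eq: "udiag U f = udiag V g"
    and ij: "i < n" "j < n" and ne: "ov U V i j \<noteq> 0"
  shows "f i = g j"
proof -
  note u = unitary_matD(1)[OF U] and v = unitary_matD(1)[OF V]
  have "hs_inner (udiag U f - udiag V g) (udiag U f - udiag V g) = 0"
    unfolding eq using u v by (simp add: hs_inner_minus_left[of _ n] minus_carrier_mat)
  then have s: "(\<Sum>i<n. \<Sum>j<n. ov U V i j * (f i - g j)\<^sup>2) = 0" unfolding hs_norm_udiag_diff[OF U V] .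
  have "\<forall>i\<in>{..<n}. (\<Sum>j<n. ov U V i j * (f i - g j)\<^sup>2) = 0"
    using s by (subst (asm) sum_nonneg_eq_0_iff) (auto intro!: sum_nonneg)
  then have "(\<Sum>j<n. ov U V i j * (f i - g j)\<^sup>2) = 0" using ij by auto
  then have "\<forall>j\<in>{..<n}. ov U V i j * (f i - g j)\<^sup>2 = 0"
    by (subst (asm) sum_nonneg_eq_0_iff) auto
  then show ?thesis using ij ne by auto
qed

section \<open>Functional calculus and the exponential in an eigenbasis\<close>

text \<open>Uniqueness in the definite description: two diagonalizations of one matrix have equal
  eigenvalues on overlapping pairs, hence equal values of \<open>f\<close> there.\<close>

lemma herm_fun_udiag:
  assumes U: "unitary_mat n U"
  shows "herm_fun f (udiag U l) = udiag U (\<lambda>i. f (l i))"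
proof -
  have Uc: "U \<in> carrier_mat n n" using unitary_matD[OF U] by auto
  show ?thesis unfolding herm_fun_def
  proof (rule the_equality)
    show "\<exists>U'\<in>carrier_mat (dim_row (udiag U l)) (dim_row (udiag U l)). \<exists>la. U' * mat_adjoint U' = 1\<^sub>m (dim_row (udiag U l)) \<and>
          udiag U l = U' * mat_diag (dim_row (udiag U l)) (\<lambda>i. complex_of_real (la i)) * mat_adjoint U' \<and>
          udiag U (\<lambda>i. f (l i)) = U' * mat_diag (dim_row (udiag U l)) (\<lambda>i. complex_of_real (f (la i))) * mat_adjoint U'"
      using Uc unitary_matD[OF U] by (intro bexI[of _ U] exI[of _ l]) (auto simp: udiag_def)
  next
    fix B
    assume "\<exists>U'\<in>carrier_mat (dim_row (udiag U l)) (dim_row (udiag U l)). \<exists>la. U' * mat_adjoint U' = 1\<^sub>m (dim_row (udiag U l)) \<and>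
          udiag U l = U' * mat_diag (dim_row (udiag U l)) (\<lambda>i. complex_of_real (la i)) * mat_adjoint U' \<and>
          B = U' * mat_diag (dim_row (udiag U l)) (\<lambda>i. complex_of_real (f (la i))) * mat_adjoint U'"
    then obtain V m where V: "V \<in> carrier_mat n n" "V * mat_adjoint V = 1\<^sub>m n"
      and 1: "udiag U l = udiag V m" and 2: "B = udiag V (\<lambda>i. f (m i))"
      using Uc by (auto simp: udiag_def)
    have V': "unitary_mat n V" using V by (rule unitary_matI_right)
    show "B = udiag U (\<lambda>i. f (l i))" unfolding 2
      by (rule udiag_eq_ov[OF V' U]) (metis udiag_eq_imp_ov[OF V' U 1[symmetric]])
  qed
qed

lemma udiag_pow:
  assumes U: "unitary_mat n U"
  shows "udiag U l ^\<^sub>m k = udiag U (\<lambda>i. l i ^ k)"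
proof (induction k)
  case 0
  then show ?case using udiag_const_one[OF U] unitary_matD(1)[OF U] by simp
next
  case (Suc k)
  then show ?case using udiag_mult[OF U] by (simp add: mult.commute)
qed

text \<open>Powers act on the eigenvalues, so each entry of the series is a finite combination of
  scalar exponential series.\<close>

lemma mexp_udiag:
  assumes U: "unitary_mat n U"
  shows "mexp (udiag U l) = udiag U (\<lambda>i. exp (l i))"
proof (rule eq_matI)
  have Uc: "U \<in> carrier_mat n n" using unitary_matD[OF U] by auto
  fix i j assume "i < dim_row (udiag U (\<lambda>i. exp (l i)))" "j < dim_col (udiag U (\<lambda>i. exp (l i)))"
  then have ij: "i < n" "j < n" using Uc by auto
  have "(\<lambda>k. \<Sum>m<n. U $$ (i, m) * complex_of_real (l m ^ k /\<^sub>R fact k) * cnj (U $$ (j, m))) sums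
      (\<Sum>m<n. U $$ (i, m) * complex_of_real (exp (l m)) * cnj (U $$ (j, m)))"
    by (intro sums_sum sums_mult sums_mult2 sums_of_real exp_converges)
  also have "(\<lambda>k. \<Sum>m<n. U $$ (i, m) * complex_of_real (l m ^ k /\<^sub>R fact k) * cnj (U $$ (j, m))) =
      (\<lambda>k. (udiag U l ^\<^sub>m k) $$ (i, j) / fact k)"
    unfolding udiag_pow[OF U] udiag_index[OF Uc ij] sum_divide_distrib
    by (intro ext sum.cong refl) (simp add: field_simps scaleR_conv_of_real)
  finally have "(\<Sum>k. (udiag U l ^\<^sub>m k) $$ (i, j) / fact k) = udiag U (\<lambda>i. exp (l i)) $$ (i, j)"
    unfolding udiag_index[OF Uc ij] by (rule sums_unique[symmetric])
  then show "mexp (udiag U l) $$ (i, j) = udiag U (\<lambda>i. exp (l i)) $$ (i, j)"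
    using ij Uc by (simp add: mexp_def)
qed (use unitary_matD(1)[OF U] in \<open>auto simp: mexp_def\<close>)

section \<open>Positive semidefinite matrices and states\<close>

lemma quadratic_form:
  assumes "A \<in> carrier_mat n n" "v \<in> carrier_vec n"
  shows "(A *\<^sub>v v) \<bullet>c v = (\<Sum>i<n. \<Sum>j<n. A $$ (i, j) * v $ j * cnj (v $ i))"
  using assms by (auto simp: scalar_prod_def lessThan_atLeast0 sum_distrib_right intro!: sum.cong)

lemma quadratic_form_udiag:
  assumes U: "U \<in> carrier_mat n n" and v: "v \<in> carrier_vec n"
  shows "(udiag U l *\<^sub>v v) \<bullet>c v = complex_of_real (\<Sum>k<n. l k * (cmod (\<Sum>i<n. cnj (U $$ (i, k)) * v $ i))\<^sup>2)"
proof -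
  let ?c = "\<lambda>k. \<Sum>i<n. cnj (U $$ (i, k)) * v $ i"
  let ?t = "\<lambda>i j k. U $$ (i, k) * l k * cnj (U $$ (j, k)) * v $ j * cnj (v $ i)"
  have "(udiag U l *\<^sub>v v) \<bullet>c v = (\<Sum>i<n. \<Sum>j<n. \<Sum>k<n. ?t i j k)"
    unfolding quadratic_form[OF udiag_carrier[OF U] v]
    by (auto simp: udiag_index[OF U] sum_distrib_right intro!: sum.cong)
  also have "\<dots> = (\<Sum>i<n. \<Sum>k<n. \<Sum>j<n. ?t i j k)"
    by (rule sum.cong[OF refl], rule sum.swap)
  also have "\<dots> = (\<Sum>k<n. \<Sum>i<n. \<Sum>j<n. ?t i j k)" by (rule sum.swap)
  also have "\<dots> = (\<Sum>k<n. complex_of_real (l k * (cmod (?c k))\<^sup>2))"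
  proof (rule sum.cong[OF refl])
    fix k
    have "(\<Sum>i<n. \<Sum>j<n. ?t i j k) = (\<Sum>i<n. \<Sum>j<n. complex_of_real (l k) *
        (cnj (cnj (U $$ (i, k)) * v $ i) * (cnj (U $$ (j, k)) * v $ j)))"
      by (simp add: mult_ac)
    also have "\<dots> = l k * (cnj (?c k) * ?c k)"
      unfolding cnj_sum sum_product by (simp only: sum_distrib_left)
    also have "cnj (?c k) * ?c k = complex_of_real ((cmod (?c k))\<^sup>2)"
      by (simp only: complex_norm_square mult.commute)
    finally show "(\<Sum>i<n. \<Sum>j<n. ?t i j k) = complex_of_real (l k * (cmod (?c k))\<^sup>2)" by simp
  qed
  finally show ?thesis by simp
qed

lemma psd_herm: "psd n A \<Longrightarrow> A \<in> herm n"
  by (simp add: psd_def)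

lemma psd_udiag_iff:
  assumes U: "unitary_mat n U"
  shows "psd n (udiag U l) \<longleftrightarrow> (\<forall>i<n. 0 \<le> l i)"
proof
  have Uc: "U \<in> carrier_mat n n" using unitary_matD[OF U] by auto
  {
    assume p: "psd n (udiag U l)"
    show "\<forall>i<n. 0 \<le> l i"
    proof (intro allI impI)
      fix m assume m: "m < n"
      \<comment> \<open>Testing the quadratic form on the eigenvector \<open>col U m\<close>
        isolates the eigenvalue \<open>l m\<close>.\<close>
      have c: "col U m \<in> carrier_vec n" using Uc by auto
      have "(\<Sum>i<n. cnj (U $$ (i, k)) * col U m $ i) = (if k = m then 1 else 0)" if "k < n" for k
        using unitary_cols[OF U that m] Uc m by simp
      then have "(\<Sum>k<n. l k * (cmod (\<Sum>i<n. cnj (U $$ (i, k)) * col U m $ i))\<^sup>2) =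
          (\<Sum>k<n. if k = m then l k else 0)"
        by (intro sum.cong refl) auto
      also have "\<dots> = l m" using m by simp
      finally have "(udiag U l *\<^sub>v col U m) \<bullet>c col U m = complex_of_real (l m)"
        unfolding quadratic_form_udiag[OF Uc c] by (simp only:)
      moreover have "0 \<le> Re ((udiag U l *\<^sub>v col U m) \<bullet>c col U m)" using p c unfolding psd_def by blast
      ultimately show "0 \<le> l m" by simp
    qed
  }
  assume l: "\<forall>i<n. 0 \<le> l i"
  show "psd n (udiag U l)" unfolding psd_def
    by (auto simp: quadratic_form_udiag[OF Uc] udiag_herm[OF Uc] l intro!: sum_nonneg simp del: of_real_sum)
qed

lemma psd_add:
  assumes "psd n A" "psd n B"
  shows "psd n (A + B)"
  unfolding psd_def
proof (intro conjI ballI)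
  note c = herm_carrier[OF psd_herm[OF assms(1)]] herm_carrier[OF psd_herm[OF assms(2)]]
  show "A + B \<in> herm n" using assms by (intro herm_add psd_herm)
  fix v :: "complex vec" assume v: "v \<in> carrier_vec n"
  have "((A + B) *\<^sub>v v) \<bullet>c v = (A *\<^sub>v v) \<bullet>c v + (B *\<^sub>v v) \<bullet>c v"
    using c v by (simp add: add_mult_distrib_mat_vec[of _ n n] add_scalar_prod_distrib[of _ n])
  then show "0 \<le> Re (((A + B) *\<^sub>v v) \<bullet>c v)" using assms v by (simp add: psd_def)
qed

lemma psd_smult:
  assumes "psd n A" "0 \<le> c"
  shows "psd n (complex_of_real c \<cdot>\<^sub>m A)"
  unfolding psd_def
proof (intro conjI ballI)
  note A = herm_carrier[OF psd_herm[OF assms(1)]]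
  show "complex_of_real c \<cdot>\<^sub>m A \<in> herm n" using assms by (intro herm_smult psd_herm)
  fix v :: "complex vec" assume v: "v \<in> carrier_vec n"
  have "((complex_of_real c \<cdot>\<^sub>m A) *\<^sub>v v) \<bullet>c v = complex_of_real c * ((A *\<^sub>v v) \<bullet>c v)"
    using A v by (simp add: quadratic_form[of _ n] sum_distrib_left mult_ac)
  then show "0 \<le> Re (((complex_of_real c \<cdot>\<^sub>m A) *\<^sub>v v) \<bullet>c v)" using assms v by (simp add: psd_def)
qed

lemma psd_spectral:
  assumes "psd n A"
  obtains U l where "unitary_mat n U" "A = udiag U l" "\<And>i. i < n \<Longrightarrow> 0 \<le> l i"
  using herm_spectral[OF psd_herm[OF assms]] psd_udiag_iff assms by metis

lemma hs_inner_psd_nonneg: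
  assumes "psd n A" "psd n B"
  shows "0 \<le> hs_inner A B"
proof -
  obtain U l where U: "unitary_mat n U" "A = udiag U l" "\<And>i. i < n \<Longrightarrow> 0 \<le> l i"
    using psd_spectral[OF assms(1)] by blast
  obtain V m where V: "unitary_mat n V" "B = udiag V m" "\<And>i. i < n \<Longrightarrow> 0 \<le> m i"
    using psd_spectral[OF assms(2)] by blast
  show ?thesis unfolding U V
    by (subst hs_inner_udiag[of _ n]) (use U V unitary_matD in \<open>auto intro!: sum_nonneg mult_nonneg_nonneg\<close>)
qed

lemma states_herm: "\<rho> \<in> states n \<Longrightarrow> \<rho> \<in> herm n"
  by (simp add: states_def psd_def)

lemma states_carrier: "\<rho> \<in> states n \<Longrightarrow> \<rho> \<in> carrier_mat n n"
  by (simp add: states_def)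

lemma states_psd: "\<rho> \<in> states n \<Longrightarrow> psd n \<rho>"
  by (simp add: states_def)

lemma states_trace: "\<rho> \<in> states n \<Longrightarrow> hs_inner (1\<^sub>m n) \<rho> = 1"
  by (auto simp: states_def hs_inner_def)

lemma statesI:
  assumes "psd n \<rho>" "hs_inner (1\<^sub>m n) \<rho> = 1"
  shows "\<rho> \<in> states n"
proof -
  note h = psd_herm[OF assms(1)]
  have "mtrace \<rho> = complex_of_real (Re (mtrace \<rho>))" by (rule mtrace_herm_real[OF h])
  also have "Re (mtrace \<rho>) = 1" using hs_inner_one[OF herm_carrier[OF h]] assms by simp
  finally show ?thesis using assms h by (simp add: states_def herm_carrier)
qed

lemma states_dim_pos: "\<rho> \<in> states n \<Longrightarrow> 0 < n"
  by (rule ccontr) (auto simp: states_def mtrace_def)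

lemma udiag_states_iff:
  assumes U: "unitary_mat n U"
  shows "udiag U l \<in> states n \<longleftrightarrow> (\<forall>i<n. 0 \<le> l i) \<and> (\<Sum>i<n. l i) = 1"
  using statesI[of n "udiag U l"] states_psd[of "udiag U l" n] states_trace[of "udiag U l" n]
  by (auto simp: psd_udiag_iff[OF U] hs_inner_one_udiag[OF U])

lemma states_spectral:
  assumes "\<rho> \<in> states n"
  obtains U l where "unitary_mat n U" "\<rho> = udiag U l" "\<And>i. i < n \<Longrightarrow> 0 \<le> l i" "(\<Sum>i<n. l i) = 1"
    "\<And>i. i < n \<Longrightarrow> l i \<le> 1"
proof -
  obtain U l where U: "unitary_mat n U" "\<rho> = udiag U l" using herm_spectral[OF states_herm[OF assms]] by blast
  then have l: "\<And>i. i < n \<Longrightarrow> 0 \<le> l i" "(\<Sum>i<n. l i) = 1" using assms udiag_states_iff by auto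
  have "l i \<le> 1" if "i < n" for i using member_le_sum[of i "{..<n}" l] l that by auto
  then show ?thesis using that U l by blast
qed

lemma states_convex:
  assumes "\<sigma> \<in> states n" "\<mu> \<in> states n" "0 \<le> t" "t \<le> 1"
  shows "complex_of_real (1 - t) \<cdot>\<^sub>m \<sigma> + complex_of_real t \<cdot>\<^sub>m \<mu> \<in> states n"
proof (rule statesI)
  note c = states_carrier[OF assms(1)] states_carrier[OF assms(2)]
  show "psd n (complex_of_real (1 - t) \<cdot>\<^sub>m \<sigma> + complex_of_real t \<cdot>\<^sub>m \<mu>)"
    using assms by (intro psd_add psd_smult states_psd) auto
  show "hs_inner (1\<^sub>m n) (complex_of_real (1 - t) \<cdot>\<^sub>m \<sigma> + complex_of_real t \<cdot>\<^sub>m \<mu>) = 1"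
    using c assms states_trace
    by (simp add: hs_inner_add_right[of _ n] hs_inner_smult_right[of _ n] smult_carrier_mat del: of_real_diff)
qed

text \<open>The rank-one projection onto column \<open>j\<close> of \<open>U\<close>. Pairing a
  state with it gives the weight of the state on that column; for a positive semidefinite matrix
  this weight vanishes exactly when the column lies in the kernel.\<close>

definition pr :: "complex mat \<Rightarrow> nat \<Rightarrow> complex mat" where
  "pr U j = udiag U (\<lambda>k. if k = j then 1 else 0)"

lemma pr_carrier [simp]: "U \<in> carrier_mat n n \<Longrightarrow> pr U j \<in> carrier_mat n n"
  by (simp add: pr_def)

lemma psd_pr: "unitary_mat n U \<Longrightarrow> psd n (pr U j)"
  by (simp add: pr_def psd_udiag_iff)

lemma hs_inner_pr:
  assumes "U \<in> carrier_mat n n" "V \<in> carrier_mat n n" "j < n"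
  shows "hs_inner (udiag U f) (pr V j) = (\<Sum>i<n. f i * ov U V i j)"
proof -
  have "hs_inner (udiag U f) (pr V j) = (\<Sum>i<n. \<Sum>k<n. if k = j then f i * ov U V i j else 0)"
    unfolding pr_def hs_inner_udiag[OF assms(1,2)] by (intro sum.cong refl) auto
  then show ?thesis using assms(3) by simp
qed

lemma hs_inner_pr_same:
  assumes "unitary_mat n U" "j < n"
  shows "hs_inner (udiag U f) (pr U j) = f j"
  unfolding pr_def hs_inner_udiag_same[OF assms(1)] using assms(2) by (simp add: if_distrib cong: if_cong)

lemma hs_inner_udiag_expand:
  assumes A: "A \<in> herm n" and V: "unitary_mat n V"
  shows "hs_inner A (udiag V g) = (\<Sum>j<n. g j * hs_inner A (pr V j))"
proof -
  obtain U l where U: "unitary_mat n U" "A = udiag U l" using herm_spectral[OF A] by blast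
  note u = unitary_matD(1)[OF U(1)] and v = unitary_matD(1)[OF V]
  show ?thesis unfolding U hs_inner_udiag[OF u v]
    by (subst sum.swap) (auto simp: hs_inner_pr[OF u v] sum_distrib_left mult_ac intro!: sum.cong)
qed

lemma hs_inner_state_pr_le_1:
  assumes "\<rho> \<in> states n" "unitary_mat n V" "j < n"
  shows "hs_inner \<rho> (pr V j) \<le> 1"
proof -
  have "(\<Sum>j<n. hs_inner \<rho> (pr V j)) = hs_inner \<rho> (udiag V (\<lambda>_. 1))"
    using hs_inner_udiag_expand[OF states_herm[OF assms(1)] assms(2), of "\<lambda>_. 1"] by simp
  also have "\<dots> = 1" unfolding udiag_const_one[OF assms(2)]
    using hs_inner_commute[OF states_carrier[OF assms(1)], of "1\<^sub>m n"] states_trace[OF assms(1)] by simp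
  finally have s: "(\<Sum>j<n. hs_inner \<rho> (pr V j)) = 1" .
  have "hs_inner \<rho> (pr V j) \<le> (\<Sum>j<n. hs_inner \<rho> (pr V j))"
    by (rule member_le_sum) (use assms(3) hs_inner_psd_nonneg[OF states_psd[OF assms(1)] psd_pr[OF assms(2)]] in auto)
  then show ?thesis using s by simp
qed

lemma ov_le_1:
  assumes U: "unitary_mat n U" and V: "unitary_mat n V" and "i < n" "j < n"
  shows "ov U V i j \<le> 1"
  using member_le_sum[of i "{..<n}" "\<lambda>i. ov U V i j"] ov_sum_left[OF U V] assms by auto

section \<open>Entropy inequalities\<close>

lemma mlog_udiag: "unitary_mat n U \<Longrightarrow> mlog (udiag U l) = udiag U (\<lambda>i. ln (l i))"
  unfolding mlog_def by (rule herm_fun_udiag)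

lemma mlog_herm: "A \<in> herm n \<Longrightarrow> mlog A \<in> herm n"
  using herm_spectral[of A n] mlog_udiag udiag_herm unitary_matD(1) by metis

lemma vn_entropy_eq: "vn_entropy \<rho> = - hs_inner \<rho> (mlog \<rho>)"
  by (simp add: vn_entropy_def hs_inner_def)

lemma vn_entropy_udiag:
  assumes "unitary_mat n U"
  shows "vn_entropy (udiag U l) = - (\<Sum>i<n. l i * ln (l i))"
  unfolding vn_entropy_eq mlog_udiag[OF assms] hs_inner_udiag_same[OF assms] ..

lemma vn_entropy_nonneg:
  assumes "\<rho> \<in> states n"
  shows "0 \<le> vn_entropy \<rho>"
proof -
  obtain U l where U: "unitary_mat n U" "\<rho> = udiag U l" and l: "\<And>i. i < n \<Longrightarrow> 0 \<le> l i"
    "\<And>i. i < n \<Longrightarrow> l i \<le> 1" using states_spectral[OF assms] by metis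
  have "l i * ln (l i) \<le> 0" if "i < n" for i
    using l(1)[OF that] l(2)[OF that] by (cases "l i = 0") (auto simp: mult_nonneg_nonpos)
  then have "(\<Sum>i<n. l i * ln (l i)) \<le> 0" by (intro sum_nonpos) auto
  then show ?thesis unfolding U(2) vn_entropy_udiag[OF U(1)] by simp
qed

text \<open>The crude bound \<open>- x * ln x \<le> 1\<close> replaces the sharp value
  \<open>ln n\<close>: the lemma only serves to make the supremum of the entropy finite.\<close>

lemma vn_entropy_le_dim:
  assumes "\<rho> \<in> states n"
  shows "vn_entropy \<rho> \<le> real n"
proof -
  obtain U l where U: "unitary_mat n U" "\<rho> = udiag U l" and l: "\<And>i. i < n \<Longrightarrow> 0 \<le> l i"
    using states_spectral[OF assms] by metis
  have "- (l i * ln (l i)) \<le> 1" if "i < n" for i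
  proof (cases "l i = 0")
    case False
    then have p: "0 < l i" using l[OF that] by simp
    have "ln (1 / l i) \<le> 1 / l i - 1" using p by (intro ln_le_minus_one) auto
    then have "l i * (- ln (l i)) \<le> l i * (1 / l i - 1)" using p by (intro mult_left_mono) (auto simp: ln_div)
    also have "\<dots> \<le> 1" using p by (simp add: right_diff_distrib)
    finally show ?thesis by simp
  qed simp
  then have "(\<Sum>i<n. - (l i * ln (l i))) \<le> (\<Sum>i<n. 1)" by (intro sum_mono) auto
  then show ?thesis unfolding U(2) vn_entropy_udiag[OF U(1)] by (simp add: sum_negf)
qed

section \<open>Scalar convexity estimates and Klein's inequality\<close>

text \<open>The expression is the Bregman divergence of \<open>x * ln x\<close>. After factoring out
  \<open>a\<close> it is \<open>ln x \<le> x - 1\<close> at \<open>x = b / a\<close>, with equality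
  only at 1.\<close>

lemma klein_scalar:
  fixes a b :: real
  assumes "0 \<le> a" "0 < b"
  shows "0 \<le> a * ln a - a * ln b - a + b"
    and "a * ln a - a * ln b - a + b = 0 \<Longrightarrow> a = b"
proof -
  have *: "a * ln a - a * ln b - a + b = a * (b / a - 1 - ln (b / a))" if "0 < a"
    using that assms by (simp add: ln_div field_simps)
  show "0 \<le> a * ln a - a * ln b - a + b"
  proof (cases "a = 0")
    case False
    then have a: "0 < a" using assms by simp
    have "0 \<le> b / a - 1 - ln (b / a)" using ln_le_minus_one[of "b / a"] a assms by simp
    then show ?thesis unfolding *[OF a] using a by simp
  qed (use assms in simp)
  show "a = b" if eq: "a * ln a - a * ln b - a + b = 0"
  proof (cases "a = 0")
    case False
    then have a: "0 < a" using assms by simp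
    have "ln (b / a) = b / a - 1" using eq a unfolding *[OF a] by simp
    then have "b / a = 1" using a assms by (intro ln_eq_minus_one) auto
    then show ?thesis using a by simp
  qed (use eq assms in simp)
qed

text \<open>The estimate opposite to \<open>klein_scalar\<close>, from
  \<open>ln x \<le> x - 1\<close> at \<open>x = a / b\<close>. The error is quadratic apart from
  \<open>a - b\<close>, which cancels once it is summed over two probability distributions.\<close>

lemma chi_square_scalar:
  fixes a b :: real
  assumes "0 \<le> a" "0 < b"
  shows "a * ln a - a * ln b \<le> (a - b)\<^sup>2 / b + (a - b)"
proof (cases "a = 0")
  case True
  then show ?thesis using assms by (simp add: power2_eq_square)
next
  case False
  then have a: "0 < a" using assms by simp
  have "a * ln (a / b) \<le> a * (a / b - 1)" using a assms by (intro mult_left_mono ln_le_minus_one) auto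
  also have "\<dots> = (a - b)\<^sup>2 / b + (a - b)" using assms by (simp add: field_simps power2_eq_square)
  finally show ?thesis using a assms by (simp add: ln_div algebra_simps)
qed

lemma overlap_zero:
  assumes U: "unitary_mat n U" and V: "unitary_mat n V" and a: "\<And>i. i < n \<Longrightarrow> 0 \<le> a i"
    and z: "hs_inner (udiag U a) (pr V j) = 0" and ij: "i < n" "j < n"
  shows "ov U V i j = 0 \<or> a i = 0"
proof -
  have "(\<Sum>i<n. a i * ov U V i j) = 0"
    using z hs_inner_pr[OF unitary_matD(1)[OF U] unitary_matD(1)[OF V] ij(2)] by simp
  then have "\<forall>i\<in>{..<n}. a i * ov U V i j = 0"
    by (subst (asm) sum_nonneg_eq_0_iff) (auto intro!: mult_nonneg_nonneg a)
  then show ?thesis using ij by auto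
qed

lemma entropy_cross_expand:
  assumes U: "unitary_mat n U" and V: "unitary_mat n V"
  shows "- vn_entropy (udiag U a) - hs_inner (udiag U a) (udiag V (\<lambda>j. ln (b j))) =
    (\<Sum>i<n. \<Sum>j<n. ov U V i j * (a i * ln (a i) - a i * ln (b j)))"
proof -
  have "- vn_entropy (udiag U a) - hs_inner (udiag U a) (udiag V (\<lambda>j. ln (b j))) =
     (\<Sum>i<n. \<Sum>j<n. a i * ln (a i) * ov U V i j) - (\<Sum>i<n. \<Sum>j<n. a i * ln (b j) * ov U V i j)"
    unfolding vn_entropy_udiag[OF U] hs_inner_udiag[OF unitary_matD(1)[OF U] unitary_matD(1)[OF V]]
      ov_sums(1)[OF U V] by simp
  then show ?thesis by (simp add: sum_subtractf[symmetric] algebra_simps)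
qed

text \<open>In the next two lemmas \<open>hs_inner \<mu> (pr V j) = 0\<close> whenever \<open>b j = 0\<close> expresses that the
  kernel of \<open>udiag V b\<close> is contained in the kernel of \<open>\<mu>\<close>.\<close>

lemma klein_inequality:
  assumes mu: "\<mu> \<in> states n" and V: "unitary_mat n V"
    and b: "\<And>j. j < n \<Longrightarrow> 0 \<le> b j" "(\<Sum>j<n. b j) = 1"
    and supp: "\<And>j. j < n \<Longrightarrow> b j = 0 \<Longrightarrow> hs_inner \<mu> (pr V j) = 0"
  shows "vn_entropy \<mu> \<le> - hs_inner \<mu> (udiag V (\<lambda>j. ln (b j)))"
    and "vn_entropy \<mu> = - hs_inner \<mu> (udiag V (\<lambda>j. ln (b j))) \<Longrightarrow> \<mu> = udiag V b"
proof -
  obtain U a where U: "unitary_mat n U" "\<mu> = udiag U a" and a: "\<And>i. i < n \<Longrightarrow> 0 \<le> a i" "(\<Sum>i<n. a i) = 1"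
    using states_spectral[OF mu] by metis
  \<comment> \<open>The extra terms \<open>- a i + b j\<close> cost nothing, because both weighted
    sums equal one, but they make every single summand nonnegative. Hence a vanishing total forces
    each summand to vanish, which is the equality case.\<close>
  define g where "g i j = ov U V i j * (a i * ln (a i) - a i * ln (b j) - a i + b j)" for i j
  have z: "ov U V i j = 0 \<or> a i = 0" if "i < n" "j < n" "b j = 0" for i j
    using overlap_zero[where a=a and i=i and j=j, OF U(1) V a(1)] supp[OF that(2,3)] that U(2) by auto
  have g0: "0 \<le> g i j" if "i < n" "j < n" for i j
  proof (cases "b j = 0")
    case True
    then show ?thesis using z[OF that True] by (auto simp: g_def)
  next
    case False
    then show ?thesis unfolding g_def using klein_scalar(1)[of "a i" "b j"] a(1)[OF that(1)] b(1)[OF that(2)]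
      by (intro mult_nonneg_nonneg) auto
  qed
  have sg: "(\<Sum>i<n. \<Sum>j<n. g i j) = - vn_entropy \<mu> - hs_inner \<mu> (udiag V (\<lambda>j. ln (b j)))"
  proof -
    have "(\<Sum>i<n. \<Sum>j<n. g i j) = (\<Sum>i<n. \<Sum>j<n. ov U V i j * (a i * ln (a i) - a i * ln (b j)))
       - (\<Sum>i<n. \<Sum>j<n. a i * ov U V i j) + (\<Sum>i<n. \<Sum>j<n. b j * ov U V i j)"
      unfolding g_def by (simp add: sum_subtractf[symmetric] sum.distrib[symmetric] algebra_simps)
    then show ?thesis unfolding ov_sums[OF U(1) V] a(2) b(2) U(2) entropy_cross_expand[OF U(1) V] by simp
  qed
  have "0 \<le> (\<Sum>i<n. \<Sum>j<n. g i j)" by (intro sum_nonneg) (use g0 in auto)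
  then show "vn_entropy \<mu> \<le> - hs_inner \<mu> (udiag V (\<lambda>j. ln (b j)))" unfolding sg by simp
  assume "vn_entropy \<mu> = - hs_inner \<mu> (udiag V (\<lambda>j. ln (b j)))"
  then have s0: "(\<Sum>i<n. \<Sum>j<n. g i j) = 0" unfolding sg by simp
  have gz: "g i j = 0" if "i < n" "j < n" for i j
  proof -
    have "\<forall>i\<in>{..<n}. (\<Sum>j<n. g i j) = 0"
      using s0 by (subst (asm) sum_nonneg_eq_0_iff) (auto intro!: sum_nonneg g0)
    then have "(\<Sum>j<n. g i j) = 0" using that by auto
    then have "\<forall>j\<in>{..<n}. g i j = 0"
      using that by (subst (asm) sum_nonneg_eq_0_iff) (auto intro!: g0)
    then show ?thesis using that by auto
  qed
  show "\<mu> = udiag V b" unfolding U(2)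
  proof (rule udiag_eq_ov[OF U(1) V])
    fix i j assume ij: "i < n" "j < n" and o: "ov U V i j \<noteq> 0"
    show "a i = b j"
    proof (cases "b j = 0")
      case True
      then show ?thesis using z[OF ij True] o by simp
    next
      case False
      have "a i * ln (a i) - a i * ln (b j) - a i + b j = 0" using gz[OF ij] o by (simp add: g_def)
      then show ?thesis using klein_scalar(2)[of "a i" "b j"] a(1)[OF ij(1)] b(1)[OF ij(2)] False by auto
    qed
  qed
qed

lemma entropy_lower_bound:
  assumes mu: "\<mu> \<in> states n" and V: "unitary_mat n V"
    and b: "\<And>j. j < n \<Longrightarrow> 0 \<le> b j" "(\<Sum>j<n. b j) = 1"
    and supp: "\<And>j. j < n \<Longrightarrow> b j = 0 \<Longrightarrow> hs_inner \<mu> (pr V j) = 0"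
    and c: "0 < c" "\<And>j. j < n \<Longrightarrow> b j \<noteq> 0 \<Longrightarrow> c \<le> b j"
  shows "- hs_inner \<mu> (udiag V (\<lambda>j. ln (b j))) - hs_inner (\<mu> - udiag V b) (\<mu> - udiag V b) / c \<le> vn_entropy \<mu>"
proof -
  obtain U a where U: "unitary_mat n U" "\<mu> = udiag U a" and a: "\<And>i. i < n \<Longrightarrow> 0 \<le> a i" "(\<Sum>i<n. a i) = 1"
    using states_spectral[OF mu] by metis
  have z: "ov U V i j = 0 \<or> a i = 0" if "i < n" "j < n" "b j = 0" for i j
    using overlap_zero[where a=a and i=i and j=j, OF U(1) V a(1)] supp[OF that(2,3)] that U(2) by auto
  have "- vn_entropy \<mu> - hs_inner \<mu> (udiag V (\<lambda>j. ln (b j))) =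
     (\<Sum>i<n. \<Sum>j<n. ov U V i j * (a i * ln (a i) - a i * ln (b j)))"
    unfolding U(2) by (rule entropy_cross_expand[OF U(1) V])
  \<comment> \<open>The chi-square estimate holds pair by pair, with the lower bound
    \<open>c\<close> on the nonzero eigenvalues in the denominator. The linear terms sum to
    \<open>1 - 1\<close>, so only the squared distance of the two matrices remains.\<close>
  also have "\<dots> \<le> (\<Sum>i<n. \<Sum>j<n. ov U V i j * (a i - b j)\<^sup>2 / c + (a i * ov U V i j - b j * ov U V i j))"
  proof (intro sum_mono)
    fix i j assume "i \<in> {..<n}" "j \<in> {..<n}"
    then have ij: "i < n" "j < n" by auto
    show "ov U V i j * (a i * ln (a i) - a i * ln (b j)) \<le>
        ov U V i j * (a i - b j)\<^sup>2 / c + (a i * ov U V i j - b j * ov U V i j)"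
    proof (cases "b j = 0")
      case True
      then show ?thesis using z[OF ij True] c by auto
    next
      case False
      then have bp: "0 < b j" "c \<le> b j" using b(1)[OF ij(2)] c(2)[OF ij(2)] by auto
      have "a i * ln (a i) - a i * ln (b j) \<le> (a i - b j)\<^sup>2 / b j + (a i - b j)"
        using a(1)[OF ij(1)] bp by (intro chi_square_scalar)
      also have "(a i - b j)\<^sup>2 / b j \<le> (a i - b j)\<^sup>2 / c"
        using bp c by (intro divide_left_mono) auto
      finally have "ov U V i j * (a i * ln (a i) - a i * ln (b j)) \<le> ov U V i j * ((a i - b j)\<^sup>2 / c + (a i - b j))"
        by (intro mult_left_mono) auto
      then show ?thesis by (simp add: algebra_simps)
    qed
  qed
  also have "\<dots> = hs_inner (\<mu> - udiag V b) (\<mu> - udiag V b) / c"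
    unfolding U(2) hs_norm_udiag_diff[OF U(1) V] sum.distrib sum_subtractf ov_sums[OF U(1) V] a(2) b(2)
      sum_divide_distrib by simp
  finally show ?thesis by simp
qed

section \<open>Continuity of the entropy\<close>

text \<open>The function \<open>x * ln x\<close> has infinite slope at 0, so no Lipschitz bound
  exists; Hoelder continuity with exponent one half holds uniformly on the unit interval.\<close>

lemma xlnx_diff_le:
  fixes a b :: real
  assumes "0 \<le> a" "a \<le> 1" "0 \<le> b" "b \<le> 1"
  shows "\<bar>a * ln a - b * ln b\<bar> \<le> 2 * sqrt \<bar>a - b\<bar>"
proof -
  have small: "- (h * ln h) \<le> 2 * sqrt h" if h: "0 < h" for h :: real
  proof -
    \<comment> \<open>Evaluating the tangent bound of the logarithm at \<open>1 / sqrt h\<close>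
      instead of \<open>1 / h\<close> produces the square root.\<close>
    have "ln (1 / sqrt h) \<le> 1 / sqrt h - 1" using h by (intro ln_le_minus_one) auto
    then have "- ln h / 2 \<le> 1 / sqrt h" using h by (simp add: ln_div ln_sqrt)
    then have "h * (- ln h / 2) \<le> h * (1 / sqrt h)" using h by (intro mult_left_mono) auto
    then show ?thesis using h by (simp add: real_div_sqrt)
  qed
  have main: "\<bar>a * ln a - b * ln b\<bar> \<le> 2 * sqrt (a - b)" if "0 \<le> b" "b < a" "a \<le> 1" for a b :: real
  proof (rule abs_leI)
    have h: "0 < a - b" "a - b \<le> 1" using that by auto
    have l0: "ln a \<le> 0" using that by simp
    have 1: "b * (ln a - ln b) \<le> a - b"
    proof (cases "b = 0")
      case False
      then have b: "0 < b" using that by simp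
      have "b * ln (a / b) \<le> b * (a / b - 1)" using b that by (intro mult_left_mono ln_le_minus_one) auto
      then show ?thesis using b that by (simp add: ln_div right_diff_distrib)
    qed (use h in simp)
    have "a * ln a - b * ln b = (a - b) * ln a + b * (ln a - ln b)" by (simp add: algebra_simps)
    also have "\<dots> \<le> 0 + (a - b)" using h l0 1 by (intro add_mono mult_nonneg_nonpos) auto
    also have "\<dots> \<le> 2 * sqrt (a - b)"
    proof -
      have "a - b \<le> sqrt (a - b)" using h by (intro real_le_rsqrt) (auto simp: power2_eq_square mult_left_le)
      moreover have "0 \<le> sqrt (a - b)" using h by simp
      ultimately show ?thesis by linarith
    qed
    finally show "a * ln a - b * ln b \<le> 2 * sqrt (a - b)" .
    have 2: "b * (ln b - ln a) \<le> 0"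
      using that by (cases "b = 0") (auto intro!: mult_nonneg_nonpos)
    have "- (a * ln a - b * ln b) = (a - b) * (- ln a) + b * (ln b - ln a)" by (simp add: algebra_simps)
    \<comment> \<open>Since \<open>a - b \<le> a\<close>, the factor \<open>- ln a\<close> is at
      most \<open>- ln (a - b)\<close>; everything is reduced to the behaviour at 0.\<close>
    also have "\<dots> \<le> (a - b) * (- ln (a - b)) + 0" using that h 2 by (intro add_mono mult_left_mono) auto
    also have "\<dots> \<le> 2 * sqrt (a - b)" using small[OF h(1)] by simp
    finally show "- (a * ln a - b * ln b) \<le> 2 * sqrt (a - b)" .
  qed
  consider "a = b" | "b < a" | "a < b" by linarith
  then show ?thesis
  proof cases
    case 2
    then show ?thesis using main[of b a] assms by simp
  next
    case 3
    then show ?thesis using main[of a b] assms by (simp add: abs_minus_commute)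
  qed simp
qed

text \<open>Overlaps average squared differences of eigenvalues exactly into the Frobenius distance,
  but they do not do so for square roots. The Hoelder bound is therefore traded for
  \<open>\<epsilon>\<close> plus a multiple of the square; the weights of the
  \<open>\<epsilon>\<close> terms add up to \<open>n\<close>.\<close>

lemma entropy_modulus:
  assumes e: "0 < \<epsilon>" and mu: "\<mu> \<in> states n" and tau: "\<tau> \<in> states n"
  shows "\<bar>vn_entropy \<mu> - vn_entropy \<tau>\<bar> \<le> real n * \<epsilon> + 32 / \<epsilon> ^ 4 * hs_inner (\<mu> - \<tau>) (\<mu> - \<tau>)"
proof -
  obtain U a where U: "unitary_mat n U" "\<mu> = udiag U a" and a: "\<And>i. i < n \<Longrightarrow> 0 \<le> a i" "\<And>i. i < n \<Longrightarrow> a i \<le> 1"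
    using states_spectral[OF mu] by metis
  obtain V b where V: "unitary_mat n V" "\<tau> = udiag V b" and b: "\<And>i. i < n \<Longrightarrow> 0 \<le> b i" "\<And>i. i < n \<Longrightarrow> b i \<le> 1"
    using states_spectral[OF tau] by metis
  let ?K = "32 / \<epsilon> ^ 4"
  \<comment> \<open>The constant: if \<open>2 * sqrt h\<close> exceeds \<open>\<epsilon>\<close>,
    then \<open>h\<close> is at least a quarter of the square of \<open>\<epsilon>\<close>, so
    \<open>32 / \<epsilon> ^ 4\<close> times the square of \<open>h\<close> is at least 2, which
    dominates \<open>2 * sqrt h\<close> for \<open>h \<le> 1\<close>.\<close>
  have sc: "2 * sqrt h \<le> \<epsilon> + ?K * h\<^sup>2" if h: "0 \<le> h" "h \<le> 1" for h :: real
  proof (cases "2 * sqrt h \<le> \<epsilon>")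
    case True
    then show ?thesis using e by (simp add: add_increasing2)
  next
    case False
    then have "(\<epsilon> / 2)\<^sup>2 \<le> (sqrt h)\<^sup>2" using e by (intro power_mono) auto
    then have "(\<epsilon>\<^sup>2 / 4)\<^sup>2 \<le> h\<^sup>2" using h by (intro power_mono) (auto simp: power_divide)
    then have k: "2 \<le> ?K * h\<^sup>2" using e by (simp add: field_simps power_divide flip: power_mult)
    have "sqrt h \<le> 1" using h by simp
    then have "2 * sqrt h \<le> 2" by simp
    also have "\<dots> \<le> \<epsilon> + ?K * h\<^sup>2" using k e by simp
    finally show ?thesis .
  qed
  have "vn_entropy \<mu> - vn_entropy \<tau> = (\<Sum>i<n. \<Sum>j<n. (b j * ln (b j)) * ov U V i j) - (\<Sum>i<n. \<Sum>j<n. (a i * ln (a i)) * ov U V i j)"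
    unfolding U(2) V(2) vn_entropy_udiag[OF U(1)] vn_entropy_udiag[OF V(1)] ov_sums[OF U(1) V(1)] by simp
  also have "\<dots> = (\<Sum>i<n. \<Sum>j<n. ov U V i j * (b j * ln (b j) - a i * ln (a i)))"
    by (simp add: sum_subtractf[symmetric] algebra_simps)
  finally have "\<bar>vn_entropy \<mu> - vn_entropy \<tau>\<bar> \<le> (\<Sum>i<n. \<bar>\<Sum>j<n. ov U V i j * (b j * ln (b j) - a i * ln (a i))\<bar>)"
    by (simp only: sum_abs)
  also have "\<dots> \<le> (\<Sum>i<n. \<Sum>j<n. \<epsilon> * ov U V i j + ?K * (ov U V i j * (a i - b j)\<^sup>2))"
  proof (rule sum_mono)
    fix i assume "i \<in> {..<n}"
    then have i: "i < n" by simp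
    have "\<bar>\<Sum>j<n. ov U V i j * (b j * ln (b j) - a i * ln (a i))\<bar> \<le> (\<Sum>j<n. \<bar>ov U V i j * (b j * ln (b j) - a i * ln (a i))\<bar>)"
      by (rule sum_abs)
    also have "\<dots> \<le> (\<Sum>j<n. \<epsilon> * ov U V i j + ?K * (ov U V i j * (a i - b j)\<^sup>2))"
    proof (rule sum_mono)
      fix j assume "j \<in> {..<n}"
      then have j: "j < n" by simp
      have "\<bar>b j * ln (b j) - a i * ln (a i)\<bar> \<le> 2 * sqrt \<bar>b j - a i\<bar>"
        using a[OF i] b[OF j] by (intro xlnx_diff_le) auto
      also have "\<dots> \<le> \<epsilon> + ?K * \<bar>b j - a i\<bar>\<^sup>2" using a[OF i] b[OF j] by (intro sc) auto
      finally have "ov U V i j * \<bar>b j * ln (b j) - a i * ln (a i)\<bar> \<le> ov U V i j * (\<epsilon> + ?K * (a i - b j)\<^sup>2)"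
        by (intro mult_left_mono) (auto simp: power2_commute)
      then show "\<bar>ov U V i j * (b j * ln (b j) - a i * ln (a i))\<bar> \<le> \<epsilon> * ov U V i j + ?K * (ov U V i j * (a i - b j)\<^sup>2)"
        by (simp only: abs_mult abs_of_nonneg[OF ov_nonneg] distrib_left mult_ac)
    qed
    finally show "\<bar>\<Sum>j<n. ov U V i j * (b j * ln (b j) - a i * ln (a i))\<bar> \<le>
      (\<Sum>j<n. \<epsilon> * ov U V i j + ?K * (ov U V i j * (a i - b j)\<^sup>2))" .
  qed
  also have "\<dots> = real n * \<epsilon> + ?K * hs_inner (\<mu> - \<tau>) (\<mu> - \<tau>)"
    unfolding U(2) V(2) hs_norm_udiag_diff[OF U(1) V(1)] sum.distrib ov_sums(1)[OF U(1) V(1), of "\<lambda>_. \<epsilon>"]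
      sum_distrib_left by simp
  finally show ?thesis .
qed

section \<open>Support of an entropy maximizer on a segment\<close>

lemma square_sum_le:
  fixes f :: "nat \<Rightarrow> real"
  shows "(\<Sum>i<n. f i)\<^sup>2 \<le> real n * (\<Sum>i<n. (f i)\<^sup>2)"
proof -
  have "(\<Sum>i<n. f i)\<^sup>2 = (\<Sum>i<n. \<Sum>j<n. f i * f j)" by (simp add: power2_eq_square sum_product)
  also have "\<dots> \<le> (\<Sum>i<n. \<Sum>j<n. (f i)\<^sup>2 / 2 + (f j)\<^sup>2 / 2)"
  proof (intro sum_mono)
    fix i j
    have "0 \<le> (f i - f j)\<^sup>2" by simp
    then show "f i * f j \<le> (f i)\<^sup>2 / 2 + (f j)\<^sup>2 / 2" by (simp add: power2_diff)
  qed
  also have "\<dots> = real n * (\<Sum>i<n. (f i)\<^sup>2)"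
    by (simp add: sum.distrib sum_distrib_left[symmetric] sum_divide_distrib[symmetric])
  finally show ?thesis .
qed

text \<open>Inserting the basis \<open>W\<close> between \<open>X\<close> and \<open>V\<close> adds
  amplitudes, whereas \<open>ov\<close> contains their squares. Cauchy-Schwarz passes from one to
  the other at the price of the factor \<open>n\<close>.\<close>

lemma hs_inner_pr_change_basis:
  assumes mu: "\<mu> \<in> states n" and V: "unitary_mat n V" and W: "unitary_mat n W" and j: "j < n"
  shows "hs_inner \<mu> (pr V j) \<le> real n * (\<Sum>i<n. hs_inner \<mu> (pr W i) * ov W V i j)"
proof -
  obtain X a where X: "unitary_mat n X" "\<mu> = udiag X a" and a: "\<And>i. i < n \<Longrightarrow> 0 \<le> a i"
    using states_spectral[OF mu] by metis
  note x = unitary_matD[OF X(1)] and v = unitary_matD[OF V] and w = unitary_matD[OF W]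
  have o: "ov X V k j \<le> real n * (\<Sum>i<n. ov X W k i * ov W V i j)" if k: "k < n" for k
  proof -
    have e: "mat_adjoint X * V = (mat_adjoint X * W) * (mat_adjoint W * V)"
    proof -
      have "(mat_adjoint X * W) * (mat_adjoint W * V) = mat_adjoint X * ((W * mat_adjoint W) * V)"
        using x(1) v(1) w(1) by (simp add: assoc_mult_square[of _ n])
      then show ?thesis using w(2) v(1) by simp
    qed
    have "(mat_adjoint X * V) $$ (k, j) = (\<Sum>i<n. (mat_adjoint X * W) $$ (k, i) * (mat_adjoint W * V) $$ (i, j))"
      unfolding e by (rule index_mult_sum) (use x v w k j in auto)
    then have "cmod ((mat_adjoint X * V) $$ (k, j)) \<le> (\<Sum>i<n. cmod ((mat_adjoint X * W) $$ (k, i)) * cmod ((mat_adjoint W * V) $$ (i, j)))"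
      by (metis (no_types, lifting) norm_mult sum.cong norm_sum)
    then have "ov X V k j \<le> (\<Sum>i<n. cmod ((mat_adjoint X * W) $$ (k, i)) * cmod ((mat_adjoint W * V) $$ (i, j)))\<^sup>2"
      unfolding ov_def by (intro power_mono) auto
    also have "\<dots> \<le> real n * (\<Sum>i<n. (cmod ((mat_adjoint X * W) $$ (k, i)) * cmod ((mat_adjoint W * V) $$ (i, j)))\<^sup>2)"
      by (rule square_sum_le)
    finally show ?thesis by (simp add: ov_def power_mult_distrib)
  qed
  have "hs_inner \<mu> (pr V j) = (\<Sum>k<n. a k * ov X V k j)"
    unfolding X(2) by (rule hs_inner_pr[OF x(1) v(1) j])
  also have "\<dots> \<le> (\<Sum>k<n. a k * (real n * (\<Sum>i<n. ov X W k i * ov W V i j)))"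
    by (intro sum_mono mult_left_mono o) (use a in auto)
  also have "\<dots> = real n * (\<Sum>k<n. \<Sum>i<n. a k * ov X W k i * ov W V i j)"
    by (simp add: sum_distrib_left mult_ac)
  also have "\<dots> = real n * (\<Sum>i<n. \<Sum>k<n. a k * ov X W k i * ov W V i j)"
    by (subst sum.swap) simp
  also have "\<dots> = real n * (\<Sum>i<n. hs_inner \<mu> (pr W i) * ov W V i j)"
    unfolding X(2) by (simp add: hs_inner_pr[OF x(1) w(1)] sum_distrib_right)
  finally show ?thesis .
qed

text \<open>The entropy has infinite slope when leaving the boundary of the state space, so a maximizer
  on a segment already carries the support of the whole segment.\<close>

lemma maximizer_support:
  assumes V: "unitary_mat n V" and sg: "udiag V b \<in> states n" and mu: "\<mu> \<in> states n"
    and max: "\<And>t. 0 < t \<Longrightarrow> t < 1 \<Longrightarrow>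
      vn_entropy (complex_of_real (1 - t) \<cdot>\<^sub>m udiag V b + complex_of_real t \<cdot>\<^sub>m \<mu>) \<le> vn_entropy (udiag V b)"
    and j: "j < n" and bj: "b j = 0"
  shows "hs_inner \<mu> (pr V j) = 0"
proof (rule ccontr)
  assume ne: "hs_inner \<mu> (pr V j) \<noteq> 0"
  define m where "m = hs_inner \<mu> (pr V j)"
  define C where "C = vn_entropy (udiag V b)"
  define N where "N = real n"
  let ?\<sigma> = "udiag V b"
  note v = unitary_matD(1)[OF V]
  note muc = states_carrier[OF mu] and sgc = states_carrier[OF sg]
  have m: "0 < m" using ne hs_inner_psd_nonneg[OF states_psd[OF mu] psd_pr[OF V]] by (auto simp: m_def less_le)
  have m1: "m \<le> 1" unfolding m_def by (rule hs_inner_state_pr_le_1[OF mu V j])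
  have C: "0 \<le> C" unfolding C_def by (rule vn_entropy_nonneg[OF sg])
  have N: "0 < N" using j by (simp add: N_def)
  \<comment> \<open>A bound on the weight \<open>m\<close> that is valid for every mixing parameter
    \<open>t\<close> and every cutoff \<open>\<delta>\<close> on the eigenvalues of the mixture; the
    contradiction comes from choosing both small.\<close>
  have key: "m \<le> N\<^sup>2 * (t / \<delta> + C / (- ln \<delta>))" if t: "0 < t" "t < 1" and d: "0 < \<delta>" "\<delta> < 1" for t \<delta>
  proof -
    define \<tau> where "\<tau> = complex_of_real (1 - t) \<cdot>\<^sub>m ?\<sigma> + complex_of_real t \<cdot>\<^sub>m \<mu>"
    have tau: "\<tau> \<in> states n" unfolding \<tau>_def by (rule states_convex) (use sg mu t in auto)
    have inner: "hs_inner \<tau> B = (1 - t) * hs_inner ?\<sigma> B + t * hs_inner \<mu> B" if "B \<in> carrier_mat n n" for B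
      unfolding \<tau>_def using muc sgc that
      by (simp add: hs_inner_add_left[of _ n] hs_inner_smult_left[of _ n] smult_carrier_mat del: of_real_diff)
    obtain W s where W: "unitary_mat n W" "\<tau> = udiag W s" and s: "\<And>i. i < n \<Longrightarrow> 0 \<le> s i" "\<And>i. i < n \<Longrightarrow> s i \<le> 1"
      "(\<Sum>i<n. s i) = 1" using states_spectral[OF tau] by metis
    note w = unitary_matD(1)[OF W(1)]
    define q where "q i = hs_inner \<mu> (pr W i)" for i
    define r where "r i = hs_inner ?\<sigma> (pr W i)" for i
    define h where "h i = ov W V i j" for i
    have q: "0 \<le> q i" "q i \<le> 1" and r: "0 \<le> r i" and h: "0 \<le> h i" "h i \<le> 1" if "i < n" for i
      using hs_inner_psd_nonneg[OF states_psd[OF mu] psd_pr[OF W(1)]]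
        hs_inner_psd_nonneg[OF states_psd[OF sg] psd_pr[OF W(1)]] hs_inner_state_pr_le_1[OF mu W(1) that]
        ov_le_1[OF W(1) V that j]
      by (auto simp: q_def r_def h_def)
    have seq: "s i = (1 - t) * r i + t * q i" if "i < n" for i
      using inner[of "pr W i"] hs_inner_pr_same[OF W(1) that, of s] w by (simp add: W(2) q_def r_def)
    have s0: "q i = 0 \<and> r i = 0" if "i < n" "s i = 0" for i
    proof -
      have "(1 - t) * r i = 0 \<and> t * q i = 0"
        using seq[OF that(1)] that q[OF that(1)] r[OF that(1)] t
        by (smt (verit) mult_nonneg_nonneg)
      then show ?thesis using t by simp
    qed
    let ?L = "udiag W (\<lambda>i. ln (s i))"
    \<comment> \<open>Klein's inequality bounds the entropy of \<open>?\<sigma>\<close> by its cross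
      entropy with the mixture \<open>\<tau>\<close>, while the entropy of \<open>\<tau>\<close> is
      the weighted mean of the cross entropies of \<open>?\<sigma>\<close> and \<open>\<mu>\<close>
      and is at most \<open>C\<close>. Hence the cross entropy of \<open>\<mu>\<close> is at most
      \<open>C\<close>, uniformly in \<open>t\<close>.\<close>
    have "vn_entropy ?\<sigma> \<le> - hs_inner ?\<sigma> ?L"
      by (rule klein_inequality(1)[OF sg W(1) s(1) s(3)]) (use s0 r_def in auto)
    moreover have "vn_entropy \<tau> = - hs_inner \<tau> ?L"
      unfolding vn_entropy_eq using mlog_udiag[OF W(1)] W(2) by simp
    moreover have "vn_entropy \<tau> \<le> C" using max[OF t] by (simp add: \<tau>_def C_def)
    ultimately have "C \<le> - hs_inner ?\<sigma> ?L" "- ((1 - t) * hs_inner ?\<sigma> ?L + t * hs_inner \<mu> ?L) \<le> C"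
      using inner[of ?L] w by (auto simp: C_def)
    moreover from this have "(1 - t) * C \<le> (1 - t) * (- hs_inner ?\<sigma> ?L)"
      using t by (intro mult_left_mono) auto
    ultimately have "t * (- hs_inner \<mu> ?L) \<le> t * C" by (simp add: algebra_simps)
    then have "- hs_inner \<mu> ?L \<le> C" using t by (simp only: mult_le_cancel_left_pos)
    moreover have "- hs_inner \<mu> ?L = (\<Sum>i<n. q i * (- ln (s i)))"
      using hs_inner_udiag_expand[OF states_herm[OF mu] W(1)] by (simp add: q_def sum_negf mult.commute)
    moreover have nn: "0 \<le> q i * (- ln (s i))" if "i < n" for i
      using q[OF that] s(1,2)[OF that] by (cases "s i = 0") (auto intro!: mult_nonneg_nonneg simp: mult_nonneg_nonpos)
    ultimately have qC: "q i * (- ln (s i)) \<le> C" if "i < n" for i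
      using member_le_sum[of i "{..<n}" "\<lambda>i. q i * (- ln (s i))"] that by auto
    have "(\<Sum>i<n. s i * h i) = hs_inner \<tau> (pr V j)"
      unfolding W(2) h_def by (rule hs_inner_pr[symmetric]) (use w v j in auto)
    also have "\<dots> = t * m"
      using inner[of "pr V j"] hs_inner_pr_same[OF V j, of b] v bj by (simp add: m_def)
    also have "\<dots> \<le> t" using m1 t by (simp add: mult_left_le)
    finally have sh: "s i * h i \<le> t" if "i < n" for i
      using member_le_sum[of i "{..<n}" "\<lambda>i. s i * h i"] that s(1) h by (force intro: order_trans)
    have ld: "0 < - ln \<delta>" using d by simp
    \<comment> \<open>Eigenvectors of \<open>\<tau>\<close> split at \<open>\<delta>\<close>. A
      large eigenvalue forces a small overlap \<open>h i\<close>, because \<open>\<tau>\<close> has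
      weight at most \<open>t\<close> on column \<open>j\<close>; a small eigenvalue forces a small
      weight \<open>q i\<close>, because the cross entropy of \<open>\<mu>\<close> is
      bounded.\<close>
    have qo: "q i * h i \<le> t / \<delta> + C / (- ln \<delta>)" if i: "i < n" for i
    proof (cases "\<delta> \<le> s i")
      case True
      have "\<delta> * h i \<le> s i * h i" using True h[OF i] by (intro mult_right_mono) auto
      also have "\<dots> \<le> t" by (rule sh[OF i])
      finally have "h i \<le> t / \<delta>" using d by (simp add: field_simps)
      moreover have "q i * h i \<le> h i" using q[OF i] h[OF i] by (simp add: mult_left_le_one_le)
      moreover have "0 \<le> C / (- ln \<delta>)" using C ld by (intro divide_nonneg_pos)
      ultimately show ?thesis by linarith
    next
      case False
      have "q i \<le> C / (- ln \<delta>)"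
      proof (cases "s i = 0")
        case True
        then show ?thesis using s0[OF i] C ld by (simp add: divide_nonneg_pos divide_nonneg_neg)
      next
        case sn: False
        then have "- ln \<delta> \<le> - ln (s i)" using False s(1)[OF i] d by simp
        then have "q i * (- ln \<delta>) \<le> q i * (- ln (s i))" using q[OF i] by (intro mult_left_mono) auto
        also have "\<dots> \<le> C" by (rule qC[OF i])
        finally show ?thesis using ld by (simp only: pos_le_divide_eq)
      qed
      moreover have "q i * h i \<le> q i" using q[OF i] h[OF i] by (simp add: mult_left_le)
      moreover have "0 \<le> t / \<delta>" using t d by simp
      ultimately show ?thesis by linarith
    qed
    have "m \<le> N * (\<Sum>i<n. q i * h i)"
      unfolding m_def N_def q_def h_def by (rule hs_inner_pr_change_basis[OF mu V W(1) j])
    also have "\<dots> \<le> N * (\<Sum>i<n. t / \<delta> + C / (- ln \<delta>))"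
      using N qo by (intro mult_left_mono sum_mono) auto
    also have "\<dots> = N\<^sup>2 * (t / \<delta> + C / (- ln \<delta>))" by (simp add: N_def power2_eq_square)
    finally show ?thesis .
  qed
  \<comment> \<open>First \<open>\<delta>\<close> makes the logarithmic term at most
    \<open>m / 4\<close>, then \<open>t\<close> does the same for the other term, so that
    \<open>m\<close> would be at most \<open>m / 2\<close>. Writing \<open>C + 1\<close> keeps the
    exponent nonzero when \<open>C = 0\<close>.\<close>
  define \<delta> where "\<delta> = exp (- (4 * N\<^sup>2 * (C + 1) / m))"
  define t where "t = min (1 / 2) (\<delta> * m / (4 * N\<^sup>2))"
  have pos: "0 < 4 * N\<^sup>2 * (C + 1) / m" using N C m by (intro divide_pos_pos mult_pos_pos) auto
  have d: "0 < \<delta>" "\<delta> < 1" using pos by (auto simp: \<delta>_def)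
  have t: "0 < t" "t < 1" using d m N by (auto simp: t_def)
  have "N\<^sup>2 * (C / (- ln \<delta>)) = m / 4 * (C / (C + 1))" proof -
    have "N\<^sup>2 * (C / (4 * N\<^sup>2 * D / m)) = m / 4 * (C / D)" if "0 < D" for D
      using N m that by (simp add: field_simps)
    from this[of "C + 1"] show ?thesis using C by (simp add: \<delta>_def)
  qed
  also have "\<dots> \<le> m / 4 * 1" using C m by (intro mult_left_mono) auto
  finally have 1: "N\<^sup>2 * (C / (- ln \<delta>)) \<le> m / 4" by simp
  have "t \<le> \<delta> * m / (4 * N\<^sup>2)" by (simp add: t_def)
  then have 2: "N\<^sup>2 * (t / \<delta>) \<le> m / 4" using d N by (simp add: field_simps)
  have "m \<le> N\<^sup>2 * (t / \<delta>) + N\<^sup>2 * (C / (- ln \<delta>))" using key[OF t d] by (simp only: distrib_left)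
  then show False using 1 2 m by linarith
qed

section \<open>Real subspaces of Hermitian matrices\<close>

definition real_subspace :: "nat \<Rightarrow> complex mat set \<Rightarrow> bool" where
  "real_subspace n \<H> \<longleftrightarrow> \<H> \<subseteq> herm n \<and> 0\<^sub>m n n \<in> \<H> \<and> (\<forall>A\<in>\<H>. \<forall>B\<in>\<H>. A + B \<in> \<H>) \<and>
    (\<forall>A\<in>\<H>. \<forall>c :: real. complex_of_real c \<cdot>\<^sub>m A \<in> \<H>)"

definition herm_functional :: "nat \<Rightarrow> (complex mat \<Rightarrow> real) \<Rightarrow> bool" where
  "herm_functional n \<phi> \<longleftrightarrow> (\<forall>A\<in>herm n. \<forall>B\<in>herm n. \<phi> (A + B) = \<phi> A + \<phi> B) \<and>
    (\<forall>A\<in>herm n. \<forall>c. \<phi> (complex_of_real c \<cdot>\<^sub>m A) = c * \<phi> A)"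

lemma real_subspaceD:
  assumes "real_subspace n \<H>"
  shows "X \<in> \<H> \<Longrightarrow> X \<in> herm n" "X \<in> \<H> \<Longrightarrow> X \<in> carrier_mat n n" "0\<^sub>m n n \<in> \<H>"
    "X \<in> \<H> \<Longrightarrow> Y \<in> \<H> \<Longrightarrow> X + Y \<in> \<H>" "X \<in> \<H> \<Longrightarrow> complex_of_real c \<cdot>\<^sub>m X \<in> \<H>"
  using assms by (auto simp: real_subspace_def herm_def)

lemma minus_as_add_smult:
  "(A :: complex mat) \<in> carrier_mat n n \<Longrightarrow> B \<in> carrier_mat n n \<Longrightarrow>
    A - complex_of_real c \<cdot>\<^sub>m B = A + complex_of_real (- c) \<cdot>\<^sub>m B"
  by (rule eq_matI) auto

lemma real_subspace_minus_smult:
  assumes "real_subspace n \<H>" "X \<in> \<H>" "Y \<in> \<H>"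
  shows "X - complex_of_real c \<cdot>\<^sub>m Y \<in> \<H>"
  using assms real_subspaceD[OF assms(1)] by (simp only: minus_as_add_smult[of X n Y])

lemma herm_functional_zero: "herm_functional n \<phi> \<Longrightarrow> \<phi> (0\<^sub>m n n) = 0"
proof -
  assume "herm_functional n \<phi>"
  then have "\<phi> (0\<^sub>m n n + 0\<^sub>m n n) = \<phi> (0\<^sub>m n n) + \<phi> (0\<^sub>m n n)"
    unfolding herm_functional_def using herm_zero by blast
  then show ?thesis by simp
qed

lemma herm_functional_minus_smult:
  assumes "herm_functional n \<phi>" "X \<in> herm n" "Y \<in> herm n"
  shows "\<phi> (X - complex_of_real c \<cdot>\<^sub>m Y) = \<phi> X - c * \<phi> Y"
proof -
  have "\<phi> (X + complex_of_real (- c) \<cdot>\<^sub>m Y) = \<phi> X + (- c) * \<phi> Y"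
    using assms herm_smult[OF assms(3), of "- c"] unfolding herm_functional_def by (simp del: of_real_minus)
  then show ?thesis using minus_as_add_smult[of X n Y c] assms by (simp add: herm_carrier)
qed

lemma real_subspace_kernel:
  assumes "real_subspace n \<H>" "herm_functional n \<phi>"
  shows "real_subspace n {X \<in> \<H>. \<phi> X = 0}"
  using assms herm_functional_zero[OF assms(2)] unfolding real_subspace_def herm_functional_def
  by (auto simp: subset_iff)

lemma real_subspace_induct [consumes 1, case_names zero kernel]:
  assumes "real_subspace n \<H>"
    and zero: "P {0\<^sub>m n n}"
    and step: "\<And>\<H> \<phi> v. real_subspace n \<H> \<Longrightarrow> herm_functional n \<phi> \<Longrightarrow> v \<in> \<H> \<Longrightarrow> \<phi> v \<noteq> 0 \<Longrightarrow>
      P {X \<in> \<H>. \<phi> X = 0} \<Longrightarrow> P \<H>"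
  shows "P \<H>"
proof -
  have gen: "finite \<Phi> \<Longrightarrow> (\<forall>\<phi>\<in>\<Phi>. herm_functional n \<phi>) \<Longrightarrow> real_subspace n \<H> \<Longrightarrow>
      (\<forall>X\<in>\<H>. (\<forall>\<phi>\<in>\<Phi>. \<phi> X = 0) \<longrightarrow> X = 0\<^sub>m n n) \<Longrightarrow> P \<H>" for \<Phi> \<H>
  proof (induction \<Phi> arbitrary: \<H> rule: finite_induct)
    case empty
    then have "\<H> = {0\<^sub>m n n}" using real_subspaceD(3) by auto
    then show ?case using zero by simp
  next
    case (insert \<phi> \<Phi>)
    have lin: "herm_functional n \<phi>" using insert by auto
    show ?case
    proof (cases "\<forall>X\<in>\<H>. \<phi> X = 0")
      case True
      then show ?thesis using insert by auto
    next
      case False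
      then obtain v where v: "v \<in> \<H>" "\<phi> v \<noteq> 0" by auto
      have "P {X \<in> \<H>. \<phi> X = 0}"
        by (rule insert.IH) (use insert.prems lin in \<open>auto intro!: real_subspace_kernel\<close>)
      then show ?thesis using step[OF insert.prems(2) lin v] by simp
    qed
  qed
  define \<Phi> where "\<Phi> = (\<lambda>(i, j). \<lambda>X :: complex mat. Re (X $$ (i, j))) ` ({..<n} \<times> {..<n}) \<union>
    (\<lambda>(i, j). \<lambda>X :: complex mat. Im (X $$ (i, j))) ` ({..<n} \<times> {..<n})"
  have "P \<H>"
  proof (rule gen[of \<Phi> \<H>, OF _ _ assms(1)])
    show "finite \<Phi>" by (simp add: \<Phi>_def)
    show "\<forall>\<phi>\<in>\<Phi>. herm_functional n \<phi>"
      by (auto simp: \<Phi>_def herm_functional_def dest!: herm_carrier)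
    show "\<forall>X\<in>\<H>. (\<forall>\<phi>\<in>\<Phi>. \<phi> X = 0) \<longrightarrow> X = 0\<^sub>m n n"
    proof (intro ballI impI eq_matI)
      fix X i j assume X: "X \<in> \<H>" and z: "\<forall>\<phi>\<in>\<Phi>. \<phi> X = 0"
        and "i < dim_row (0\<^sub>m n n :: complex mat)" "j < dim_col (0\<^sub>m n n :: complex mat)"
      then have "i < n" "j < n" by auto
      then show "X $$ (i, j) = 0\<^sub>m n n $$ (i, j)" using z
        by (force simp: \<Phi>_def ball_Un complex_eq_iff)
    qed (use real_subspaceD(2)[OF assms(1)] in auto)
  qed
  then show ?thesis .
qed

lemma real_comb_carrier [simp]: "real_comb n Hs c \<in> carrier_mat n n"
  by (simp add: real_comb_def)

lemma real_comb_Nil: "real_comb n [] c = 0\<^sub>m n n"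
  by (rule eq_matI) (auto simp: real_comb_def)

lemma real_comb_snoc:
  assumes "v \<in> carrier_mat n n"
  shows "real_comb n (Hs @ [v]) c = real_comb n Hs c + complex_of_real (c (length Hs)) \<cdot>\<^sub>m v"
  by (rule eq_matI) (use assms in \<open>auto simp: real_comb_def nth_append intro!: sum.cong\<close>)

lemma real_comb_cong: "(\<And>l. l < length Hs \<Longrightarrow> c l = c' l) \<Longrightarrow> real_comb n Hs c = real_comb n Hs c'"
  by (rule eq_matI) (auto simp: real_comb_def intro!: sum.cong)

lemma add_minus_smult_cancel:
  "(X :: complex mat) \<in> carrier_mat n n \<Longrightarrow> v \<in> carrier_mat n n \<Longrightarrow> X = (X - c \<cdot>\<^sub>m v) + c \<cdot>\<^sub>m v"
  by (rule eq_matI) auto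

text \<open>A basis of the hyperplane is extended by \<open>v\<close>. Existence matters because
  \<open>gibbs_proj\<close> selects its basis with \<open>SOME\<close>.\<close>

lemma real_basis_exists: "real_subspace n \<H> \<Longrightarrow> \<exists>Hs. real_basis n \<H> Hs"
proof (induction rule: real_subspace_induct)
  case zero
  show ?case by (rule exI[of _ "[]"]) (auto simp: real_basis_def real_comb_Nil)
next
  case (kernel \<H> \<phi> v)
  note sub = real_subspaceD[OF kernel(1)]
  obtain Hs where "real_basis n {X \<in> \<H>. \<phi> X = 0} Hs" using kernel(5) by blast
  then have Hs: "set Hs \<subseteq> {X \<in> \<H>. \<phi> X = 0}" and rng: "{X \<in> \<H>. \<phi> X = 0} = range (real_comb n Hs)"
    and ind: "\<And>c. real_comb n Hs c = 0\<^sub>m n n \<Longrightarrow> (\<forall>l<length Hs. c l = 0)"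
    by (auto simp: real_basis_def)
  have vc: "v \<in> carrier_mat n n" using sub kernel by auto
  have inK: "real_comb n Hs c \<in> \<H>" "\<phi> (real_comb n Hs c) = 0" for c using rng by auto
  have "real_basis n \<H> (Hs @ [v])"
    unfolding real_basis_def
  proof (intro conjI allI impI)
    show "set (Hs @ [v]) \<subseteq> \<H>" using Hs kernel by auto
    show "\<H> = range (real_comb n (Hs @ [v]))"
    proof (rule Set.set_eqI, rule iffI)
      fix X assume X: "X \<in> \<H>"
      \<comment> \<open>The multiple of \<open>v\<close> whose removal puts \<open>X\<close> into
        the hyperplane.\<close>
      define a where "a = \<phi> X / \<phi> v"
      have "X - complex_of_real a \<cdot>\<^sub>m v \<in> {X \<in> \<H>. \<phi> X = 0}"
        using real_subspace_minus_smult[OF kernel(1) X kernel(3)]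
          herm_functional_minus_smult[OF kernel(2) sub(1)[OF X] sub(1)[OF kernel(3)], of a] kernel(4)
        by (simp add: a_def del: of_real_divide)
      then obtain c where c: "X - complex_of_real a \<cdot>\<^sub>m v = real_comb n Hs c" unfolding rng by auto
      have "real_comb n (Hs @ [v]) (c(length Hs := a)) = real_comb n Hs c + complex_of_real a \<cdot>\<^sub>m v"
        unfolding real_comb_snoc[OF vc] by (subst real_comb_cong[of Hs _ c]) auto
      also have "\<dots> = X" unfolding c[symmetric]
        using add_minus_smult_cancel[OF sub(2)[OF X] vc] by simp
      finally show "X \<in> range (real_comb n (Hs @ [v]))" by (metis rangeI)
    next
      fix X assume "X \<in> range (real_comb n (Hs @ [v]))"
      then show "X \<in> \<H>" using sub(4)[OF inK(1) sub(5)[OF kernel(3)]] by (auto simp: real_comb_snoc[OF vc])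
    qed
    fix c l assume z: "real_comb n (Hs @ [v]) c = 0\<^sub>m n n" and l: "l < length (Hs @ [v])"
    have z': "real_comb n Hs c + complex_of_real (c (length Hs)) \<cdot>\<^sub>m v = 0\<^sub>m n n"
      using z real_comb_snoc[OF vc] by simp
    have "\<phi> (real_comb n Hs c + complex_of_real (c (length Hs)) \<cdot>\<^sub>m v) = c (length Hs) * \<phi> v"
      using kernel(2) sub(1)[OF inK(1)] sub(1)[OF kernel(3)] herm_smult[OF sub(1)[OF kernel(3)]] inK(2)
      unfolding herm_functional_def by simp
    then have c0: "c (length Hs) = 0" using herm_functional_zero[OF kernel(2)] kernel(4) unfolding z' by simp
    have "complex_of_real 0 \<cdot>\<^sub>m v = 0\<^sub>m n n" using vc by (intro eq_matI) auto
    then have "real_comb n Hs c = 0\<^sub>m n n" using z' c0 by simp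
    then show "c l = 0" using ind c0 l by (auto simp: less_Suc_eq)
  qed
  then show ?case by blast
qed

text \<open>One Gram-Schmidt step per dimension: \<open>v\<close> is made orthogonal to the
  hyperplane, and the component along the resulting \<open>w\<close> is added to the projection onto
  the hyperplane.\<close>

lemma orthogonal_projection_exists:
  "real_subspace n \<H> \<Longrightarrow> \<forall>A\<in>herm n. \<exists>K\<in>\<H>. \<forall>X\<in>\<H>. hs_inner (A - K) X = 0"
proof (induction rule: real_subspace_induct)
  case zero
  have "hs_inner A (0\<^sub>m n n) = 0" if "A \<in> carrier_mat n n" for A
    using that by (simp add: hs_inner_sum[of _ n])
  then show ?case by (auto dest: herm_carrier simp: minus_carrier_mat)
next
  case (kernel \<H> \<phi> v)
  let ?K = "{X \<in> \<H>. \<phi> X = 0}"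
  note sub = real_subspaceD[OF kernel(1)]
  show ?case
  proof
    fix A assume A: "A \<in> herm n"
    have vh: "v \<in> herm n" using sub kernel by auto
    obtain K0 where K0: "K0 \<in> \<H>" "\<phi> K0 = 0" "\<And>X. X \<in> ?K \<Longrightarrow> hs_inner (A - K0) X = 0"
      using kernel(5) A by blast
    obtain Kv where Kv: "Kv \<in> \<H>" "\<phi> Kv = 0" "\<And>X. X \<in> ?K \<Longrightarrow> hs_inner (v - Kv) X = 0"
      using kernel(5) vh by blast
    define w where "w = v - Kv"
    have w': "w = v - complex_of_real 1 \<cdot>\<^sub>m Kv"
      using sub(2)[OF Kv(1)] herm_carrier[OF vh] by (intro eq_matI) (auto simp: w_def)
    have wH: "w \<in> \<H>" unfolding w' by (rule real_subspace_minus_smult[OF kernel(1,3) Kv(1)])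
    have wphi: "\<phi> w = \<phi> v"
      unfolding w' herm_functional_minus_smult[OF kernel(2) vh sub(1)[OF Kv(1)]] Kv by simp
    have "w \<noteq> 0\<^sub>m n n" using wphi kernel(4) herm_functional_zero[OF kernel(2)] by auto
    then have ww: "hs_inner w w \<noteq> 0" using hs_inner_self_eq_0[OF sub(1)[OF wH]] by blast
    define a where "a = hs_inner A w / hs_inner w w"
    define K where "K = K0 + complex_of_real a \<cdot>\<^sub>m w"
    have KH: "K \<in> \<H>" unfolding K_def by (intro sub(4,5) K0 wH)
    note cs = herm_carrier[OF A] sub(2)[OF K0(1)] sub(2)[OF wH]
    have in1: "hs_inner (A - K) X = hs_inner (A - K0) X - a * hs_inner w X" if X: "X \<in> carrier_mat n n" for X
      unfolding K_def using cs X
      by (simp add: hs_inner_minus_left[of _ n] hs_inner_add_left[of _ n] hs_inner_smult_left[of _ n] smult_carrier_mat)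
    have perpK: "hs_inner (A - K) X = 0" if "X \<in> ?K" for X
      using in1[of X] K0(3)[OF that] Kv(3)[OF that] sub(2) that by (simp add: w_def)
    have "hs_inner K0 w = 0"
      using Kv(3)[of K0] K0 hs_inner_commute[OF cs(2,3)] by (simp add: w_def)
    then have perpw: "hs_inner (A - K) w = 0"
      unfolding in1[OF cs(3)] using cs ww by (simp add: hs_inner_minus_left[of _ n] a_def)
    have "hs_inner (A - K) X = 0" if X: "X \<in> \<H>" for X
    proof -
      define b where "b = \<phi> X / \<phi> w"
      have "X - complex_of_real b \<cdot>\<^sub>m w \<in> ?K"
        using real_subspace_minus_smult[OF kernel(1) X wH]
          herm_functional_minus_smult[OF kernel(2) sub(1)[OF X] sub(1)[OF wH], of b] wphi kernel(4)
        by (simp add: b_def del: of_real_divide)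
      from perpK[OF this] have "hs_inner (A - K) X - b * hs_inner (A - K) w = 0"
        using cs sub(2)[OF X] sub(2)[OF KH]
        by (simp add: hs_inner_minus_right[of _ n] hs_inner_smult_right[of _ n] smult_carrier_mat minus_carrier_mat)
      then show ?thesis using perpw by simp
    qed
    then show "\<exists>K\<in>\<H>. \<forall>X\<in>\<H>. hs_inner (A - K) X = 0" using KH by blast
  qed
qed

lemma hs_inner_real_comb:
  assumes "set Hs \<subseteq> carrier_mat n n" and a: "a \<in> carrier_mat n n"
  shows "hs_inner (real_comb n Hs c) a = (\<Sum>l<length Hs. c l * hs_inner (Hs ! l) a)"
  using assms(1)
proof (induction Hs rule: rev_induct)
  case Nil
  then show ?case using a by (simp add: real_comb_Nil hs_inner_sum[of _ n])
next
  case (snoc v Hs)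
  then have v: "v \<in> carrier_mat n n" by simp
  then show ?case using snoc a
    by (simp add: real_comb_snoc hs_inner_add_left[of _ n] hs_inner_smult_left[of _ n] nth_append)
qed

text \<open>This removes the chosen basis from the argument: from here on, equal expectation values
  can be expressed by pairing with all of \<open>\<H>\<close>.\<close>

lemma expectation_map_eq_iff:
  assumes "real_basis n \<H> Hs" "\<H> \<subseteq> herm n" "a \<in> carrier_mat n n" "b \<in> carrier_mat n n"
  shows "expectation_map Hs a = expectation_map Hs b \<longleftrightarrow> (\<forall>X\<in>\<H>. hs_inner X a = hs_inner X b)"
proof -
  have s: "set Hs \<subseteq> \<H>" "\<H> = range (real_comb n Hs)" using assms(1) by (auto simp: real_basis_def)
  then have c: "set Hs \<subseteq> carrier_mat n n" using assms(2) by (auto simp: herm_def)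
  have "expectation_map Hs a = expectation_map Hs b \<longleftrightarrow> (\<forall>l<length Hs. hs_inner (Hs ! l) a = hs_inner (Hs ! l) b)"
    unfolding expectation_map_def by (auto simp: vec_eq_iff)
  also have "\<dots> \<longleftrightarrow> (\<forall>X\<in>\<H>. hs_inner X a = hs_inner X b)"
  proof
    assume "\<forall>l<length Hs. hs_inner (Hs ! l) a = hs_inner (Hs ! l) b"
    then show "\<forall>X\<in>\<H>. hs_inner X a = hs_inner X b"
      unfolding s(2) by (auto simp: hs_inner_real_comb[OF c] assms(3,4))
  next
    assume "\<forall>X\<in>\<H>. hs_inner X a = hs_inner X b"
    then show "\<forall>l<length Hs. hs_inner (Hs ! l) a = hs_inner (Hs ! l) b" using s(1) nth_mem by blast
  qed
  finally show ?thesis .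
qed

section \<open>Compactness of the state space\<close>

definition mat_tendsto :: "nat \<Rightarrow> (nat \<Rightarrow> complex mat) \<Rightarrow> complex mat \<Rightarrow> bool" where
  "mat_tendsto n X L \<longleftrightarrow> (\<forall>i<n. \<forall>j<n. (\<lambda>k. X k $$ (i, j)) \<longlonglongrightarrow> L $$ (i, j))"

lemma mat_tendstoD: "mat_tendsto n X L \<Longrightarrow> i < n \<Longrightarrow> j < n \<Longrightarrow> (\<lambda>k. X k $$ (i, j)) \<longlonglongrightarrow> L $$ (i, j)"
  by (simp add: mat_tendsto_def)

text \<open>Bolzano-Weierstrass one coordinate at a time: a monotone subsequence is extracted for
  the new coordinate, and convergence of the earlier ones survives.\<close>

lemma finite_family_convergent_subseq:
  fixes f :: "'a \<Rightarrow> nat \<Rightarrow> real"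
  assumes "finite I" "\<And>i. i \<in> I \<Longrightarrow> Bseq (f i)"
  shows "\<exists>r. strict_mono (r :: nat \<Rightarrow> nat) \<and> (\<forall>i\<in>I. convergent (\<lambda>k. f i (r k)))"
  using assms
proof (induction I rule: finite_induct)
  case empty
  then show ?case by (intro exI[of _ id]) (auto simp: strict_mono_def)
next
  case (insert a I)
  then obtain r where r: "strict_mono r" "\<forall>i\<in>I. convergent (\<lambda>k. f i (r k))" by auto
  obtain s where s: "strict_mono s" "monoseq (\<lambda>k. f a (r (s k)))"
    using seq_monosub[of "\<lambda>k. f a (r k)"] by auto
  obtain K where "\<And>k. norm (f a k) \<le> K" using insert.prems[of a] by (auto simp: Bseq_def)
  then have "Bseq (\<lambda>k. f a (r (s k)))" by (intro BseqI') auto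
  then have "convergent (\<lambda>k. f a (r (s k)))" using s(2) by (rule Bseq_monoseq_convergent)
  moreover have "convergent (\<lambda>k. f i (r (s k)))" if "i \<in> I" for i
    using convergent_subseq_convergent[OF r(2)[rule_format, OF that] s(1)] by (simp add: o_def)
  moreover have "strict_mono (\<lambda>k. r (s k))" using strict_mono_o[OF r(1) s(1)] by (simp add: o_def)
  ultimately show ?case by (intro exI[of _ "\<lambda>k. r (s k)"]) auto
qed

text \<open>The Frobenius norm dominates each entry, and its square is the sum of the squared
  eigenvalues, at most their sum, which is the trace.\<close>

lemma states_entry_bound:
  assumes "\<rho> \<in> states n" "i < n" "j < n"
  shows "cmod (\<rho> $$ (i, j)) \<le> 1"
proof -
  obtain U l where U: "unitary_mat n U" "\<rho> = udiag U l" and l: "\<And>i. i < n \<Longrightarrow> 0 \<le> l i"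
    "(\<Sum>i<n. l i) = 1" "\<And>i. i < n \<Longrightarrow> l i \<le> 1" using states_spectral[OF assms(1)] by metis
  have "(cmod (\<rho> $$ (i, j)))\<^sup>2 \<le> (\<Sum>k<n. (cmod (\<rho> $$ (i, k)))\<^sup>2)"
    using assms by (intro member_le_sum) auto
  also have "\<dots> \<le> (\<Sum>i<n. \<Sum>k<n. (cmod (\<rho> $$ (i, k)))\<^sup>2)"
    using assms by (intro member_le_sum[where f="\<lambda>i. \<Sum>k<n. (cmod (\<rho> $$ (i, k)))\<^sup>2"] sum_nonneg) auto
  also have "\<dots> = hs_inner \<rho> \<rho>" by (rule hs_inner_self[OF states_herm[OF assms(1)], symmetric])
  also have "\<dots> = (\<Sum>i<n. l i * l i)" unfolding U(2) by (rule hs_inner_udiag_same[OF U(1)])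
  also have "\<dots> \<le> (\<Sum>i<n. l i)" using l by (intro sum_mono) (auto intro: mult_left_le)
  finally have "(cmod (\<rho> $$ (i, j)))\<^sup>2 \<le> 1\<^sup>2" using l(2) by simp
  then show ?thesis by (rule power2_le_imp_le) simp
qed

lemma tendsto_hs_inner:
  assumes "mat_tendsto n X L" "\<And>k. X k \<in> carrier_mat n n" "L \<in> carrier_mat n n" "A \<in> carrier_mat n n"
  shows "(\<lambda>k. hs_inner A (X k)) \<longlonglongrightarrow> hs_inner A L"
  unfolding hs_inner_sum[OF assms(4) assms(2)] hs_inner_sum[OF assms(4) assms(3)]
  by (intro tendsto_sum tendsto_Re tendsto_mult tendsto_const mat_tendstoD[OF assms(1)]) auto

lemma limit_of_states:
  assumes X: "\<And>k. X k \<in> states n" and lim: "mat_tendsto n X L" and L: "L \<in> carrier_mat n n"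
  shows "L \<in> states n"
proof (rule statesI)
  have "L \<in> herm n"
  proof (rule hermI[OF L])
    fix i j assume ij: "i < n" "j < n"
    have "X k $$ (i, j) = cnj (X k $$ (j, i))" for k
      using states_herm[OF X] ij unfolding herm_iff by blast
    then have "(\<lambda>k. X k $$ (i, j)) \<longlonglongrightarrow> cnj (L $$ (j, i))"
      by (simp add: tendsto_cnj mat_tendstoD[OF lim ij(2,1)])
    then show "L $$ (i, j) = cnj (L $$ (j, i))" using mat_tendstoD[OF lim ij] LIMSEQ_unique by blast
  qed
  moreover have "0 \<le> Re ((L *\<^sub>v v) \<bullet>c v)" if v: "v \<in> carrier_vec n" for v
  proof -
    have "(\<lambda>k. Re ((X k *\<^sub>v v) \<bullet>c v)) \<longlonglongrightarrow> Re ((L *\<^sub>v v) \<bullet>c v)"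
      unfolding quadratic_form[OF states_carrier[OF X] v] quadratic_form[OF L v]
      by (intro tendsto_Re tendsto_sum tendsto_mult tendsto_const mat_tendstoD[OF lim]) auto
    then show ?thesis using states_psd[OF X] v by (intro LIMSEQ_le_const) (auto simp: psd_def)
  qed
  ultimately show "psd n L" by (simp add: psd_def)
  have "(\<lambda>k. hs_inner (1\<^sub>m n) (X k)) \<longlonglongrightarrow> hs_inner (1\<^sub>m n) L"
    by (rule tendsto_hs_inner[OF lim]) (use states_carrier[OF X] L in auto)
  then show "hs_inner (1\<^sub>m n) L = 1" using states_trace[OF X] by (simp add: LIMSEQ_const_iff)
qed

lemma states_compact:
  assumes X: "\<And>k. X k \<in> states n"
  shows "\<exists>r L. strict_mono (r :: nat \<Rightarrow> nat) \<and> L \<in> states n \<and> mat_tendsto n (\<lambda>k. X (r k)) L"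
proof -
  define f where "f = (\<lambda>(b, i, j) k. if b then Re (X k $$ (i, j)) else Im (X k $$ (i, j)))"
  have "Bseq (f p)" if p: "p \<in> UNIV \<times> {..<n} \<times> {..<n}" for p
  proof (rule BseqI'[of _ 1])
    fix k
    obtain b i j where p': "p = (b, i, j)" "i < n" "j < n" using p by auto
    show "norm (f p k) \<le> 1"
      using states_entry_bound[OF X p'(2,3), of k] abs_Re_le_cmod[of "X k $$ (i, j)"] abs_Im_le_cmod[of "X k $$ (i, j)"]
      by (auto simp: f_def p'(1))
  qed
  then obtain r where r: "strict_mono (r :: nat \<Rightarrow> nat)"
    and conv: "\<And>p. p \<in> UNIV \<times> {..<n} \<times> {..<n} \<Longrightarrow> convergent (\<lambda>k. f p (r k))"
    using finite_family_convergent_subseq[of "UNIV \<times> {..<n} \<times> {..<n}" f] by auto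
  define L where "L = mat n n (\<lambda>(i, j). Complex (lim (\<lambda>k. f (True, i, j) (r k))) (lim (\<lambda>k. f (False, i, j) (r k))))"
  have lim: "mat_tendsto n (\<lambda>k. X (r k)) L"
    unfolding mat_tendsto_def
  proof (intro allI impI)
    fix i j assume ij: "i < n" "j < n"
    have "(\<lambda>k. f (b, i, j) (r k)) \<longlonglongrightarrow> lim (\<lambda>k. f (b, i, j) (r k))" for b
      using conv[of "(b, i, j)"] ij by (simp add: convergent_LIMSEQ_iff)
    from this[of True] this[of False] show "(\<lambda>k. X (r k) $$ (i, j)) \<longlonglongrightarrow> L $$ (i, j)"
      unfolding tendsto_complex_iff using ij by (simp add: L_def f_def)
  qed
  have "L \<in> states n" by (rule limit_of_states[OF _ lim]) (use X in \<open>auto simp: L_def\<close>)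
  then show ?thesis using r lim by blast
qed

text \<open>In \<open>entropy_modulus\<close> the additive error is fixed at half the tolerance; the
  remaining error is a constant times the squared Frobenius distance and tends to zero.\<close>

lemma tendsto_vn_entropy:
  assumes X: "\<And>k. X k \<in> states n" and lim: "mat_tendsto n X L" and L: "L \<in> states n"
  shows "(\<lambda>k. vn_entropy (X k)) \<longlonglongrightarrow> vn_entropy L"
proof (rule LIMSEQ_I)
  fix \<eta> :: real assume \<eta>: "0 < \<eta>"
  define \<epsilon> where "\<epsilon> = \<eta> / (2 * (real n + 1))"
  have e: "0 < \<epsilon>" using \<eta> by (simp add: \<epsilon>_def)
  have ne: "real n * \<epsilon> \<le> \<eta> / 2" using \<eta> by (simp add: \<epsilon>_def field_simps)
  note Lc = states_carrier[OF L] and Xc = states_carrier[OF X]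
  have "(\<lambda>k. (cmod ((X k - L) $$ (i, j)))\<^sup>2) \<longlonglongrightarrow> 0" if "i < n" "j < n" for i j
  proof -
    have "(\<lambda>k. (cmod (X k $$ (i, j) - L $$ (i, j)))\<^sup>2) \<longlonglongrightarrow> (cmod (L $$ (i, j) - L $$ (i, j)))\<^sup>2"
      by (intro tendsto_intros mat_tendstoD[OF lim] that)
    then show ?thesis using Lc Xc that by simp
  qed
  then have "(\<lambda>k. \<Sum>i<n. \<Sum>j<n. (cmod ((X k - L) $$ (i, j)))\<^sup>2) \<longlonglongrightarrow> (\<Sum>i<n. \<Sum>j<n. 0)"
    by (intro tendsto_sum) auto
  also have "(\<lambda>k. \<Sum>i<n. \<Sum>j<n. (cmod ((X k - L) $$ (i, j)))\<^sup>2) = (\<lambda>k. hs_inner (X k - L) (X k - L))"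
    by (rule ext, rule hs_inner_self[symmetric]) (intro herm_minus states_herm X L)
  finally have "(\<lambda>k. hs_inner (X k - L) (X k - L)) \<longlonglongrightarrow> 0" by simp
  then have g: "(\<lambda>k. 32 / \<epsilon> ^ 4 * hs_inner (X k - L) (X k - L)) \<longlonglongrightarrow> 32 / \<epsilon> ^ 4 * 0"
    by (intro tendsto_mult tendsto_const)
  have "0 < \<eta> / 2" using \<eta> by simp
  from LIMSEQ_D[OF g this] obtain K where K: "\<And>k. k \<ge> K \<Longrightarrow> \<bar>32 / \<epsilon> ^ 4 * hs_inner (X k - L) (X k - L)\<bar> < \<eta> / 2"
    by (auto simp: real_norm_def)
  show "\<exists>no. \<forall>k\<ge>no. norm (vn_entropy (X k) - vn_entropy L) < \<eta>"
  proof (intro exI[of _ K] allI impI)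
    fix k assume "K \<le> k"
    from K[OF this] entropy_modulus[OF e X L, of k] ne
    show "norm (vn_entropy (X k) - vn_entropy L) < \<eta>" unfolding real_norm_def by linarith
  qed
qed

text \<open>Stated with all of \<open>\<H>\<close> rather than a basis, so that linear arguments can
  use any element directly.\<close>

definition fiber :: "nat \<Rightarrow> complex mat set \<Rightarrow> complex mat \<Rightarrow> complex mat set" where
  "fiber n \<H> \<rho> = {\<tau> \<in> states n. \<forall>X\<in>\<H>. hs_inner X \<tau> = hs_inner X \<rho>}"

lemma max_entropy_exists:
  assumes rho: "\<rho> \<in> states n" and H: "\<H> \<subseteq> herm n"
  shows "\<exists>\<sigma>\<in>fiber n \<H> \<rho>. \<forall>\<mu>\<in>fiber n \<H> \<rho>. vn_entropy \<mu> \<le> vn_entropy \<sigma>"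
proof -
  define S where "S = Sup (vn_entropy ` fiber n \<H> \<rho>)"
  have bdd: "bdd_above (vn_entropy ` fiber n \<H> \<rho>)"
    using vn_entropy_le_dim by (intro bdd_aboveI[of _ "real n"]) (auto simp: fiber_def)
  have ne: "vn_entropy ` fiber n \<H> \<rho> \<noteq> {}" using rho by (auto simp: fiber_def)
  have "\<exists>x\<in>fiber n \<H> \<rho>. S - inverse (real (Suc k)) < vn_entropy x" for k
  proof -
    have "S - inverse (real (Suc k)) < S" by simp
    then show ?thesis unfolding S_def less_cSup_iff[OF ne bdd] by auto
  qed
  then obtain X where X: "\<And>k. X k \<in> fiber n \<H> \<rho>" "\<And>k. S - inverse (real (Suc k)) < vn_entropy (X k)" by metis
  have Xs: "X k \<in> states n" for k using X(1) by (simp add: fiber_def)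
  obtain r L where r: "strict_mono (r :: nat \<Rightarrow> nat)" and L: "L \<in> states n"
    and lim: "mat_tendsto n (\<lambda>k. X (r k)) L" using states_compact[of X n] Xs by blast
  have "hs_inner A L = hs_inner A \<rho>" if A: "A \<in> \<H>" for A
  proof -
    have "(\<lambda>k. hs_inner A (X (r k))) \<longlonglongrightarrow> hs_inner A L"
      by (rule tendsto_hs_inner[OF lim]) (use states_carrier Xs L A H herm_carrier in auto)
    then show ?thesis using X(1) A by (simp add: fiber_def LIMSEQ_const_iff)
  qed
  then have Lf: "L \<in> fiber n \<H> \<rho>" using L by (simp add: fiber_def)
  have "(\<lambda>k. vn_entropy (X (r k))) \<longlonglongrightarrow> vn_entropy L"
    by (rule tendsto_vn_entropy[OF _ lim L]) (rule Xs)
  moreover have "(\<lambda>k. S - inverse (real (Suc (r k)))) \<longlonglongrightarrow> S - 0"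
    using LIMSEQ_subseq_LIMSEQ[OF LIMSEQ_inverse_real_of_nat r] by (intro tendsto_intros) (simp add: o_def)
  ultimately have "S \<le> vn_entropy L"
    using X(2) by (intro LIMSEQ_le[of _ S]) (auto intro: less_imp_le)
  then show ?thesis using Lf cSup_upper[OF _ bdd] by (auto simp: S_def intro!: bexI[of _ L] intro: order_trans)
qed

section \<open>Corners of the matrix algebra\<close>

lemma psd_udiag_general:
  assumes U: "U \<in> carrier_mat n n" and l: "\<And>i. i < n \<Longrightarrow> 0 \<le> l i"
  shows "psd n (udiag U l)"
  unfolding psd_def
  by (auto simp: quadratic_form_udiag[OF U] udiag_herm[OF U] l intro!: sum_nonneg simp del: of_real_sum)

text \<open>The factors \<open>p\<close> are absorbed into the frame of the eigenvectors; the frame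
  stops being unitary, but nonnegative coefficients still give a nonnegative quadratic form.\<close>

lemma psd_sandwich:
  assumes p: "p \<in> herm n" and E: "psd n E"
  shows "psd n (p * E * p)"
proof -
  obtain X e where X: "unitary_mat n X" "E = udiag X e" "\<And>i. i < n \<Longrightarrow> 0 \<le> e i"
    using psd_spectral[OF E] by blast
  note x = unitary_matD(1)[OF X(1)] and pc = herm_carrier[OF p]
  have "p * E * p = udiag (p * X) e"
    unfolding X(2) udiag_def using x pc herm_adjoint[OF p]
    by (simp add: assoc_mult_square[of _ n] mat_adjoint_mult[where m=n and n=n and l=n])
  then show ?thesis using psd_udiag_general[of "p * X" n e] x pc X(3) by simp
qed

lemma sandwich_idem:
  assumes "p \<in> carrier_mat n n" "p * p = p" "A \<in> carrier_mat n n"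
  shows "p * (p * A * p) * p = p * A * p"
proof -
  have "p * (p * A * p) * p = (p * p) * A * (p * p)" using assms(1,3) by (simp add: assoc_mult_square[of _ n])
  then show ?thesis using assms(2) by simp
qed

lemma sandwich_add_smult:
  assumes p: "p \<in> carrier_mat n n" and A: "A \<in> carrier_mat n n" and B: "B \<in> carrier_mat n n"
  shows "p * (A + c \<cdot>\<^sub>m B) * p = p * A * p + c \<cdot>\<^sub>m (p * B * (p :: complex mat))"
proof -
  have "p * (A + c \<cdot>\<^sub>m B) = p * A + c \<cdot>\<^sub>m (p * B)"
    using assms by (simp add: mult_add_distrib_mat[of _ n n] mult_smult_distrib[of _ n n])
  then show ?thesis
    using assms by (simp add: add_mult_distrib_mat[of _ n n] mult_smult_assoc_mat[of _ n n])
qed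

text \<open>The operator inequality \<open>- M p \<le> \<delta> \<le> M p\<close> in dual form. As
  \<open>\<delta>\<close> is its own compression, it sees only \<open>p * E * p\<close>, a positive
  matrix whose trace is \<open>hs_inner p E\<close>.\<close>

lemma sandwich_bound:
  assumes p: "p \<in> herm n" "p * p = p" and d: "\<delta> \<in> herm n" "p * \<delta> * p = \<delta>"
  shows "\<exists>M>0. \<forall>E. psd n E \<longrightarrow> \<bar>hs_inner \<delta> E\<bar> \<le> M * hs_inner p E"
proof -
  obtain W m where W: "unitary_mat n W" "\<delta> = udiag W m" using herm_spectral[OF d(1)] by blast
  note w = unitary_matD(1)[OF W(1)] and pc = herm_carrier[OF p(1)]
  \<comment> \<open>A crude bound for the operator norm of \<open>\<delta>\<close>; the summand 1
    makes it positive, since it is used as a denominator.\<close>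
  define M where "M = 1 + (\<Sum>k<n. \<bar>m k\<bar>)"
  have mM: "\<bar>m k\<bar> \<le> M" if "k < n" for k
    using member_le_sum[of k "{..<n}" "\<lambda>k. \<bar>m k\<bar>"] that by (auto simp: M_def)
  have "\<bar>hs_inner \<delta> E\<bar> \<le> M * hs_inner p E" if E: "psd n E" for E
  proof -
    have Ec: "E \<in> carrier_mat n n" using E psd_herm herm_carrier by blast
    obtain Y x where Y: "unitary_mat n Y" "p * E * p = udiag Y x" and x: "\<And>i. i < n \<Longrightarrow> 0 \<le> x i"
      using psd_spectral[OF psd_sandwich[OF p(1) E]] by blast
    note y = unitary_matD(1)[OF Y(1)]
    have "hs_inner \<delta> E = hs_inner (p * \<delta> * p) E" using d(2) by simp
    also have "\<dots> = hs_inner \<delta> (p * E * p)" using hs_inner_sandwich[OF pc herm_carrier[OF d(1)] Ec] .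
    also have "\<dots> = (\<Sum>k<n. \<Sum>j<n. m k * x j * ov W Y k j)" unfolding Y(2) W(2) by (rule hs_inner_udiag[OF w y])
    also have "\<bar>\<dots>\<bar> \<le> (\<Sum>k<n. \<Sum>j<n. \<bar>m k * x j * ov W Y k j\<bar>)"
      by (intro order_trans[OF sum_abs] sum_mono sum_abs)
    also have "\<dots> \<le> (\<Sum>k<n. \<Sum>j<n. (M * x j) * ov W Y k j)"
      by (intro sum_mono) (auto simp: abs_mult x intro!: mult_right_mono mM)
    also have "\<dots> = M * (\<Sum>j<n. x j)" unfolding ov_sums(2)[OF W(1) Y(1)] by (simp add: sum_distrib_left)
    also have "(\<Sum>j<n. x j) = hs_inner (1\<^sub>m n) (p * E * p)" unfolding Y(2) hs_inner_one_udiag[OF Y(1)] ..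
    also have "\<dots> = hs_inner (p * 1\<^sub>m n * p) E" by (rule hs_inner_sandwich[symmetric]) (use pc Ec in auto)
    also have "p * 1\<^sub>m n * p = p" using pc p(2) by simp
    finally show ?thesis .
  qed
  moreover have "0 < M" unfolding M_def by (intro add_pos_nonneg sum_nonneg) auto
  ultimately show ?thesis by blast
qed

section \<open>Support projections and perturbations inside a corner\<close>

definition supp_proj :: "complex mat \<Rightarrow> (nat \<Rightarrow> real) \<Rightarrow> complex mat" where
  "supp_proj V b = udiag V (\<lambda>j. if b j = 0 then 0 else 1)"

lemma supp_proj_props:
  assumes V: "unitary_mat n V"
  shows "supp_proj V b \<in> herm n" "supp_proj V b \<in> carrier_mat n n" "supp_proj V b * supp_proj V b = supp_proj V b"
  using udiag_herm[OF unitary_matD(1)[OF V]] unitary_matD(1)[OF V]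
  by (auto simp: supp_proj_def udiag_mult[OF V] intro!: udiag_cong)

lemma supp_proj_udiag:
  assumes V: "unitary_mat n V" and f: "\<And>j. j < n \<Longrightarrow> b j = 0 \<Longrightarrow> f j = 0"
  shows "supp_proj V b * udiag V f * supp_proj V b = udiag V f"
  unfolding supp_proj_def udiag_mult[OF V] by (rule udiag_cong) (use f unitary_matD(1)[OF V] in auto)

lemma corner_pr_zero:
  assumes V: "unitary_mat n V" and mu: "\<mu> \<in> herm n" "supp_proj V b * \<mu> * supp_proj V b = \<mu>"
    and j: "j < n" "b j = 0"
  shows "hs_inner \<mu> (pr V j) = 0"
proof -
  note v = unitary_matD(1)[OF V] and s = supp_proj_props[OF V, of b]
  have "hs_inner \<mu> (pr V j) = hs_inner (supp_proj V b * \<mu> * supp_proj V b) (pr V j)" using mu by simp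
  also have "\<dots> = hs_inner \<mu> (supp_proj V b * pr V j * supp_proj V b)"
    by (rule hs_inner_sandwich) (use s herm_carrier[OF mu(1)] v in auto)
  also have "supp_proj V b * pr V j * supp_proj V b = udiag V (\<lambda>_. 0)"
    unfolding supp_proj_def pr_def udiag_mult[OF V] by (rule udiag_cong) (use j in auto)
  also have "hs_inner \<mu> (udiag V (\<lambda>_. 0)) = 0" unfolding hs_inner_udiag_expand[OF mu(1) V] by simp
  finally show ?thesis .
qed

text \<open>For a positive semidefinite matrix a zero diagonal entry annihilates its whole row and
  column. Hence vanishing weights on the columns outside the support already place the matrix in the
  corner.\<close>

lemma pr_zero_corner:
  assumes V: "unitary_mat n V" and mu: "psd n \<mu>"
    and z: "\<And>j. j < n \<Longrightarrow> b j = 0 \<Longrightarrow> hs_inner \<mu> (pr V j) = 0"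
  shows "supp_proj V b * \<mu> * supp_proj V b = \<mu>"
proof -
  obtain U a where U: "unitary_mat n U" "\<mu> = udiag U a" and a: "\<And>i. i < n \<Longrightarrow> 0 \<le> a i"
    using psd_spectral[OF mu] by blast
  note u = unitary_matD[OF U(1)] and v = unitary_matD[OF V] and muc = herm_carrier[OF psd_herm[OF mu]]
  \<comment> \<open>The eigenvectors of \<open>\<mu>\<close> in the coordinates of \<open>V\<close>,
    so that \<open>udiag B a\<close> is \<open>\<mu>\<close> written in the basis
    \<open>V\<close>.\<close>
  define B where "B = mat_adjoint V * U"
  define x where "x j = complex_of_real (if b j = 0 then 0 else 1)" for j
  have Bc: "B \<in> carrier_mat n n" using u v by (simp add: B_def)
  let ?V = "mat_adjoint V" and ?X = "mat_diag n x"
  have adjc: "?V \<in> carrier_mat n n" and Xc: "?X \<in> carrier_mat n n" using v by auto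
  have ent: "x j * udiag B a $$ (j, k) * x k = udiag B a $$ (j, k)" if jk: "j < n" "k < n" for j k
  proof -
    have zz: "B $$ (j, i) * a i = 0" if "b j = 0" "i < n" "j < n" for i j
    proof -
      have "ov U V i j = 0 \<or> a i = 0"
        using overlap_zero[where a=a and i=i and j=j, OF U(1) V a] z[OF that(3,1)] that U(2) by auto
      then show ?thesis
      proof
        assume "ov U V i j = 0"
        then have "(mat_adjoint U * V) $$ (i, j) = 0" by (simp add: ov_def)
        moreover have "B = mat_adjoint (mat_adjoint U * V)"
          using u v by (simp add: B_def mat_adjoint_mult[where m=n and n=n and l=n])
        ultimately show ?thesis using that u v by simp
      qed simp
    qed
    have zz': "a i * cnj (B $$ (j, i)) = 0" if "b j = 0" "i < n" "j < n" for i j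
      using zz[OF that] by auto
    show ?thesis
    proof (cases "b j = 0 \<or> b k = 0")
      case True
      have "udiag B a $$ (j, k) = 0" unfolding udiag_index[OF Bc jk]
        using True zz zz' jk by (intro sum.neutral ballI) (auto simp: mult.assoc)
      then show ?thesis by simp
    qed (simp add: x_def)
  qed
  have "?X * udiag B a = mat n n (\<lambda>(i, j). x i * udiag B a $$ (i, j))"
    by (rule mat_diag_mult_left) (use Bc in auto)
  then have "?X * udiag B a * ?X = mat n n (\<lambda>(i, j). x i * udiag B a $$ (i, j) * x j)"
    by (subst mat_diag_mult_right[of _ n]) auto
  then have XBX: "?X * udiag B a * ?X = udiag B a"
    using ent Bc by (intro eq_matI) auto
  have Bm: "udiag B a = ?V * \<mu> * V"
    unfolding U(2) udiag_def B_def using u v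
    by (simp add: assoc_mult_square[of _ n] mat_adjoint_mult[where m=n and n=n and l=n])
  have s: "supp_proj V b = V * ?X * ?V"
    using v by (simp add: supp_proj_def udiag_def x_def[abs_def])
  have "supp_proj V b * \<mu> * supp_proj V b = V * (?X * (?V * \<mu> * V) * ?X) * ?V"
    unfolding s using v(1) adjc Xc muc by (simp add: assoc_mult_square[of _ n] del: mat_diag_diag)
  also have "?X * (?V * \<mu> * V) * ?X = ?V * \<mu> * V" using XBX Bm by simp
  also have "V * (?V * \<mu> * V) * ?V = (V * ?V) * \<mu> * (V * ?V)"
    using v(1) adjc muc by (simp add: assoc_mult_square[of _ n])
  also have "\<dots> = \<mu>" using v(2) muc by simp
  finally show ?thesis .
qed

lemma corner_states_iff:
  assumes "p \<in> carrier_mat n n" "p * p = p"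
  shows "\<rho> \<in> corner_states n p \<longleftrightarrow> \<rho> \<in> states n \<and> p * \<rho> * p = \<rho>"
proof
  assume "\<rho> \<in> corner_states n p"
  then show "\<rho> \<in> states n \<and> p * \<rho> * p = \<rho>"
    using sandwich_idem[OF assms] by (auto simp: corner_states_def)
next
  assume r: "\<rho> \<in> states n \<and> p * \<rho> * p = \<rho>"
  then have "\<rho> = p * \<rho> * p" "\<rho> \<in> carrier_mat n n" using states_carrier by auto
  then show "\<rho> \<in> corner_states n p" using r unfolding corner_states_def by blast
qed

lemma corner_states_supp_proj_iff:
  assumes V: "unitary_mat n V"
  shows "\<mu> \<in> corner_states n (supp_proj V b) \<longleftrightarrow>
    \<mu> \<in> states n \<and> (\<forall>j<n. b j = 0 \<longrightarrow> hs_inner \<mu> (pr V j) = 0)"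
  unfolding corner_states_iff[OF supp_proj_props(2,3)[OF V]]
  using corner_pr_zero[OF V states_herm] pr_zero_corner[OF V states_psd] by blast

lemma min_positive_exists:
  fixes b :: "nat \<Rightarrow> real"
  assumes "\<And>j. j < n \<Longrightarrow> 0 \<le> b j"
  shows "\<exists>c>0. \<forall>j<n. b j \<noteq> 0 \<longrightarrow> c \<le> b j"
proof -
  define S where "S = insert 1 (b ` {j. j < n \<and> b j \<noteq> 0})"
  have S: "finite S" "S \<noteq> {}" by (auto simp: S_def)
  have "0 < Min S" using S assms by (subst Min_gr_iff) (auto simp: S_def less_le)
  moreover have "Min S \<le> b j" if "j < n" "b j \<noteq> 0" for j
    using that S by (intro Min_le) (auto simp: S_def)
  ultimately show ?thesis by blast
qed

text \<open>A state is a relative interior point of the corner of its support. It dominates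
  \<open>c\<close> times the support projection, with \<open>c\<close> below all nonzero
  eigenvalues, and \<open>\<delta>\<close> is dominated by \<open>M\<close> times that projection,
  so every \<open>t\<close> with absolute value at most \<open>c / M\<close> is admissible.\<close>

lemma perturbed_state:
  assumes V: "unitary_mat n V" and sg: "udiag V b \<in> states n"
    and d: "\<delta> \<in> herm n" "supp_proj V b * \<delta> * supp_proj V b = \<delta>" "hs_inner (1\<^sub>m n) \<delta> = 0"
  shows "\<exists>\<epsilon>>0. \<forall>t. \<bar>t\<bar> \<le> \<epsilon> \<longrightarrow> udiag V b + complex_of_real t \<cdot>\<^sub>m \<delta> \<in> states n"
proof -
  note v = unitary_matD(1)[OF V] and s = supp_proj_props[OF V, of b]
  have b: "\<And>j. j < n \<Longrightarrow> 0 \<le> b j" "(\<Sum>j<n. b j) = 1" using sg udiag_states_iff[OF V] by auto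
  obtain c where c: "0 < c" "\<And>j. j < n \<Longrightarrow> b j \<noteq> 0 \<Longrightarrow> c \<le> b j" using min_positive_exists[of n b] b by blast
  obtain M where M: "0 < M" "\<And>E. psd n E \<Longrightarrow> \<bar>hs_inner \<delta> E\<bar> \<le> M * hs_inner (supp_proj V b) E"
    using sandwich_bound[OF s(1,3) d(1,2)] by blast
  have dc: "\<delta> \<in> carrier_mat n n" using d herm_carrier by blast
  have low: "c * hs_inner (supp_proj V b) E \<le> hs_inner (udiag V b) E" if E: "psd n E" for E
  proof -
    have Ec: "E \<in> carrier_mat n n" using E psd_herm herm_carrier by blast
    have "psd n (udiag V (\<lambda>j. b j - c * (if b j = 0 then 0 else 1)))"
      unfolding psd_udiag_iff[OF V] using b c by auto
    then have "psd n (udiag V b - complex_of_real c \<cdot>\<^sub>m supp_proj V b)"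
      unfolding supp_proj_def udiag_smult[OF v] udiag_minus[OF v] .
    from hs_inner_psd_nonneg[OF this E] show ?thesis
      using v s Ec by (simp add: hs_inner_minus_left[of _ n] hs_inner_smult_left[of _ n] smult_carrier_mat)
  qed
  have "udiag V b + complex_of_real t \<cdot>\<^sub>m \<delta> \<in> states n" if t: "\<bar>t\<bar> \<le> c / M" for t
  proof (rule statesI)
    let ?A = "udiag V b + complex_of_real t \<cdot>\<^sub>m \<delta>"
    have "?A \<in> herm n" by (intro herm_add herm_smult d udiag_herm v)
    then obtain X e where X: "unitary_mat n X" "?A = udiag X e" using herm_spectral by blast
    note x = unitary_matD(1)[OF X(1)]
    have "0 \<le> e i" if i: "i < n" for i
    proof -
      let ?E = "pr X i"
      have E: "psd n ?E" by (rule psd_pr[OF X(1)])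
      have "e i = hs_inner ?A ?E" unfolding X(2) by (rule hs_inner_pr_same[OF X(1) i, symmetric])
      also have "\<dots> = hs_inner (udiag V b) ?E + t * hs_inner \<delta> ?E"
        using v dc x by (simp add: hs_inner_add_left[of _ n] hs_inner_smult_left[of _ n] smult_carrier_mat)
      finally have e: "e i = hs_inner (udiag V b) ?E + t * hs_inner \<delta> ?E" .
      have "\<bar>t * hs_inner \<delta> ?E\<bar> \<le> (c / M) * (M * hs_inner (supp_proj V b) ?E)"
        unfolding abs_mult using t M(2)[OF E] M(1) c by (intro mult_mono) auto
      also have "\<dots> = c * hs_inner (supp_proj V b) ?E" using M by simp
      finally show ?thesis using e low[OF E] by linarith
    qed
    then show "psd n ?A" unfolding X(2) psd_udiag_iff[OF X(1)] by simp
    show "hs_inner (1\<^sub>m n) ?A = 1" using v dc d(3) states_trace[OF sg]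
      by (simp add: hs_inner_add_right[of _ n] hs_inner_smult_right[of _ n] smult_carrier_mat)
  qed
  then show ?thesis using c M by (intro exI[of _ "c / M"]) auto
qed

section \<open>The maximum entropy state of a fiber\<close>

text \<open>The substitute for a derivative test: near 0 a nonzero linear term of either sign cannot
  be controlled by a quadratic one.\<close>

lemma zero_of_quadratic_bound:
  fixes g :: real
  assumes e: "0 < \<epsilon>" and K: "0 \<le> K" and b: "\<And>t. \<bar>t\<bar> \<le> \<epsilon> \<Longrightarrow> - (t * g) \<le> t\<^sup>2 * K"
  shows "g = 0"
proof (rule ccontr)
  assume g: "g \<noteq> 0"
  define r where "r = min \<epsilon> (\<bar>g\<bar> / (2 * (K + 1)))"
  have r: "0 < r" "r \<le> \<epsilon>" "r \<le> \<bar>g\<bar> / (2 * (K + 1))" using e g K by (auto simp: r_def)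
  \<comment> \<open>The sign of \<open>t\<close> is chosen opposite to \<open>g\<close>, which turns
    the left side into \<open>r * \<bar>g\<bar>\<close>; the size of \<open>r\<close> leaves at most
    half of it on the right.\<close>
  have "- ((- sgn g * r) * g) \<le> (- sgn g * r)\<^sup>2 * K"
    using r g by (intro b) (auto simp: abs_mult abs_sgn_eq)
  then have "r * \<bar>g\<bar> \<le> r * (r * K)" using g
    by (cases "0 < g") (auto simp: power2_eq_square mult_ac)
  then have "\<bar>g\<bar> \<le> r * K" using r by simp
  also have "\<dots> \<le> \<bar>g\<bar> / (2 * (K + 1)) * K" using r K by (intro mult_right_mono) auto
  also have "\<dots> = \<bar>g\<bar> * (K / (2 * (K + 1)))" by simp
  also have "\<dots> \<le> \<bar>g\<bar> * (1 / 2)" using K by (intro mult_left_mono) (auto simp: field_simps)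
  finally show False using g by simp
qed

text \<open>The maximizer is carried as an eigendecomposition instead of a matrix, so that its
  support projection and its logarithm have explicit formulas in the same basis.\<close>

locale fiber_maximizer =
  fixes n :: nat and \<H> :: "complex mat set" and \<rho> :: "complex mat" and V :: "complex mat" and b :: "nat \<Rightarrow> real"
  assumes H: "real_subspace n \<H>" and one: "1\<^sub>m n \<in> \<H>" and V: "unitary_mat n V"
    and in_fiber: "udiag V b \<in> fiber n \<H> \<rho>"
    and maximal: "\<And>\<mu>. \<mu> \<in> fiber n \<H> \<rho> \<Longrightarrow> vn_entropy \<mu> \<le> vn_entropy (udiag V b)"
begin

abbreviation "sgm \<equiv> udiag V b"
abbreviation "sp \<equiv> supp_proj V b"

lemma sgm_state: "sgm \<in> states n"
  using in_fiber by (simp add: fiber_def)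

lemma b_nonneg: "j < n \<Longrightarrow> 0 \<le> b j" and b_sum: "(\<Sum>j<n. b j) = 1"
  using sgm_state udiag_states_iff[OF V] by auto

lemma V_carrier: "V \<in> carrier_mat n n"
  by (rule unitary_matD(1)[OF V])

lemmas sp_props = supp_proj_props[OF V, of b]

lemma H_carrier: "X \<in> \<H> \<Longrightarrow> X \<in> carrier_mat n n"
  using real_subspaceD(2)[OF H] .

text \<open>The segment from the maximizer to \<open>\<mu>\<close> stays inside the fiber, so
  \<open>maximizer_support\<close> applies to it.\<close>

lemma fiber_support:
  assumes mu: "\<mu> \<in> fiber n \<H> \<rho>" and j: "j < n" "b j = 0"
  shows "hs_inner \<mu> (pr V j) = 0"
proof (rule maximizer_support[OF V sgm_state _ _ j])
  show ms: "\<mu> \<in> states n" using mu by (simp add: fiber_def)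
  fix t :: real assume t: "0 < t" "t < 1"
  have "complex_of_real (1 - t) \<cdot>\<^sub>m sgm + complex_of_real t \<cdot>\<^sub>m \<mu> \<in> fiber n \<H> \<rho>"
    unfolding fiber_def
  proof (intro CollectI conjI ballI)
    show "complex_of_real (1 - t) \<cdot>\<^sub>m sgm + complex_of_real t \<cdot>\<^sub>m \<mu> \<in> states n"
      using t by (intro states_convex sgm_state ms) auto
    fix X assume X: "X \<in> \<H>"
    have "hs_inner X sgm = hs_inner X \<rho>" "hs_inner X \<mu> = hs_inner X \<rho>"
      using in_fiber mu X by (auto simp: fiber_def)
    then show "hs_inner X (complex_of_real (1 - t) \<cdot>\<^sub>m sgm + complex_of_real t \<cdot>\<^sub>m \<mu>) = hs_inner X \<rho>"
      using H_carrier[OF X] V_carrier states_carrier[OF ms]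
      by (simp add: hs_inner_add_right[of _ n] hs_inner_smult_right[of _ n] smult_carrier_mat algebra_simps del: of_real_diff)
  qed
  then show "vn_entropy (complex_of_real (1 - t) \<cdot>\<^sub>m sgm + complex_of_real t \<cdot>\<^sub>m \<mu>) \<le> vn_entropy sgm"
    by (rule maximal)
qed

text \<open>Moving along \<open>\<delta>\<close> by a small \<open>t\<close> of either sign stays in
  the fiber. The entropy there is at most the maximum, yet at least its linearization minus a
  quadratic error by \<open>entropy_lower_bound\<close>; so the linear term vanishes.\<close>

lemma stationary:
  assumes d: "\<delta> \<in> herm n" "sp * \<delta> * sp = \<delta>" and perp: "\<And>X. X \<in> \<H> \<Longrightarrow> hs_inner X \<delta> = 0"
  shows "hs_inner (mlog sgm) \<delta> = 0"
proof -
  have dc: "\<delta> \<in> carrier_mat n n" using d herm_carrier by blast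
  obtain \<epsilon> where e: "0 < \<epsilon>" and st: "\<And>t. \<bar>t\<bar> \<le> \<epsilon> \<Longrightarrow> sgm + complex_of_real t \<cdot>\<^sub>m \<delta> \<in> states n"
    using perturbed_state[OF V sgm_state d perp[OF one]] by blast
  obtain c where c: "0 < c" "\<And>j. j < n \<Longrightarrow> b j \<noteq> 0 \<Longrightarrow> c \<le> b j"
    using min_positive_exists[of n b] b_nonneg by blast
  let ?L = "udiag V (\<lambda>j. ln (b j))"
  have L: "mlog sgm = ?L" by (rule mlog_udiag[OF V])
  have "hs_inner \<delta> ?L = 0"
  proof (rule zero_of_quadratic_bound[OF e, of "hs_inner \<delta> \<delta> / c"])
    show "0 \<le> hs_inner \<delta> \<delta> / c" using hs_inner_self_nonneg[OF d(1)] c by simp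
    fix t assume t: "\<bar>t\<bar> \<le> \<epsilon>"
    let ?m = "sgm + complex_of_real t \<cdot>\<^sub>m \<delta>"
    have fib: "?m \<in> fiber n \<H> \<rho>"
      unfolding fiber_def
    proof (intro CollectI conjI ballI st[OF t])
      fix X assume X: "X \<in> \<H>"
      have "hs_inner X sgm = hs_inner X \<rho>" using in_fiber X by (auto simp: fiber_def)
      then show "hs_inner X ?m = hs_inner X \<rho>"
        using H_carrier[OF X] V_carrier dc perp[OF X]
        by (simp add: hs_inner_add_right[of _ n] hs_inner_smult_right[of _ n] smult_carrier_mat)
    qed
    have diff: "?m - sgm = complex_of_real t \<cdot>\<^sub>m \<delta>" using V_carrier dc by (intro eq_matI) auto
    have "- hs_inner ?m ?L - hs_inner (?m - sgm) (?m - sgm) / c \<le> vn_entropy ?m"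
      by (rule entropy_lower_bound[OF st[OF t] V b_nonneg b_sum fiber_support[OF fib] c])
    also have "\<dots> \<le> vn_entropy sgm" by (rule maximal[OF fib])
    also have "\<dots> = - hs_inner sgm ?L" unfolding vn_entropy_eq L ..
    finally show "- (t * hs_inner \<delta> ?L) \<le> t\<^sup>2 * (hs_inner \<delta> \<delta> / c)"
      unfolding diff using V_carrier dc
      by (simp add: hs_inner_add_left[of _ n] hs_inner_smult_left[of _ n] hs_inner_smult_right[of _ n]
          smult_carrier_mat power2_eq_square)
  qed
  then show ?thesis unfolding L using hs_inner_commute[OF dc, of ?L] V_carrier by simp
qed

text \<open>The difference \<open>\<delta>\<close> between the logarithm and its orthogonal
  projection onto the compressed space is itself an admissible direction. Stationarity makes it
  orthogonal to the logarithm, hence to itself.\<close>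

lemma mlog_in_corner: "\<exists>X\<in>\<H>. mlog sgm = sp * X * sp"
proof -
  define \<K> where "\<K> = (\<lambda>X. sp * X * sp) ` \<H>"
  have spc: "sp \<in> carrier_mat n n" by (rule sp_props(2))
  have sub: "real_subspace n \<K>"
    unfolding real_subspace_def
  proof (intro conjI ballI allI)
    show "\<K> \<subseteq> herm n" using real_subspaceD(1)[OF H] by (auto simp: \<K>_def intro!: herm_sandwich sp_props)
    have "sp * 0\<^sub>m n n * sp = 0\<^sub>m n n" using spc by simp
    then show "0\<^sub>m n n \<in> \<K>" using real_subspaceD(3)[OF H] unfolding \<K>_def by (metis imageI)
  next
    fix A B assume "A \<in> \<K>" "B \<in> \<K>"
    then obtain X Y where X: "X \<in> \<H>" "Y \<in> \<H>" "A = sp * X * sp" "B = sp * Y * sp" by (auto simp: \<K>_def)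
    note XY = H_carrier[OF X(1)] H_carrier[OF X(2)]
    have "sp * (X + Y) * sp = (sp * X + sp * Y) * sp" using XY spc by (simp add: mult_add_distrib_mat[of _ n n])
    also have "\<dots> = A + B" unfolding X(3,4)
      by (rule add_mult_distrib_mat[of _ n n]) (use XY spc in \<open>auto intro!: mult_square_carrier\<close>)
    finally have "A + B = sp * (X + Y) * sp" by simp
    then show "A + B \<in> \<K>" using real_subspaceD(4)[OF H X(1,2)] by (auto simp: \<K>_def)
  next
    fix A and c :: real assume "A \<in> \<K>"
    then obtain X where X: "X \<in> \<H>" "A = sp * X * sp" by (auto simp: \<K>_def)
    have "complex_of_real c \<cdot>\<^sub>m A = sp * (complex_of_real c \<cdot>\<^sub>m X) * sp"
      using H_carrier[OF X(1)] X spc by (simp add: mult_smult_distrib[of _ n n] mult_smult_assoc_mat[of _ n n])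
    then show "complex_of_real c \<cdot>\<^sub>m A \<in> \<K>" using real_subspaceD(5)[OF H X(1)] by (auto simp: \<K>_def)
  qed
  have Lh: "mlog sgm \<in> herm n" by (intro mlog_herm udiag_herm V_carrier)
  obtain K where K: "K \<in> \<K>" and perp: "\<And>X. X \<in> \<K> \<Longrightarrow> hs_inner (mlog sgm - K) X = 0"
    using orthogonal_projection_exists[OF sub] Lh by blast
  define \<delta> where "\<delta> = mlog sgm - K"
  obtain X where X: "X \<in> \<H>" "K = sp * X * sp" using K by (auto simp: \<K>_def)
  have Kh: "K \<in> herm n" using real_subspaceD(1)[OF sub K] .
  note cs = herm_carrier[OF Lh] herm_carrier[OF Kh]
  have dh: "\<delta> \<in> herm n" unfolding \<delta>_def by (intro herm_minus Lh Kh)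
  note dc = herm_carrier[OF dh]
  have sL: "sp * mlog sgm * sp = mlog sgm"
    unfolding mlog_udiag[OF V] by (rule supp_proj_udiag[OF V]) simp
  have sK: "sp * K * sp = K" unfolding X(2) by (rule sandwich_idem[OF spc sp_props(3) H_carrier[OF X(1)]])
  have \<delta>': "\<delta> = mlog sgm + (-1) \<cdot>\<^sub>m K" using cs by (intro eq_matI) (auto simp: \<delta>_def)
  have sd: "sp * \<delta> * sp = \<delta>"
    unfolding \<delta>' sandwich_add_smult[OF spc cs] sL sK ..
  \<comment> \<open>Orthogonality to the compressions \<open>sp * Y * sp\<close> gives orthogonality
    to \<open>Y\<close> itself, because \<open>\<delta>\<close> equals its own compression.\<close>
  have "hs_inner Y \<delta> = 0" if Y: "Y \<in> \<H>" for Y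
  proof -
    have "hs_inner Y \<delta> = hs_inner Y (sp * \<delta> * sp)" using sd by simp
    also have "\<dots> = hs_inner (sp * Y * sp) \<delta>" by (rule hs_inner_sandwich[symmetric, OF spc H_carrier[OF Y] dc])
    also have "\<dots> = hs_inner \<delta> (sp * Y * sp)"
      by (rule hs_inner_commute[of _ n]) (use spc H_carrier[OF Y] dc in \<open>auto intro!: mult_square_carrier\<close>)
    also have "\<dots> = 0" unfolding \<delta>_def by (rule perp) (use Y in \<open>auto simp: \<K>_def\<close>)
    finally show ?thesis .
  qed
  then have "hs_inner (mlog sgm) \<delta> = 0" by (rule stationary[OF dh sd])
  moreover have "hs_inner K \<delta> = 0" using perp[OF K] hs_inner_commute[OF cs(2) dc] by (simp add: \<delta>_def)
  ultimately have "hs_inner (mlog sgm - K) \<delta> = 0" using cs dc by (simp add: hs_inner_minus_left[of _ n])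
  then have "hs_inner \<delta> \<delta> = 0" by (simp add: \<delta>_def)
  then have z: "\<delta> = 0\<^sub>m n n" by (rule hs_inner_self_eq_0[OF dh])
  have "mlog sgm = K"
  proof (rule eq_matI)
    fix i j assume ij: "i < dim_row K" "j < dim_col K"
    then have "(mlog sgm - K) $$ (i, j) = 0" using z cs by (simp add: \<delta>_def)
    then show "mlog sgm $$ (i, j) = K $$ (i, j)" using ij cs by simp
  qed (use cs in auto)
  then show ?thesis using X by blast
qed

lemma sp_projection: "sp \<in> projections n"
proof -
  have "sp \<noteq> 0\<^sub>m n n"
  proof
    assume "sp = 0\<^sub>m n n"
    moreover have "sp * sgm * sp = sgm" by (rule supp_proj_udiag[OF V]) simp
    ultimately have "sgm = 0\<^sub>m n n" using V_carrier by simp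
    then have "hs_inner (1\<^sub>m n) (0\<^sub>m n n) = 1" using states_trace[OF sgm_state] by simp
    then show False by (simp add: hs_inner_sum[of _ n])
  qed
  then show ?thesis using sp_props herm_adjoint[OF sp_props(1)] by (simp add: projections_def)
qed

lemma sgm_gibbs_corner: "sgm \<in> gibbs_corner \<H> sp"
proof -
  obtain X where X: "X \<in> \<H>" "mlog sgm = sp * X * sp" using mlog_in_corner by blast
  \<comment> \<open>On the kernel the convention \<open>ln 0 = 0\<close> makes the exponential 1,
    not 0; the factor \<open>sp\<close> removes this part.\<close>
  have "sp * mexp (sp * X * sp) = udiag V (\<lambda>j. (if b j = 0 then 0 else 1) * exp (ln (b j)))"
    by (simp only: X(2)[symmetric] mlog_udiag[OF V] mexp_udiag[OF V]) (simp only: supp_proj_def udiag_mult[OF V])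
  also have "\<dots> = sgm" by (rule udiag_cong) (use b_nonneg V_carrier in \<open>auto simp: less_le\<close>)
  finally have eq: "sp * mexp (sp * X * sp) = sgm" .
  have "mtrace sgm = 1" using sgm_state by (simp add: states_def)
  then have "sgm = (1 / mtrace (sp * mexp (sp * X * sp))) \<cdot>\<^sub>m (sp * mexp (sp * X * sp))"
    unfolding eq using V_carrier by (intro eq_matI) auto
  then show ?thesis using X(1) unfolding gibbs_corner_def by blast
qed

text \<open>The segment from \<open>\<tau>'\<close> to the maximizer can be prolonged slightly to a
  state \<open>\<tau>''\<close>. A mixture of \<open>\<tau>''\<close> with \<open>\<tau>\<close> has
  the same expectation values as the maximizer, because \<open>\<tau>\<close> and
  \<open>\<tau>'\<close> agree on \<open>\<H>\<close>. The mixture thus lies in the fiber and is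
  supported in \<open>sp\<close>, and so are its two components.\<close>

lemma corner_face:
  assumes tau: "\<tau> \<in> states n" and tau': "\<tau>' \<in> corner_states n sp"
    and eq: "\<And>X. X \<in> \<H> \<Longrightarrow> hs_inner X \<tau> = hs_inner X \<tau>'"
  shows "\<tau> \<in> corner_states n sp"
proof -
  have t's: "\<tau>' \<in> states n" and t'c: "sp * \<tau>' * sp = \<tau>'"
    using tau' corner_states_iff[OF sp_props(2,3)] by auto
  note c1 = states_carrier[OF tau] and c2 = states_carrier[OF t's]
  define \<delta> where "\<delta> = sgm - \<tau>'"
  have dh: "\<delta> \<in> herm n" unfolding \<delta>_def by (intro herm_minus states_herm sgm_state t's)
  note dc = herm_carrier[OF dh]
  have \<delta>': "\<delta> = sgm + (-1) \<cdot>\<^sub>m \<tau>'" using V_carrier c2 by (intro eq_matI) (auto simp: \<delta>_def)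
  have ss: "sp * sgm * sp = sgm" by (rule supp_proj_udiag[OF V]) simp
  have sd: "sp * \<delta> * sp = \<delta>"
    unfolding \<delta>' sandwich_add_smult[OF sp_props(2) udiag_carrier[OF V_carrier] c2] t'c ss ..
  have tr: "hs_inner (1\<^sub>m n) \<delta> = 0"
    unfolding \<delta>_def using V_carrier c2 states_trace[OF sgm_state] states_trace[OF t's]
    by (simp add: hs_inner_minus_right[of _ n])
  obtain \<epsilon> where e: "0 < \<epsilon>" and st: "\<And>t. \<bar>t\<bar> \<le> \<epsilon> \<Longrightarrow> sgm + complex_of_real t \<cdot>\<^sub>m \<delta> \<in> states n"
    using perturbed_state[OF V sgm_state dh sd tr] by blast
  define \<tau>'' where "\<tau>'' = sgm + complex_of_real \<epsilon> \<cdot>\<^sub>m \<delta>"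
  have t''s: "\<tau>'' \<in> states n" unfolding \<tau>''_def using e by (intro st) auto
  note c3 = states_carrier[OF t''s]
  \<comment> \<open>The weight for which the contributions of \<open>\<tau>\<close> and
    \<open>\<tau>'\<close> to the expectation values cancel.\<close>
  define u where "u = \<epsilon> / (1 + \<epsilon>)"
  have u: "0 < u" "u < 1" "1 - u = 1 / (1 + \<epsilon>)" using e by (auto simp: u_def field_simps)
  define \<mu> where "\<mu> = complex_of_real (1 - u) \<cdot>\<^sub>m \<tau>'' + complex_of_real u \<cdot>\<^sub>m \<tau>"
  have ms: "\<mu> \<in> states n" unfolding \<mu>_def using u by (intro states_convex t''s tau) auto
  have inner: "hs_inner X \<mu> = (1 - u) * hs_inner X \<tau>'' + u * hs_inner X \<tau>" if "X \<in> carrier_mat n n" for X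
    unfolding \<mu>_def using that c1 c3
    by (simp add: hs_inner_add_right[of _ n] hs_inner_smult_right[of _ n] smult_carrier_mat del: of_real_diff)
  have "\<mu> \<in> fiber n \<H> \<rho>" unfolding fiber_def
  proof (intro CollectI conjI ballI ms)
    fix X assume X: "X \<in> \<H>"
    have "hs_inner X \<tau>'' = hs_inner X sgm + \<epsilon> * (hs_inner X sgm - hs_inner X \<tau>')"
      unfolding \<tau>''_def \<delta>_def using H_carrier[OF X] V_carrier c2
      by (simp add: hs_inner_add_right[of _ n] hs_inner_smult_right[of _ n] hs_inner_minus_right[of _ n]
          smult_carrier_mat minus_carrier_mat)
    then have "hs_inner X \<mu> = (1 / (1 + \<epsilon>)) * (hs_inner X sgm + \<epsilon> * (hs_inner X sgm - hs_inner X \<tau>')) +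
        \<epsilon> / (1 + \<epsilon>) * hs_inner X \<tau>'"
      using inner[OF H_carrier[OF X]] u(3) eq[OF X] by (simp add: u_def)
    also have "\<dots> = hs_inner X sgm" using e by (simp add: divide_simps) (simp add: algebra_simps)
    finally show "hs_inner X \<mu> = hs_inner X \<rho>" using in_fiber X by (simp add: fiber_def)
  qed
  then have m0: "hs_inner \<mu> (pr V j) = 0" if "j < n" "b j = 0" for j
    using fiber_support that by blast
  have "hs_inner \<tau> (pr V j) = 0" if j: "j < n" "b j = 0" for j
  proof -
    have p: "pr V j \<in> carrier_mat n n" using V_carrier by simp
    have "hs_inner \<mu> (pr V j) = (1 - u) * hs_inner \<tau>'' (pr V j) + u * hs_inner \<tau> (pr V j)"
      using inner[OF p] hs_inner_commute[OF p] c1 c3 states_carrier[OF ms] by simp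
    moreover have "0 \<le> hs_inner \<tau>'' (pr V j)" "0 \<le> hs_inner \<tau> (pr V j)"
      using hs_inner_psd_nonneg[OF _ psd_pr[OF V]] states_psd t''s tau by auto
    ultimately have "u * hs_inner \<tau> (pr V j) \<le> 0" using m0[OF j] u
      by (smt (verit) mult_nonneg_nonneg)
    then show ?thesis using u \<open>0 \<le> hs_inner \<tau> (pr V j)\<close> by (simp add: mult_le_0_iff)
  qed
  then show ?thesis using corner_states_supp_proj_iff[OF V] tau by blast
qed

end

section \<open>The projection onto the extended Gibbs family\<close>

lemma projectionsD:
  assumes "p \<in> projections n"
  shows "p \<in> herm n" "p \<in> carrier_mat n n" "p * p = p" "p \<noteq> 0\<^sub>m n n"
  using assms by (auto simp: projections_def herm_def)

text \<open>Diagonalizing \<open>K + C p\<close> for a large constant \<open>C\<close> diagonalizes \<open>K = p K p\<close> and \<open>p\<close> simultaneously,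
  since the range of \<open>p\<close> becomes the range of \<open>K + C p\<close>.\<close>

lemma simultaneous_diagonalization:
  assumes p: "p \<in> herm n" "p * p = p" and K: "K \<in> herm n" "p * K * p = K"
  shows "\<exists>V k \<chi>. unitary_mat n V \<and> K = udiag V k \<and> p = udiag V \<chi> \<and>
    (\<forall>i<n. \<chi> i = 0 \<or> \<chi> i = 1) \<and> (\<forall>i<n. \<chi> i = 0 \<longrightarrow> k i = 0)"
proof -
  note pc = herm_carrier[OF p(1)] and Kc = herm_carrier[OF K(1)]
  obtain M where M: "0 < M" "\<And>E. psd n E \<Longrightarrow> \<bar>hs_inner K E\<bar> \<le> M * hs_inner p E"
    using sandwich_bound[OF p K] by blast
  \<comment> \<open>With \<open>C = M + 1\<close> the matrix \<open>L\<close> dominates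
    \<open>p\<close>, so it vanishes only on the kernel of \<open>p\<close>.\<close>
  define C where "C = M + 1"
  define L where "L = K + complex_of_real C \<cdot>\<^sub>m p"
  have "L \<in> herm n" unfolding L_def by (intro herm_add herm_smult K p)
  then obtain V l where V: "unitary_mat n V" "L = udiag V l" using herm_spectral by blast
  obtain W q where W: "unitary_mat n W" "p = udiag W q" using herm_spectral[OF p(1)] by blast
  note v = unitary_matD(1)[OF V(1)] and w = unitary_matD(1)[OF W(1)]
  define \<chi> where "\<chi> i = (if l i = 0 then 0 else 1 :: real)" for i
  have q01: "q i = 0 \<or> q i = 1" if "i < n" for i
  proof -
    have "udiag W (\<lambda>i. q i * q i) = udiag W q" using p(2) unfolding W(2) udiag_mult[OF W(1)] .
    from udiag_eq_imp_ov[OF W(1) W(1) this that that] have "q i * q i = q i"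
      using ov_self[OF W(1) that that] by simp
    then show ?thesis by simp
  qed
  have Kp: "K * p = K"
  proof -
    have "K * p = p * K * (p * p)" using K(2) pc Kc by (metis assoc_mult_square mult_square_carrier)
    then show ?thesis using p(2) K(2) by simp
  qed
  have Lp: "L * p = L"
    unfolding L_def using pc Kc Kp p(2)
    by (simp add: add_mult_distrib_mat[of _ n n] mult_smult_assoc_mat[of _ n n])
  \<comment> \<open>\<open>L * p = L\<close>, so \<open>L\<close> kills the kernel of
    \<open>p\<close>; its eigenvectors with nonzero eigenvalue are orthogonal to that
    kernel.\<close>
  have z1: "ov W V i j = 0" if ij: "i < n" "j < n" and lj: "l j \<noteq> 0" and qi: "q i = 0" for i j
  proof -
    have "p * pr W i = udiag W (\<lambda>_. 0)"
      unfolding W(2) pr_def udiag_mult[OF W(1)] by (rule udiag_cong) (use qi in auto)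
    also have "\<dots> = 0\<^sub>m n n" using w by (intro eq_matI) (auto simp: udiag_index)
    finally have pz: "p * pr W i = 0\<^sub>m n n" .
    have Lc: "L \<in> carrier_mat n n" unfolding V(2) using v by simp
    have wc: "pr W i \<in> carrier_mat n n" using w by simp
    have "L * pr W i = (L * p) * pr W i" using Lp by simp
    also have "\<dots> = L * (p * pr W i)" using Lc pc wc by (rule assoc_mult_square)
    finally have Lz: "L * pr W i = 0\<^sub>m n n" using Lc by (simp add: pz)
    have "hs_inner (pr W i) (L * L) = hs_inner (pr W i * L) L"
      unfolding hs_inner_def using wc Lc by (simp add: assoc_mult_square[of _ n])
    also have "\<dots> = hs_inner L (pr W i * L)"
      by (rule hs_inner_commute[of _ n]) (use wc Lc in \<open>auto intro!: mult_square_carrier\<close>)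
    also have "\<dots> = Re (mtrace (L * pr W i * L))"
      unfolding hs_inner_def using wc Lc by (simp add: assoc_mult_square[of _ n])
    also have "\<dots> = 0" unfolding Lz using Lc by (simp add: mtrace_def)
    finally have "hs_inner (udiag W (\<lambda>k. if k = i then 1 else 0)) (udiag V (\<lambda>j. l j * l j)) = 0"
      unfolding V(2) udiag_mult[OF V(1)] pr_def .
    then have "(\<Sum>k<n. \<Sum>j<n. if k = i then l j * l j * ov W V k j else 0) = 0"
      unfolding hs_inner_udiag[OF w v] by (simp add: if_distrib[of "\<lambda>x. x * _"] cong: if_cong)
    then have "(\<Sum>j<n. \<Sum>k<n. if k = i then l j * l j * ov W V k j else 0) = 0"
      by (subst sum.swap)
    then have "(\<Sum>j<n. l j * l j * ov W V i j) = 0" using ij by simp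
    then have "\<forall>j\<in>{..<n}. l j * l j * ov W V i j = 0"
      by (subst (asm) sum_nonneg_eq_0_iff) auto
    then show ?thesis using ij lj by auto
  qed
  \<comment> \<open>Conversely, on a null vector of \<open>L\<close> the bound on \<open>K\<close>
    leaves a nonpositive expectation of \<open>p\<close>, so \<open>p\<close> vanishes there as
    well.\<close>
  have z0: "ov W V i j = 0" if ij: "i < n" "j < n" and lj: "l j = 0" and qi: "q i = 1" for i j
  proof -
    have E: "psd n (pr V j)" by (rule psd_pr[OF V(1)])
    have vc: "pr V j \<in> carrier_mat n n" using v by simp
    have "hs_inner L (pr V j) = 0" unfolding V(2) using hs_inner_pr_same[OF V(1) ij(2), of l] lj by simp
    then have "hs_inner K (pr V j) + C * hs_inner p (pr V j) = 0"
      unfolding L_def using Kc pc vc by (simp add: hs_inner_add_left[of _ n] hs_inner_smult_left[of _ n] smult_carrier_mat)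
    moreover have "\<bar>hs_inner K (pr V j)\<bar> \<le> M * hs_inner p (pr V j)" by (rule M(2)[OF E])
    ultimately have "hs_inner p (pr V j) \<le> 0" by (simp add: C_def distrib_right)
    moreover have "psd n p" unfolding W(2) psd_udiag_iff[OF W(1)] using q01 by force
    then have "0 \<le> hs_inner p (pr V j)" by (rule hs_inner_psd_nonneg[OF _ E])
    ultimately have "hs_inner (udiag W q) (pr V j) = 0" using W(2) by simp
    moreover have "0 \<le> q i" if "i < n" for i using q01[OF that] by auto
    ultimately have "ov W V i j = 0 \<or> q i = 0"
      using overlap_zero[where a=q and i=i and j=j, OF W(1) V(1)] ij by blast
    then show ?thesis using qi by simp
  qed
  have pV: "p = udiag V \<chi>" unfolding W(2)
  proof (rule udiag_eq_ov[OF W(1) V(1)])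
    fix i j assume ij: "i < n" "j < n" and o: "ov W V i j \<noteq> 0"
    show "q i = \<chi> j" using z0[OF ij] z1[OF ij] o q01[OF ij(1)] by (auto simp: \<chi>_def)
  qed
  have "K = L - complex_of_real C \<cdot>\<^sub>m p" unfolding L_def using Kc pc by (intro eq_matI) auto
  then have "K = udiag V (\<lambda>i. l i - C * \<chi> i)" unfolding V(2) pV udiag_smult[OF v] udiag_minus[OF v] .
  then show ?thesis using V(1) pV
    by (intro exI[of _ V] exI[of _ "\<lambda>i. l i - C * \<chi> i"] exI[of _ \<chi>]) (auto simp: \<chi>_def)
qed

text \<open>On the corner, \<open>ln \<tau>\<close> is \<open>p * X * p\<close> minus
  \<open>ln Z\<close> times \<open>p\<close>. The cross entropy of \<open>\<mu>\<close> with
  \<open>\<tau>\<close> therefore depends only on the expectation of \<open>X\<close>, which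
  \<open>\<mu>\<close> and \<open>\<tau>\<close> share; Klein's inequality gives the maximum and its
  equality case the uniqueness.\<close>

lemma gibbs_corner_max_entropy:
  assumes tau: "\<tau> \<in> gibbs_corner \<H> p" and p: "p \<in> projections n" and H: "\<H> \<subseteq> herm n"
  shows "\<tau> \<in> corner_states n p"
    and "\<mu> \<in> corner_states n p \<Longrightarrow> (\<And>X. X \<in> \<H> \<Longrightarrow> hs_inner X \<mu> = hs_inner X \<tau>) \<Longrightarrow>
      vn_entropy \<mu> \<le> vn_entropy \<tau> \<and> (vn_entropy \<mu> = vn_entropy \<tau> \<longrightarrow> \<mu> = \<tau>)"
proof -
  note pp = projectionsD[OF p]
  obtain X where X: "X \<in> \<H>" and tau': "\<tau> = (1 / mtrace (p * mexp (p * X * p))) \<cdot>\<^sub>m (p * mexp (p * X * p))"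
    using tau by (auto simp: gibbs_corner_def)
  have Xh: "X \<in> herm n" and Xc: "X \<in> carrier_mat n n" using X H herm_carrier by auto
  define K where "K = p * X * p"
  have Kh: "K \<in> herm n" unfolding K_def by (intro herm_sandwich pp Xh)
  have pK: "p * K * p = K" unfolding K_def by (rule sandwich_idem[OF pp(2,3) Xc])
  obtain V k \<chi> where V: "unitary_mat n V" "K = udiag V k" "p = udiag V \<chi>"
    and chi: "\<And>i. i < n \<Longrightarrow> \<chi> i = 0 \<or> \<chi> i = 1" "\<And>i. i < n \<Longrightarrow> \<chi> i = 0 \<Longrightarrow> k i = 0"
    using simultaneous_diagonalization[OF pp(1,3) Kh pK] by metis
  note v = unitary_matD(1)[OF V(1)]
  define Z where "Z = (\<Sum>i<n. \<chi> i * exp (k i))"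
  define b where "b i = \<chi> i * exp (k i) / Z" for i
  have pe: "p * mexp K = udiag V (\<lambda>i. \<chi> i * exp (k i))"
    unfolding V(2,3) mexp_udiag[OF V(1)] udiag_mult[OF V(1)] ..
  have "\<exists>i<n. \<chi> i \<noteq> 0"
  proof (rule ccontr)
    assume "\<not> (\<exists>i<n. \<chi> i \<noteq> 0)"
    then have "p = 0\<^sub>m n n" unfolding V(3) using v by (intro eq_matI) (auto simp: udiag_index)
    then show False using pp by simp
  qed
  then obtain i0 where i0: "i0 < n" "\<chi> i0 = 1" using chi by blast
  have chi0: "0 \<le> \<chi> i" if "i < n" for i using chi(1)[OF that] by auto
  have "exp (k i0) \<le> Z" unfolding Z_def
    using member_le_sum[of i0 "{..<n}" "\<lambda>i. \<chi> i * exp (k i)"] i0 chi0 by auto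
  then have Z: "0 < Z" using exp_gt_zero[of "k i0"] by linarith
  have "1 / mtrace (p * mexp K) = complex_of_real (1 / Z)"
    unfolding pe mtrace_udiag[OF V(1)] by (simp add: Z_def)
  then have tb: "\<tau> = udiag V b"
    unfolding tau' K_def[symmetric] by (simp only: pe udiag_smult[OF v]) (simp add: b_def[abs_def])
  have b0: "0 \<le> b i" if "i < n" for i using chi0[OF that] Z by (simp add: b_def)
  have bs: "(\<Sum>i<n. b i) = 1" unfolding b_def sum_divide_distrib[symmetric] Z_def[symmetric] using Z by simp
  have ts: "\<tau> \<in> states n" unfolding tb udiag_states_iff[OF V(1)] using b0 bs by auto
  have ptp: "p * \<tau> * p = \<tau>" unfolding tb V(3) udiag_mult[OF V(1)]
    by (rule udiag_cong) (use chi(1) v in \<open>force simp: b_def\<close>)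
  show tcorner: "\<tau> \<in> corner_states n p" using corner_states_iff[OF pp(2,3)] ts ptp by simp
  define L where "L = udiag V (\<lambda>i. ln (b i))"
  \<comment> \<open>Where \<open>\<chi> i = 0\<close> both sides are zero: \<open>b i = 0\<close>
    with \<open>ln 0 = 0\<close>, and \<open>k i = 0\<close> because \<open>K\<close> lives in the
    corner.\<close>
  have "L = udiag V (\<lambda>i. k i + - ln Z * \<chi> i)" unfolding L_def
  proof (rule udiag_cong)
    fix i assume "i < dim_row V"
    then have "i < n" using v by simp
    then show "ln (b i) = k i + - ln Z * \<chi> i"
      using chi[of i] Z by (auto simp: b_def ln_div)
  qed
  then have L': "L = K + complex_of_real (- ln Z) \<cdot>\<^sub>m p"
    unfolding V(2,3) udiag_smult[OF v] udiag_add[OF v] .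
  have inner: "hs_inner \<mu> L = hs_inner X \<mu> - ln Z" if mu: "\<mu> \<in> corner_states n p" for \<mu>
  proof -
    have ms: "\<mu> \<in> states n" "p * \<mu> * p = \<mu>" using mu corner_states_iff[OF pp(2,3)] by auto
    note mc = states_carrier[OF ms(1)]
    have "hs_inner \<mu> K = hs_inner K \<mu>" by (rule hs_inner_commute[OF mc herm_carrier[OF Kh]])
    also have "\<dots> = hs_inner X (p * \<mu> * p)" unfolding K_def by (rule hs_inner_sandwich[OF pp(2) Xc mc])
    finally have 1: "hs_inner \<mu> K = hs_inner X \<mu>" using ms by simp
    have "hs_inner \<mu> p = hs_inner (p * 1\<^sub>m n * p) \<mu>" using hs_inner_commute[OF mc pp(2)] pp by simp
    also have "\<dots> = hs_inner (1\<^sub>m n) (p * \<mu> * p)" by (rule hs_inner_sandwich) (use pp mc in auto)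
    finally have 2: "hs_inner \<mu> p = 1" using ms states_trace by simp
    show ?thesis unfolding L' using 1 2 mc pp(2) herm_carrier[OF Kh]
      by (simp add: hs_inner_add_right[of _ n] hs_inner_smult_right[of _ n] smult_carrier_mat del: of_real_minus)
  qed
  assume mu: "\<mu> \<in> corner_states n p" and eq: "\<And>X. X \<in> \<H> \<Longrightarrow> hs_inner X \<mu> = hs_inner X \<tau>"
  have ms: "\<mu> \<in> states n" "p * \<mu> * p = \<mu>" using mu corner_states_iff[OF pp(2,3)] by auto
  have "supp_proj V b = p" unfolding supp_proj_def V(3)
    by (rule udiag_cong) (use chi(1) v Z in \<open>force simp: b_def\<close>)
  then have supp: "hs_inner \<mu> (pr V j) = 0" if "j < n" "b j = 0" for j
    using corner_pr_zero[OF V(1) states_herm[OF ms(1)], of b j] ms(2) that by simp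
  have "vn_entropy \<tau> = - hs_inner \<tau> L" unfolding vn_entropy_eq L_def by (simp add: tb mlog_udiag[OF V(1)])
  then have ht: "vn_entropy \<tau> = - hs_inner \<mu> L" using inner[OF mu] inner[OF tcorner] eq[OF X] by simp
  show "vn_entropy \<mu> \<le> vn_entropy \<tau> \<and> (vn_entropy \<mu> = vn_entropy \<tau> \<longrightarrow> \<mu> = \<tau>)"
  proof (intro conjI impI)
    show "vn_entropy \<mu> \<le> vn_entropy \<tau>" unfolding ht L_def
      by (rule klein_inequality(1)[OF ms(1) V(1) b0 bs supp])
    assume "vn_entropy \<mu> = vn_entropy \<tau>"
    then have eq: "vn_entropy \<mu> = - hs_inner \<mu> (udiag V (\<lambda>i. ln (b i)))" unfolding ht L_def .
    show "\<mu> = \<tau>" unfolding tb by (rule klein_inequality(2)[OF ms(1) V(1) b0 bs supp eq])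
  qed
qed

lemma seg_point_expectation:
  assumes "set Hs \<subseteq> carrier_mat n n" "\<alpha> \<in> carrier_mat n n" "\<beta> \<in> carrier_mat n n"
  shows "seg_point (expectation_map Hs \<alpha>) (expectation_map Hs \<beta>) t =
    expectation_map Hs (complex_of_real (1 - t) \<cdot>\<^sub>m \<alpha> + complex_of_real t \<cdot>\<^sub>m \<beta>)"
proof (rule eq_vecI)
  fix i assume "i < dim_vec (expectation_map Hs (complex_of_real (1 - t) \<cdot>\<^sub>m \<alpha> + complex_of_real t \<cdot>\<^sub>m \<beta>))"
  then have i: "i < length Hs" by (simp add: expectation_map_def)
  then have "Hs ! i \<in> carrier_mat n n" using assms(1) by auto
  then show "seg_point (expectation_map Hs \<alpha>) (expectation_map Hs \<beta>) t $ i =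
    expectation_map Hs (complex_of_real (1 - t) \<cdot>\<^sub>m \<alpha> + complex_of_real t \<cdot>\<^sub>m \<beta>) $ i"
    using i assms by (simp add: seg_point_def expectation_map_def hs_inner_add_right[of _ n]
        hs_inner_smult_right[of _ n] smult_carrier_mat del: of_real_diff)
qed (simp add: seg_point_def expectation_map_def)

context fiber_maximizer
begin

lemma corner_convex:
  assumes "\<alpha> \<in> corner_states n sp" "\<beta> \<in> corner_states n sp" "0 \<le> t" "t \<le> 1"
  shows "complex_of_real (1 - t) \<cdot>\<^sub>m \<alpha> + complex_of_real t \<cdot>\<^sub>m \<beta> \<in> corner_states n sp"
  using assms V_carrier states_convex[of \<alpha> n \<beta> t] states_carrier
  unfolding corner_states_supp_proj_iff[OF V]
  by (auto simp: hs_inner_add_left[of _ n] hs_inner_smult_left[of _ n] smult_carrier_mat simp del: of_real_diff)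

lemma corner_extreme:
  assumes a: "\<alpha> \<in> states n" and b: "\<beta> \<in> states n" and t: "0 < t" "t < 1"
    and c: "complex_of_real (1 - t) \<cdot>\<^sub>m \<alpha> + complex_of_real t \<cdot>\<^sub>m \<beta> \<in> corner_states n sp"
  shows "\<alpha> \<in> corner_states n sp" "\<beta> \<in> corner_states n sp"
proof -
  have "hs_inner \<alpha> (pr V j) = 0 \<and> hs_inner \<beta> (pr V j) = 0" if j: "j < n" "b j = 0" for j
  proof -
    have "hs_inner (complex_of_real (1 - t) \<cdot>\<^sub>m \<alpha> + complex_of_real t \<cdot>\<^sub>m \<beta>) (pr V j) = 0"
      using c j unfolding corner_states_supp_proj_iff[OF V] by blast
    then have s: "(1 - t) * hs_inner \<alpha> (pr V j) + t * hs_inner \<beta> (pr V j) = 0"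
      using states_carrier[OF a] states_carrier[OF b] V_carrier
      by (simp add: hs_inner_add_left[of _ n] hs_inner_smult_left[of _ n] smult_carrier_mat del: of_real_diff)
    have "0 \<le> (1 - t) * hs_inner \<alpha> (pr V j)" "0 \<le> t * hs_inner \<beta> (pr V j)"
      using t a b by (auto intro!: mult_nonneg_nonneg hs_inner_psd_nonneg[OF _ psd_pr[OF V]] intro: states_psd)
    then have "(1 - t) * hs_inner \<alpha> (pr V j) = 0" "t * hs_inner \<beta> (pr V j) = 0" using s by linarith+
    then show ?thesis using t by simp
  qed
  then show "\<alpha> \<in> corner_states n sp" "\<beta> \<in> corner_states n sp"
    using a b unfolding corner_states_supp_proj_iff[OF V] by blast+
qed

text \<open>The face is the image of the corner under the expectation map. By
  \<open>corner_face\<close> its preimage is again the corner, so the face property descends from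
  the state space, where a mixture lies in the corner only if both components do.\<close>

lemma sp_face_projection:
  assumes basis: "real_basis n \<H> Hs"
  shows "sp \<in> face_projections n Hs"
proof -
  define F where "F = expectation_map Hs ` corner_states n sp"
  have Hh: "\<H> \<subseteq> herm n" using H by (simp add: real_subspace_def)
  have Hs: "set Hs \<subseteq> carrier_mat n n" using basis Hh by (auto simp: real_basis_def herm_def)
  have cs: "\<mu> \<in> states n" if "\<mu> \<in> corner_states n sp" for \<mu>
    using that by (simp add: corner_states_def)
  have inF: "\<tau> \<in> corner_states n sp" if tau: "\<tau> \<in> states n" "expectation_map Hs \<tau> \<in> F" for \<tau>
  proof -
    obtain \<tau>' where t': "\<tau>' \<in> corner_states n sp" "expectation_map Hs \<tau> = expectation_map Hs \<tau>'"
      using tau(2) by (auto simp: F_def)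
    then show ?thesis
      using corner_face[OF tau(1) t'(1)] expectation_map_eq_iff[OF basis Hh] states_carrier tau(1) cs by blast
  qed
  note seg = seg_point_expectation[OF Hs]
  have "sgm \<in> corner_states n sp"
    using corner_states_supp_proj_iff[OF V] sgm_state fiber_support[OF in_fiber] by blast
  then have "F \<noteq> {}" by (auto simp: F_def)
  moreover have "corner_states n sp = {\<rho> \<in> states n. expectation_map Hs \<rho> \<in> F}"
    using inF cs by (auto simp: F_def)
  moreover have "is_face (convex_support n Hs) F"
    unfolding is_face_def
  proof (intro conjI ballI impI)
    show "F \<subseteq> convex_support n Hs" using cs by (auto simp: F_def convex_support_def)
  next
    fix x y and t :: real assume "x \<in> F" "y \<in> F" "t \<in> {0..1}"
    then obtain \<alpha> \<beta> where "\<alpha> \<in> corner_states n sp" "\<beta> \<in> corner_states n sp"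
      "x = expectation_map Hs \<alpha>" "y = expectation_map Hs \<beta>" by (auto simp: F_def)
    then show "seg_point x y t \<in> F"
      using seg[OF states_carrier states_carrier, OF cs cs] corner_convex \<open>t \<in> {0..1}\<close> by (auto simp: F_def)
  next
    fix x y and t :: real assume xy: "x \<in> convex_support n Hs" "y \<in> convex_support n Hs"
      and ex: "\<exists>t\<in>{0<..<1}. seg_point x y t \<in> F" and t: "t \<in> {0..1}"
    obtain \<alpha> \<beta> where ab: "\<alpha> \<in> states n" "\<beta> \<in> states n"
      "x = expectation_map Hs \<alpha>" "y = expectation_map Hs \<beta>" using xy by (auto simp: convex_support_def)
    note sg = seg[OF states_carrier[OF ab(1)] states_carrier[OF ab(2)]]
    obtain s where s: "0 < s" "s < 1" "seg_point x y s \<in> F" using ex by auto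
    have "complex_of_real (1 - s) \<cdot>\<^sub>m \<alpha> + complex_of_real s \<cdot>\<^sub>m \<beta> \<in> corner_states n sp"
      using s states_convex[OF ab(1,2)] ab(3,4) sg by (intro inF) auto
    note ce = corner_extreme[OF ab(1,2) s(1,2) this]
    show "seg_point x y t \<in> F" using corner_convex[OF ce] t ab(3,4) sg by (auto simp: F_def)
  qed
  ultimately show ?thesis using sp_projection unfolding face_projections_def by blast
qed

end

lemma fiber_maximizer_exists:
  assumes H: "real_subspace n \<H>" and one: "1\<^sub>m n \<in> \<H>" and rho: "\<rho> \<in> states n"
  obtains V b where "fiber_maximizer n \<H> \<rho> V b"
proof -
  have "\<H> \<subseteq> herm n" using H by (simp add: real_subspace_def)
  then obtain \<sigma> where s: "\<sigma> \<in> fiber n \<H> \<rho>" "\<And>\<mu>. \<mu> \<in> fiber n \<H> \<rho> \<Longrightarrow> vn_entropy \<mu> \<le> vn_entropy \<sigma>"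
    using max_entropy_exists[OF rho] by blast
  then obtain V b where V: "unitary_mat n V" "\<sigma> = udiag V b"
    using herm_spectral states_herm by (metis (no_types, lifting) fiber_def mem_Collect_eq)
  show ?thesis
    by (rule that[of V b], unfold_locales) (use H one V s in auto)
qed

text \<open>The maximizer is a candidate by \<open>sgm_gibbs_corner\<close> and
  \<open>sp_face_projection\<close>. For another candidate \<open>\<tau>\<close> the entropies
  compare in both directions: \<open>sgm\<close> is maximal in the fiber, \<open>\<tau>\<close> in
  its corner. They are equal, and so are the states.\<close>

theorem gibbs_proj_max_entropy:
  assumes H: "real_subspace n \<H>" and one: "1\<^sub>m n \<in> \<H>" and rho: "\<rho> \<in> states n"
  shows "gibbs_proj n \<H> \<rho> \<in> fiber n \<H> \<rho>"
    and "\<And>\<mu>. \<mu> \<in> fiber n \<H> \<rho> \<Longrightarrow> vn_entropy \<mu> \<le> vn_entropy (gibbs_proj n \<H> \<rho>)"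
proof -
  obtain V b where "fiber_maximizer n \<H> \<rho> V b" using fiber_maximizer_exists[OF assms] .
  then interpret fiber_maximizer n \<H> \<rho> V b .
  have Hh: "\<H> \<subseteq> herm n" using H by (simp add: real_subspace_def)
  define Hs where "Hs = (SOME Hs. real_basis n \<H> Hs)"
  have basis: "real_basis n \<H> Hs" unfolding Hs_def by (rule someI_ex[OF real_basis_exists[OF H]])
  note ev = expectation_map_eq_iff[OF basis Hh]
  have es: "expectation_map Hs sgm = expectation_map Hs \<rho>"
    using ev[OF states_carrier[OF sgm_state] states_carrier[OF rho]] in_fiber by (simp add: fiber_def)
  have "gibbs_proj n \<H> \<rho> = sgm"
    unfolding gibbs_proj_def Let_def Hs_def[symmetric]
  proof (rule the_equality)
    show "sgm \<in> ext_gibbs n \<H> Hs \<and> expectation_map Hs sgm = expectation_map Hs \<rho>"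
      using sgm_gibbs_corner sp_face_projection[OF basis] es unfolding ext_gibbs_def by blast
  next
    fix \<tau> assume t: "\<tau> \<in> ext_gibbs n \<H> Hs \<and> expectation_map Hs \<tau> = expectation_map Hs \<rho>"
    then obtain p where p: "p \<in> face_projections n Hs" "\<tau> \<in> gibbs_corner \<H> p" by (auto simp: ext_gibbs_def)
    then obtain F where pp: "p \<in> projections n"
      and F: "corner_states n p = {\<rho> \<in> states n. expectation_map Hs \<rho> \<in> F}"
      by (auto simp: face_projections_def)
    have tc: "\<tau> \<in> corner_states n p" by (rule gibbs_corner_max_entropy(1)[OF p(2) pp Hh])
    then have ts: "\<tau> \<in> states n" by (simp add: corner_states_def)
    \<comment> \<open>The corner of \<open>p\<close> is a full preimage under the expectation map,
      so it contains \<open>sgm\<close> along with \<open>\<tau>\<close>. This is where the face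
      condition on \<open>p\<close> enters.\<close>
    have sc: "sgm \<in> corner_states n p" using tc t es sgm_state unfolding F by simp
    have eq: "hs_inner X sgm = hs_inner X \<tau>" if "X \<in> \<H>" for X
      using ev[OF states_carrier[OF sgm_state] states_carrier[OF ts]] es t that by simp
    then have "\<tau> \<in> fiber n \<H> \<rho>" using ts in_fiber by (simp add: fiber_def)
    then have "vn_entropy \<tau> \<le> vn_entropy sgm" by (rule maximal)
    then show "\<tau> = sgm" using gibbs_corner_max_entropy(2)[OF p(2) pp Hh sc eq] by auto
  qed
  then show "gibbs_proj n \<H> \<rho> \<in> fiber n \<H> \<rho>"
    and "\<And>\<mu>. \<mu> \<in> fiber n \<H> \<rho> \<Longrightarrow> vn_entropy \<mu> \<le> vn_entropy (gibbs_proj n \<H> \<rho>)"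
    using in_fiber maximal by auto
qed

section \<open>The divergence from a Gibbs family\<close>

text \<open>The log-partition function, the convex conjugate of the negative entropy on
  states.\<close>

definition free_energy :: "complex mat \<Rightarrow> real" where
  "free_energy X = ln (Re (mtrace (mexp X)))"

lemma gibbs_state_spectral:
  fixes h :: "nat \<Rightarrow> real"
  assumes U: "unitary_mat n U" and n: "0 < n"
  defines "Z \<equiv> (\<Sum>i<n. exp (h i))"
  shows "0 < Z" "mtrace (mexp (udiag U h)) = complex_of_real Z" "free_energy (udiag U h) = ln Z"
    "(1 / mtrace (mexp (udiag U h))) \<cdot>\<^sub>m mexp (udiag U h) = udiag U (\<lambda>i. exp (h i) / Z)"
    "udiag U (\<lambda>i. exp (h i) / Z) \<in> states n"
proof -
  show Z: "0 < Z" unfolding Z_def using n by (intro sum_pos) auto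
  show tr: "mtrace (mexp (udiag U h)) = complex_of_real Z"
    unfolding mexp_udiag[OF U] mtrace_udiag[OF U] Z_def ..
  show "free_energy (udiag U h) = ln Z" unfolding free_energy_def tr by simp
  have "1 / mtrace (mexp (udiag U h)) = complex_of_real (1 / Z)" unfolding tr by simp
  then show "(1 / mtrace (mexp (udiag U h))) \<cdot>\<^sub>m mexp (udiag U h) = udiag U (\<lambda>i. exp (h i) / Z)"
    by (simp only: mexp_udiag[OF U] udiag_smult[OF unitary_matD(1)[OF U]]) simp
  have "(\<Sum>i<n. exp (h i) / Z) = 1" using Z unfolding sum_divide_distrib[symmetric] Z_def[symmetric] by simp
  then show "udiag U (\<lambda>i. exp (h i) / Z) \<in> states n" unfolding udiag_states_iff[OF U] using Z by auto
qed

lemma hs_inner_gibbs_log: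
  assumes U: "unitary_mat n U" and n: "0 < n" and rho: "\<rho> \<in> states n"
  shows "hs_inner \<rho> (udiag U (\<lambda>i. ln (exp (h i) / (\<Sum>i<n. exp (h i))))) = hs_inner (udiag U h) \<rho> - free_energy (udiag U h)"
proof -
  note g = gibbs_state_spectral[OF U n, of h] and u = unitary_matD(1)[OF U] and c = states_carrier[OF rho]
  define Z where "Z = (\<Sum>i<n. exp (h i))"
  have "udiag U (\<lambda>i. ln (exp (h i) / Z)) = udiag U (\<lambda>i. h i - ln Z * 1)"
    using g(1) by (intro udiag_cong) (simp add: ln_div Z_def)
  also have "\<dots> = udiag U h - complex_of_real (ln Z) \<cdot>\<^sub>m 1\<^sub>m n"
    unfolding udiag_const_one[OF U, symmetric] udiag_smult[OF u] udiag_minus[OF u] ..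
  finally show ?thesis unfolding Z_def[symmetric] g(3)
    using u c states_trace[OF rho]
    by (simp add: hs_inner_minus_right[of _ n] hs_inner_smult_right[of _ n] smult_carrier_mat Z_def
        hs_inner_commute[of \<rho> n "1\<^sub>m n"] hs_inner_commute[of \<rho> n "udiag U h"])
qed

lemma rel_entropy_gibbs:
  assumes rho: "\<rho> \<in> states n" and X: "X \<in> herm n"
  shows "rel_entropy \<rho> ((1 / mtrace (mexp X)) \<cdot>\<^sub>m mexp X) = ereal (free_energy X - hs_inner X \<rho> - vn_entropy \<rho>)"
proof -
  obtain U h where U: "unitary_mat n U" "X = udiag U h" using herm_spectral[OF X] by blast
  note n = states_dim_pos[OF rho] and u = unitary_matD(1)[OF U(1)] and c = states_carrier[OF rho]
  note g = gibbs_state_spectral[OF U(1) n, of h]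
  define Z where "Z = (\<Sum>i<n. exp (h i))"
  let ?s = "udiag U (\<lambda>i. exp (h i) / Z)"
  have sc: "?s \<in> carrier_mat n n" using u by simp
  \<comment> \<open>An explicit inverse shows that a Gibbs state has trivial kernel, which selects
    the finite branch of \<open>rel_entropy\<close>.\<close>
  have inv: "udiag U (\<lambda>i. Z / exp (h i)) * ?s = 1\<^sub>m n"
  proof -
    have "udiag U (\<lambda>i. Z / exp (h i)) * ?s = udiag U (\<lambda>_. 1)"
      unfolding udiag_mult[OF U(1)] by (rule udiag_cong) (use g(1) in \<open>simp add: Z_def\<close>)
    then show ?thesis using udiag_const_one[OF U(1)] by simp
  qed
  have "mat_kernel ?s \<subseteq> mat_kernel \<rho>"
  proof
    fix w assume "w \<in> mat_kernel ?s"
    then have w: "w \<in> carrier_vec n" "?s *\<^sub>v w = 0\<^sub>v n" using mat_kernelD[OF sc] by auto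
    have "w = (udiag U (\<lambda>i. Z / exp (h i)) * ?s) *\<^sub>v w" unfolding inv using w by simp
    also have "\<dots> = udiag U (\<lambda>i. Z / exp (h i)) *\<^sub>v (?s *\<^sub>v w)" using u w sc by (intro assoc_mult_mat_vec) auto
    also have "\<dots> = 0\<^sub>v n" unfolding w(2) using u by (intro eq_vecI) auto
    finally have "w = 0\<^sub>v n" .
    then show "w \<in> mat_kernel \<rho>" using c by (intro mat_kernelI) auto
  qed
  then have "rel_entropy \<rho> ?s = ereal (hs_inner \<rho> (mlog \<rho> - mlog ?s))"
    by (simp add: rel_entropy_def hs_inner_def)
  also have "hs_inner \<rho> (mlog \<rho> - mlog ?s) = - vn_entropy \<rho> - hs_inner \<rho> (mlog ?s)"
    unfolding vn_entropy_eq
    using c u sc by (simp add: hs_inner_minus_right[of _ n] herm_carrier mlog_herm states_herm[OF rho] udiag_herm)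
  also have "hs_inner \<rho> (mlog ?s) = hs_inner X \<rho> - free_energy X"
    unfolding mlog_udiag[OF U(1)] Z_def U(2) by (rule hs_inner_gibbs_log[OF U(1) n rho])
  finally show ?thesis unfolding U(2) g(4) Z_def by simp
qed

text \<open>Klein's inequality against the Gibbs state of \<open>X\<close>, whose logarithm is
  \<open>X\<close> minus the free energy.\<close>

lemma gibbs_variational:
  assumes rho: "\<rho> \<in> states n" and X: "X \<in> herm n"
  shows "vn_entropy \<rho> \<le> free_energy X - hs_inner X \<rho>"
proof -
  obtain U h where U: "unitary_mat n U" "X = udiag U h" using herm_spectral[OF X] by blast
  note n = states_dim_pos[OF rho]
  note g = gibbs_state_spectral[OF U(1) n, of h]
  let ?b = "\<lambda>i. exp (h i) / (\<Sum>i<n. exp (h i))"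
  have "vn_entropy \<rho> \<le> - hs_inner \<rho> (udiag U (\<lambda>i. ln (?b i)))"
    by (rule klein_inequality(1)[OF rho U(1)]) (use g udiag_states_iff[OF U(1), of ?b] in auto)
  then show ?thesis unfolding hs_inner_gibbs_log[OF U(1) n rho] U(2) by simp
qed

lemma maximally_mixed_state:
  assumes "0 < n"
  shows "complex_of_real (1 / real n) \<cdot>\<^sub>m 1\<^sub>m n \<in> states n"
proof -
  have "complex_of_real (1 / real n) \<cdot>\<^sub>m 1\<^sub>m n = udiag (1\<^sub>m n) (\<lambda>i. 1 / real n * 1)"
    using udiag_smult[of "1\<^sub>m n" n "1 / real n" "\<lambda>_. 1"] udiag_const_one[OF unitary_mat_one] by simp
  then show ?thesis using assms by (simp only: udiag_states_iff[OF unitary_mat_one]) simp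
qed

text \<open>Mixing \<open>\<rho>\<close> with the maximally mixed state makes the maximizer invertible, so that its
  logarithm belongs to \<open>\<H>\<close>.\<close>

lemma approximate_minimizer_mixed:
  assumes H: "real_subspace n \<H>" and one: "1\<^sub>m n \<in> \<H>" and rho: "\<rho> \<in> states n" and e: "0 < \<epsilon>" "\<epsilon> < 1"
  defines "\<omega> \<equiv> complex_of_real (1 / real n) \<cdot>\<^sub>m 1\<^sub>m n"
  shows "\<exists>\<sigma>\<in>fiber n \<H> (complex_of_real (1 - \<epsilon>) \<cdot>\<^sub>m \<rho> + complex_of_real \<epsilon> \<cdot>\<^sub>m \<omega>). \<exists>X\<in>\<H>.
    free_energy X - hs_inner X \<rho> \<le> vn_entropy \<sigma> / (1 - \<epsilon>)"
proof -
  note n = states_dim_pos[OF rho] and rc = states_carrier[OF rho]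
  have w: "\<omega> \<in> states n" unfolding \<omega>_def by (rule maximally_mixed_state[OF n])
  note wc = states_carrier[OF w]
  define \<rho>' where "\<rho>' = complex_of_real (1 - \<epsilon>) \<cdot>\<^sub>m \<rho> + complex_of_real \<epsilon> \<cdot>\<^sub>m \<omega>"
  have r': "\<rho>' \<in> states n" unfolding \<rho>'_def using e by (intro states_convex rho w) auto
  note r'c = states_carrier[OF r']
  obtain V b where "fiber_maximizer n \<H> \<rho>' V b" using fiber_maximizer_exists[OF H one r'] .
  then interpret fiber_maximizer n \<H> \<rho>' V b .
  have inner: "hs_inner X \<rho>' = (1 - \<epsilon>) * hs_inner X \<rho> + \<epsilon> * hs_inner X \<omega>" if "X \<in> carrier_mat n n" for X
    unfolding \<rho>'_def using that rc wc
    by (simp add: hs_inner_add_right[of _ n] hs_inner_smult_right[of _ n] smult_carrier_mat del: of_real_diff)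
  have win: "hs_inner (udiag V f) \<omega> = (\<Sum>i<n. f i) / real n" for f
    unfolding \<omega>_def using V_carrier hs_inner_one_udiag[OF V, of f]
    by (simp add: hs_inner_smult_right[of _ n] hs_inner_commute[of "udiag V f" n "1\<^sub>m n"] del: of_real_divide)
  \<comment> \<open>A zero eigenvalue of the maximizer would be shared by every state of the fiber,
    in particular by \<open>\<rho>'\<close>, on which the maximally mixed part contributes
    \<open>\<epsilon> / n\<close>.\<close>
  have bpos: "0 < b j" if j: "j < n" for j
  proof (rule ccontr)
    assume "\<not> 0 < b j"
    then have "b j = 0" using b_nonneg[OF j] by simp
    then have "hs_inner \<rho>' (pr V j) = 0" using r' by (intro fiber_support j) (auto simp: fiber_def)
    then have "hs_inner (pr V j) \<rho>' = 0" using hs_inner_commute[of "pr V j" n \<rho>'] V_carrier r'c by simp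
    then have "(1 - \<epsilon>) * hs_inner (pr V j) \<rho> + \<epsilon> * (1 / real n) = 0"
      using inner[of "pr V j"] V_carrier win[of "\<lambda>k. if k = j then 1 else 0"] j by (simp add: pr_def)
    moreover have "0 \<le> (1 - \<epsilon>) * hs_inner (pr V j) \<rho>"
      using e by (intro mult_nonneg_nonneg hs_inner_psd_nonneg[of n] psd_pr V states_psd rho) auto
    moreover have "0 < \<epsilon> * (1 / real n)" using e n by simp
    ultimately show False by linarith
  qed
  have sp1: "sp = 1\<^sub>m n" unfolding supp_proj_def udiag_const_one[OF V, symmetric]
    by (rule udiag_cong) (use bpos V_carrier in force)
  obtain X where X: "X \<in> \<H>" "mlog sgm = sp * X * sp" using mlog_in_corner by blast
  note Xc = H_carrier[OF X(1)]
  have XL: "X = udiag V (\<lambda>j. ln (b j))" using X(2) Xc unfolding sp1 mlog_udiag[OF V] by simp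
  have "mexp X = sgm" unfolding XL mexp_udiag[OF V] by (rule udiag_cong) (use bpos V_carrier in auto)
  \<comment> \<open>\<open>X\<close> is the logarithm of a normalized state, so no normalization
    term is left.\<close>
  then have F0: "free_energy X = 0" unfolding free_energy_def using sgm_state by (simp add: states_def)
  have "vn_entropy sgm = - hs_inner X sgm"
    unfolding vn_entropy_eq mlog_udiag[OF V] XL[symmetric] using hs_inner_commute[of sgm n X] V_carrier Xc by simp
  also have "hs_inner X sgm = hs_inner X \<rho>'" using in_fiber X(1) by (simp add: fiber_def)
  also have "\<dots> = (1 - \<epsilon>) * hs_inner X \<rho> + \<epsilon> * hs_inner X \<omega>" by (rule inner[OF Xc])
  finally have h: "vn_entropy sgm = - ((1 - \<epsilon>) * hs_inner X \<rho> + \<epsilon> * hs_inner X \<omega>)" .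
  have "b j \<le> 1" if "j < n" for j using member_le_sum[of j "{..<n}" b] that b_nonneg b_sum by auto
  then have "(\<Sum>j<n. ln (b j)) \<le> 0" using bpos by (intro sum_nonpos) auto
  then have "hs_inner X \<omega> \<le> 0" unfolding XL win by (simp add: divide_nonpos_nonneg)
  then have "\<epsilon> * hs_inner X \<omega> \<le> 0" using e by (simp add: mult_nonneg_nonpos)
  then have "(1 - \<epsilon>) * (- hs_inner X \<rho>) \<le> vn_entropy sgm" unfolding h by simp
  then have "free_energy X - hs_inner X \<rho> \<le> vn_entropy sgm / (1 - \<epsilon>)"
    using e F0 by (simp add: pos_le_divide_eq mult.commute)
  then show ?thesis using in_fiber X(1) unfolding \<rho>'_def by blast
qed

text \<open>A limit point of the maximizers for vanishing admixture lies in the fiber of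
  \<open>\<rho>\<close>, so by continuity their entropies come arbitrarily close to a value at most
  \<open>M\<close>. Any upper bound \<open>M\<close> is allowed, which also covers the algebra of a
  single unit, where the fiber is one point.\<close>

lemma approximate_minimizer:
  assumes H: "real_subspace n \<H>" and one: "1\<^sub>m n \<in> \<H>" and rho: "\<rho> \<in> states n"
    and M: "\<And>\<mu>. \<mu> \<in> fiber n \<H> \<rho> \<Longrightarrow> vn_entropy \<mu> \<le> M" and \<eta>: "0 < \<eta>"
  shows "\<exists>X\<in>\<H>. free_energy X - hs_inner X \<rho> < M + \<eta>"
proof -
  note n = states_dim_pos[OF rho] and rc = states_carrier[OF rho]
  define \<omega> where "\<omega> = complex_of_real (1 / real n) \<cdot>\<^sub>m (1\<^sub>m n :: complex mat)"
  have wc: "\<omega> \<in> carrier_mat n n" by (simp add: \<omega>_def)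
  \<comment> \<open>The shift by two keeps the mixing parameter strictly below 1 already at
    \<open>k = 0\<close>.\<close>
  define e where "e k = inverse (real (Suc (Suc k)))" for k
  have e: "0 < e k" "e k < 1" for k by (auto simp: e_def inverse_less_1_iff)
  have elim: "e \<longlonglongrightarrow> 0" unfolding e_def by (rule LIMSEQ_Suc[OF LIMSEQ_inverse_real_of_nat])
  have "\<forall>k. \<exists>\<sigma>\<in>fiber n \<H> (complex_of_real (1 - e k) \<cdot>\<^sub>m \<rho> + complex_of_real (e k) \<cdot>\<^sub>m \<omega>). \<exists>X\<in>\<H>.
      free_energy X - hs_inner X \<rho> \<le> vn_entropy \<sigma> / (1 - e k)"
    using approximate_minimizer_mixed[OF H one rho e] unfolding \<omega>_def by blast
  then obtain S Y where S: "\<And>k. S k \<in> fiber n \<H> (complex_of_real (1 - e k) \<cdot>\<^sub>m \<rho> + complex_of_real (e k) \<cdot>\<^sub>m \<omega>)"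
    and Y: "\<And>k. Y k \<in> \<H>" "\<And>k. free_energy (Y k) - hs_inner (Y k) \<rho> \<le> vn_entropy (S k) / (1 - e k)"
    by metis
  have Ss: "S k \<in> states n" for k using S by (simp add: fiber_def)
  obtain r L where r: "strict_mono (r :: nat \<Rightarrow> nat)" and L: "L \<in> states n"
    and lim: "mat_tendsto n (\<lambda>k. S (r k)) L" using states_compact[of S n] Ss by blast
  have er: "(\<lambda>k. e (r k)) \<longlonglongrightarrow> 0" using LIMSEQ_subseq_LIMSEQ[OF elim r] by (simp add: o_def)
  have "hs_inner A L = hs_inner A \<rho>" if A: "A \<in> \<H>" for A
  proof -
    note Ac = real_subspaceD(2)[OF H A]
    have "hs_inner A (S k) = (1 - e k) * hs_inner A \<rho> + e k * hs_inner A \<omega>" for k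
    proof -
      have "hs_inner A (S k) = hs_inner A (complex_of_real (1 - e k) \<cdot>\<^sub>m \<rho> + complex_of_real (e k) \<cdot>\<^sub>m \<omega>)"
        using S A by (simp add: fiber_def)
      then show ?thesis using Ac rc wc
        by (simp add: hs_inner_add_right[of _ n] hs_inner_smult_right[of _ n] smult_carrier_mat del: of_real_diff)
    qed
    moreover have "(\<lambda>k. (1 - e (r k)) * hs_inner A \<rho> + e (r k) * hs_inner A \<omega>) \<longlonglongrightarrow> (1 - 0) * hs_inner A \<rho> + 0 * hs_inner A \<omega>"
      by (intro tendsto_intros er)
    ultimately have "(\<lambda>k. hs_inner A (S (r k))) \<longlonglongrightarrow> hs_inner A \<rho>" by simp
    moreover have "(\<lambda>k. hs_inner A (S (r k))) \<longlonglongrightarrow> hs_inner A L"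
      by (rule tendsto_hs_inner[OF lim]) (use states_carrier Ss L Ac in auto)
    ultimately show ?thesis using LIMSEQ_unique by blast
  qed
  then have "L \<in> fiber n \<H> \<rho>" using L by (simp add: fiber_def)
  then have LM: "vn_entropy L < M + \<eta>" using M[of L] \<eta> by linarith
  have "(\<lambda>k. vn_entropy (S (r k))) \<longlonglongrightarrow> vn_entropy L"
    by (rule tendsto_vn_entropy[OF _ lim L]) (rule Ss)
  then have "(\<lambda>k. vn_entropy (S (r k)) / (1 - e (r k))) \<longlonglongrightarrow> vn_entropy L / (1 - 0)"
    by (intro tendsto_intros er) auto
  then have "eventually (\<lambda>k. vn_entropy (S (r k)) / (1 - e (r k)) < M + \<eta>) sequentially"
    using LM by (intro order_tendstoD(2)) auto
  then obtain k where "vn_entropy (S (r k)) / (1 - e (r k)) < M + \<eta>"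
    using eventually_happens sequentially_bot by blast
  then show ?thesis using Y[of "r k"] by (intro bexI[of _ "Y (r k)"]) auto
qed

text \<open>The variational inequality is applied to the projection instead of
  \<open>\<rho>\<close>; both have the same expectation of \<open>X\<close>.\<close>

lemma entropy_gibbs_proj_le:
  assumes H: "real_subspace n \<H>" and one: "1\<^sub>m n \<in> \<H>" and rho: "\<rho> \<in> states n" and X: "X \<in> \<H>"
  shows "vn_entropy (gibbs_proj n \<H> \<rho>) \<le> free_energy X - hs_inner X \<rho>"
proof -
  have f: "gibbs_proj n \<H> \<rho> \<in> fiber n \<H> \<rho>" by (rule gibbs_proj_max_entropy(1)[OF H one rho])
  then show ?thesis
    using gibbs_variational[of "gibbs_proj n \<H> \<rho>" n X] real_subspaceD(1)[OF H X] X by (simp add: fiber_def)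
qed

lemma entropy_gibbs_proj_approx:
  assumes H: "real_subspace n \<H>" and one: "1\<^sub>m n \<in> \<H>" and rho: "\<rho> \<in> states n" and \<eta>: "0 < \<eta>"
  shows "\<exists>X\<in>\<H>. free_energy X - hs_inner X \<rho> < vn_entropy (gibbs_proj n \<H> \<rho>) + \<eta>"
  by (rule approximate_minimizer[OF H one rho gibbs_proj_max_entropy(2)[OF H one rho] \<eta>])

theorem divergence_from_gibbs_family:
  assumes H: "real_subspace n \<H>" and one: "1\<^sub>m n \<in> \<H>" and rho: "\<rho> \<in> states n"
  shows "divergence_from (gibbs_family \<H>) \<rho> = ereal (vn_entropy (gibbs_proj n \<H> \<rho>) - vn_entropy \<rho>)"
proof (rule antisym)
  let ?g = "\<lambda>X. (1 / mtrace (mexp X)) \<cdot>\<^sub>m mexp X"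
  have rel: "rel_entropy \<rho> (?g X) = ereal (free_energy X - hs_inner X \<rho> - vn_entropy \<rho>)" if "X \<in> \<H>" for X
    by (rule rel_entropy_gibbs[OF rho real_subspaceD(1)[OF H that]])
  show "ereal (vn_entropy (gibbs_proj n \<H> \<rho>) - vn_entropy \<rho>) \<le> divergence_from (gibbs_family \<H>) \<rho>"
    unfolding divergence_from_def
  proof (rule INF_greatest)
    fix \<sigma> assume "\<sigma> \<in> gibbs_family \<H>"
    then obtain X where X: "X \<in> \<H>" "\<sigma> = ?g X" by (auto simp: gibbs_family_def)
    show "ereal (vn_entropy (gibbs_proj n \<H> \<rho>) - vn_entropy \<rho>) \<le> rel_entropy \<rho> \<sigma>"
      unfolding X(2) rel[OF X(1)] using entropy_gibbs_proj_le[OF H one rho X(1)] by simp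
  qed
  show "divergence_from (gibbs_family \<H>) \<rho> \<le> ereal (vn_entropy (gibbs_proj n \<H> \<rho>) - vn_entropy \<rho>)"
  proof (rule ereal_le_epsilon2)
    fix \<eta> :: real assume "0 < \<eta>"
    from entropy_gibbs_proj_approx[OF H one rho this] obtain X where X: "X \<in> \<H>"
      "free_energy X - hs_inner X \<rho> < vn_entropy (gibbs_proj n \<H> \<rho>) + \<eta>" by blast
    have "divergence_from (gibbs_family \<H>) \<rho> \<le> rel_entropy \<rho> (?g X)"
      unfolding divergence_from_def by (rule INF_lower) (use X in \<open>auto simp: gibbs_family_def\<close>)
    also have "\<dots> \<le> ereal (vn_entropy (gibbs_proj n \<H> \<rho>) - vn_entropy \<rho>) + ereal \<eta>"
      unfolding rel[OF X(1)] using X(2) by simp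
    finally show "divergence_from (gibbs_family \<H>) \<rho> \<le> ereal (vn_entropy (gibbs_proj n \<H> \<rho>) - vn_entropy \<rho>) + ereal \<eta>" .
  qed
qed

lemma herm_real_subspace: "real_subspace n (herm n)"
  by (auto simp: real_subspace_def intro: herm_add herm_smult)

lemma herm_fiber_unique:
  assumes "a \<in> states n" "b \<in> states n" "\<And>X. X \<in> herm n \<Longrightarrow> hs_inner X a = hs_inner X b"
  shows "a = b"
proof -
  note c = states_carrier[OF assms(1)] states_carrier[OF assms(2)]
  have h: "a - b \<in> herm n" by (intro herm_minus states_herm assms)
  have "hs_inner (a - b) (a - b) = 0"
    using assms(3)[OF h] c herm_carrier[OF h] by (simp add: hs_inner_minus_right[of _ n])
  then have z: "a - b = 0\<^sub>m n n" by (rule hs_inner_self_eq_0[OF h])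
  show ?thesis
  proof (rule eq_matI)
    fix i j assume ij: "i < dim_row b" "j < dim_col b"
    then have "(a - b) $$ (i, j) = 0" using z c by simp
    then show "a $$ (i, j) = b $$ (i, j)" using ij c by simp
  qed (use c in auto)
qed

section \<open>Mixed radix indices\<close>

text \<open>A new largest unit becomes the least significant digit, so all earlier place values are
  multiplied by \<open>d m\<close>. This allows induction on the number of units by division with
  remainder.\<close>

lemma place_insert_max:
  assumes A: "finite A" "\<And>a. a \<in> A \<Longrightarrow> a < m"
  shows "a \<in> A \<Longrightarrow> place d (insert m A) a = place d A a * d m" "place d (insert m A) m = 1"
    "tdim d (insert m A) = tdim d A * d m"
proof -
  have "{j \<in> insert m A. a < j} = insert m {j \<in> A. a < j}" if "a \<in> A" using A(2)[OF that] by auto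
  moreover have "m \<notin> {j \<in> A. a < j}" using A(2) by auto
  ultimately show "place d (insert m A) a = place d A a * d m" if "a \<in> A"
    using A(1) that by (simp add: place_def mult.commute)
  have "{j \<in> insert m A. m < j} = {}" using A(2) by (auto dest: less_asym)
  then show "place d (insert m A) m = 1" unfolding place_def by (simp only: prod.empty)
  have "m \<notin> A" using A(2) by auto
  then show "tdim d (insert m A) = tdim d A * d m" using A(1) by (simp add: tdim_def mult.commute)
qed

lemma encode_insert_max:
  assumes A: "finite A" "\<And>a. a \<in> A \<Longrightarrow> a < m"
  shows "encode d (insert m A) f = encode d A f * d m + f m"
proof -
  have "m \<notin> A" using A(2) by auto
  then have "encode d (insert m A) f = f m * place d (insert m A) m + (\<Sum>i\<in>A. f i * place d (insert m A) i)"
    unfolding encode_def using A(1) by simp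
  also have "(\<Sum>i\<in>A. f i * place d (insert m A) i) = (\<Sum>i\<in>A. f i * place d A i) * d m"
    unfolding sum_distrib_right
    by (rule sum.cong[OF refl]) (subst place_insert_max(1)[OF A], auto)
  finally show ?thesis using place_insert_max(2)[OF A] by (simp add: encode_def)
qed

lemma encode_less:
  assumes "finite A" "\<And>i. i \<in> A \<Longrightarrow> f i < d i"
  shows "encode d A f < tdim d A"
  using assms
proof (induction A rule: finite_linorder_max_induct)
  case empty
  then show ?case by (simp add: encode_def tdim_def)
next
  case (insert m A)
  have e: "encode d A f < tdim d A" using insert by auto
  have "encode d A f * d m + f m < encode d A f * d m + d m" using insert by auto
  also have "\<dots> = (encode d A f + 1) * d m" by simp
  also have "\<dots> \<le> tdim d A * d m" using e by (intro mult_right_mono) auto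
  finally show ?case using insert.hyps by (simp add: encode_insert_max place_insert_max(3))
qed

lemma interval_insert: "{1..Suc N} = insert (Suc N) {1..N}"
  by auto

text \<open>Otherwise the simplifier turns every \<open>{1..N}\<close> into \<open>{Suc 0..N}\<close>, where rules about \<open>{1..N}\<close>
  no longer apply.\<close>

declare One_nat_def [simp del]

lemma radix_Suc:
  "i \<in> {1..N} \<Longrightarrow> place d {1..Suc N} i = place d {1..N} i * d (Suc N)"
  "place d {1..Suc N} (Suc N) = 1"
  "tdim d {1..Suc N} = tdim d {1..N} * d (Suc N)"
  "encode d {1..Suc N} f = encode d {1..N} f * d (Suc N) + f (Suc N)"
  unfolding interval_insert
  by (rule place_insert_max encode_insert_max; simp)+

lemma digit_Suc:
  "i \<in> {1..N} \<Longrightarrow> digit d {1..Suc N} x i = digit d {1..N} (x div d (Suc N)) i"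
  "digit d {1..Suc N} x (Suc N) = x mod d (Suc N)"
  by (simp_all add: digit_def radix_Suc div_mult2_eq[symmetric] mult.commute)

lemma digit_less: "1 \<le> d i \<Longrightarrow> digit d A x i < d i"
  by (simp add: digit_def)

lemma encode_cong: "(\<And>i. i \<in> A \<Longrightarrow> f i = g i) \<Longrightarrow> encode d A f = encode d A g"
  by (simp add: encode_def)

lemma encode_digit:
  assumes "\<And>i. i \<in> {1..N} \<Longrightarrow> 1 \<le> d i" "x < tdim d {1..N}"
  shows "encode d {1..N} (digit d {1..N} x) = x"
  using assms
proof (induction N arbitrary: x)
  case 0
  then show ?case by (simp add: encode_def tdim_def)
next
  case (Suc N)
  let ?D = "d (Suc N)"
  have "x div ?D < tdim d {1..N}" using Suc.prems(2) by (simp add: radix_Suc less_mult_imp_div_less)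
  then have IH: "encode d {1..N} (digit d {1..N} (x div ?D)) = x div ?D" using Suc by auto
  have "encode d {1..Suc N} (digit d {1..Suc N} x) = encode d {1..N} (digit d {1..Suc N} x) * ?D + x mod ?D"
    by (simp only: radix_Suc digit_Suc)
  also have "encode d {1..N} (digit d {1..Suc N} x) = encode d {1..N} (digit d {1..N} (x div ?D))"
    by (rule encode_cong) (simp only: digit_Suc)
  finally show ?case by (simp only: IH div_mult_mod_eq)
qed

text \<open>The distributive law in mixed radix form: an index is a quotient and a last digit, and
  both range independently. The product formulas for tensor bases and partition functions come from
  it.\<close>

lemma sum_prod_digits:
  fixes g :: "nat \<Rightarrow> nat \<Rightarrow> 'a :: comm_semiring_1"
  shows "(\<Sum>x<tdim d {1..N}. \<Prod>i\<in>{1..N}. g i (digit d {1..N} x i)) = (\<Prod>i\<in>{1..N}. \<Sum>a<d i. g i a)"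
proof (induction N)
  case 0
  then show ?case by (simp add: tdim_def)
next
  case (Suc N)
  let ?D = "d (Suc N)" and ?T = "tdim d {1..N}"
  define F where "F x = (\<Prod>i\<in>{1..Suc N}. g i (digit d {1..Suc N} x i))" for x
  define G where "G x = (\<Prod>i\<in>{1..N}. g i (digit d {1..N} x i))" for x
  have F: "F (q * ?D + r) = G q * g (Suc N) r" if r: "r < ?D" for q r
  proof -
    have "F (q * ?D + r) = (\<Prod>i\<in>{1..N}. g i (digit d {1..Suc N} (q * ?D + r) i)) * g (Suc N) (digit d {1..Suc N} (q * ?D + r) (Suc N))"
      unfolding F_def by simp
    also have "(\<Prod>i\<in>{1..N}. g i (digit d {1..Suc N} (q * ?D + r) i)) = G q"
      unfolding G_def by (rule prod.cong[OF refl]) (use r in \<open>simp only: digit_Suc, simp\<close>)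
    finally show ?thesis using r by (simp only: digit_Suc) simp
  qed
  have "(\<Sum>x<?T * ?D. F x) = (\<Sum>q<?T. sum F {q * ?D..<q * ?D + ?D})" by (rule sum.nat_group[symmetric])
  also have "\<dots> = (\<Sum>q<?T. \<Sum>r<?D. F (q * ?D + r))"
  proof (rule sum.cong[OF refl])
    fix q
    have "sum F {0 + q * ?D..<?D + q * ?D} = (\<Sum>r\<in>{0..<?D}. F (r + q * ?D))" by (rule sum.shift_bounds_nat_ivl)
    then show "sum F {q * ?D..<q * ?D + ?D} = (\<Sum>r<?D. F (q * ?D + r))" by (simp add: add.commute lessThan_atLeast0)
  qed
  also have "\<dots> = (\<Sum>q<?T. G q) * (\<Sum>r<?D. g (Suc N) r)"
    by (simp add: F sum_product)
  also have "(\<Sum>q<?T. G q) = (\<Prod>i\<in>{1..N}. \<Sum>a<d i. g i a)" unfolding G_def by (rule Suc.IH)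
  finally show ?case unfolding F_def by (simp add: radix_Suc)
qed

section \<open>Local Hamiltonians and marginals\<close>

locale multipartite =
  fixes N :: nat and d :: "nat \<Rightarrow> nat"
  assumes d_pos: "\<And>i. i \<in> {1..N} \<Longrightarrow> 1 \<le> d i"
begin

abbreviation "D \<equiv> tdim d {1..N}"
abbreviation "dig \<equiv> digit d {1..N}"

lemma dig_less [simp]: "i \<in> {1..N} \<Longrightarrow> dig x i < d i"
  using digit_less d_pos by blast

lemma dig_eqI: "x < D \<Longrightarrow> y < D \<Longrightarrow> (\<And>i. i \<in> {1..N} \<Longrightarrow> dig x i = dig y i) \<Longrightarrow> x = y"
  using encode_digit[of N d x] encode_digit[of N d y] encode_cong[of "{1..N}" "dig x" "dig y" d] d_pos by metis

lemma encode_dig_less: "A \<subseteq> {1..N} \<Longrightarrow> encode d A (dig x) < tdim d A"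
  by (rule encode_less) (auto intro: finite_subset)

lemma embed_carrier [simp]: "embed N d A b \<in> carrier_mat D D"
  by (simp add: embed_def)

lemma embed_herm:
  assumes A: "A \<subseteq> {1..N}" and b: "b \<in> herm (tdim d A)"
  shows "embed N d A b \<in> herm D"
proof (rule hermI)
  fix x y assume xy: "x < D" "y < D"
  have "b $$ (encode d A (dig x), encode d A (dig y)) = cnj (b $$ (encode d A (dig y), encode d A (dig x)))"
    using b encode_dig_less[OF A] unfolding herm_iff by blast
  then show "embed N d A b $$ (x, y) = cnj (embed N d A b $$ (y, x))"
    using xy by (auto simp: embed_def)
qed simp

lemma embed_smult:
  assumes A: "A \<subseteq> {1..N}" and b: "b \<in> carrier_mat (tdim d A) (tdim d A)"
  shows "embed N d A (c \<cdot>\<^sub>m b) = c \<cdot>\<^sub>m embed N d A b"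
  by (rule eq_matI) (use b encode_dig_less[OF A] in \<open>auto simp: embed_def\<close>)

lemma foldr_add_carrier:
  "set hs \<subseteq> carrier_mat n n \<Longrightarrow> foldr (+) hs (0\<^sub>m n n :: complex mat) \<in> carrier_mat n n"
  by (induction hs) auto

lemma foldr_add_append:
  assumes "set hs \<subseteq> carrier_mat n n" "set ks \<subseteq> carrier_mat n n"
  shows "foldr (+) (hs @ ks) (0\<^sub>m n n) = foldr (+) hs (0\<^sub>m n n) + foldr (+) ks (0\<^sub>m n n :: complex mat)"
  using assms(1)
proof (induction hs)
  case Nil
  then show ?case using foldr_add_carrier[OF assms(2)] by simp
next
  case (Cons h hs)
  then show ?case
    using foldr_add_carrier[OF assms(2)] foldr_add_carrier[of hs n] by (simp add: assoc_add_mat[of _ n n])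
qed

lemma foldr_add_smult:
  assumes "set hs \<subseteq> carrier_mat n n"
  shows "c \<cdot>\<^sub>m foldr (+) hs (0\<^sub>m n n :: complex mat) = foldr (+) (map (\<lambda>h. c \<cdot>\<^sub>m h) hs) (0\<^sub>m n n)"
  using assms
proof (induction hs)
  case (Cons h hs)
  then show ?case using foldr_add_carrier[of hs n] by (simp add: add_smult_distrib_left_mat[of _ n n])
qed simp

lemma foldr_add_index:
  assumes "set hs \<subseteq> carrier_mat n n" "x < n" "y < n"
  shows "foldr (+) hs (0\<^sub>m n n :: complex mat) $$ (x, y) = sum_list (map (\<lambda>h. h $$ (x, y)) hs)"
  using assms
proof (induction hs)
  case (Cons h hs)
  then show ?case using foldr_add_carrier[of hs n] by simp
qed simp

lemma local_terms_herm: "local_terms N d k \<subseteq> herm D"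
  using embed_herm by (auto simp: local_terms_def)

lemma local_terms_carrier: "local_terms N d k \<subseteq> carrier_mat D D"
  using local_terms_herm herm_carrier by blast

lemma local_hams_subspace: "real_subspace D (local_hams N d k)"
  unfolding real_subspace_def
proof (intro conjI ballI allI)
  show "local_hams N d k \<subseteq> herm D"
  proof
    fix H assume "H \<in> local_hams N d k"
    then obtain hs where hs: "H = foldr (+) hs (0\<^sub>m D D)" "set hs \<subseteq> local_terms N d k" by (auto simp: local_hams_def)
    have "foldr (+) hs (0\<^sub>m D D) \<in> herm D" using hs(2) local_terms_herm
      by (induction hs) (auto intro!: herm_add)
    then show "H \<in> herm D" using hs by simp
  qed
  show "0\<^sub>m D D \<in> local_hams N d k" unfolding local_hams_def by (rule CollectI, rule exI[of _ "[]"]) simp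
next
  fix A B assume "A \<in> local_hams N d k" "B \<in> local_hams N d k"
  then obtain hs ks where h: "A = foldr (+) hs (0\<^sub>m D D)" "set hs \<subseteq> local_terms N d k"
    "B = foldr (+) ks (0\<^sub>m D D)" "set ks \<subseteq> local_terms N d k" by (auto simp: local_hams_def)
  then have "A + B = foldr (+) (hs @ ks) (0\<^sub>m D D)" "set (hs @ ks) \<subseteq> local_terms N d k"
    using foldr_add_append[of hs D ks] local_terms_carrier[of k] by auto
  then show "A + B \<in> local_hams N d k" unfolding local_hams_def by blast
next
  fix A and c :: real assume "A \<in> local_hams N d k"
  then obtain hs where h: "A = foldr (+) hs (0\<^sub>m D D)" "set hs \<subseteq> local_terms N d k" by (auto simp: local_hams_def)
  have t: "complex_of_real c \<cdot>\<^sub>m x \<in> local_terms N d k" if "x \<in> local_terms N d k" for x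
  proof -
    obtain A b where x: "x = embed N d A b" and A: "A \<subseteq> {1..N}" "card A \<le> k" and b: "b \<in> herm (tdim d A)"
      using \<open>x \<in> local_terms N d k\<close> by (auto simp: local_terms_def)
    have "complex_of_real c \<cdot>\<^sub>m x = embed N d A (complex_of_real c \<cdot>\<^sub>m b)"
      unfolding x embed_smult[OF A(1) herm_carrier[OF b]] ..
    then show ?thesis using A herm_smult[OF b, of c] unfolding local_terms_def by blast
  qed
  have "complex_of_real c \<cdot>\<^sub>m A = foldr (+) (map (\<lambda>h. complex_of_real c \<cdot>\<^sub>m h) hs) (0\<^sub>m D D)"
    unfolding h(1) using h(2) local_terms_carrier by (intro foldr_add_smult) blast
  moreover have "set (map (\<lambda>h. complex_of_real c \<cdot>\<^sub>m h) hs) \<subseteq> local_terms N d k" using t h(2) by auto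
  ultimately show "complex_of_real c \<cdot>\<^sub>m A \<in> local_hams N d k" unfolding local_hams_def by blast
qed

lemma local_terms_subset_hams: "local_terms N d k \<subseteq> local_hams N d k"
proof
  fix x assume x: "x \<in> local_terms N d k"
  then have "x \<in> carrier_mat D D" using local_terms_carrier by blast
  then have "x = foldr (+) [x] (0\<^sub>m D D)" by simp
  then show "x \<in> local_hams N d k" using x unfolding local_hams_def by (intro CollectI exI[of _ "[x]"]) auto
qed

text \<open>The identity is the term of the empty set of units, whose algebra has size 1; hence no
  restriction on \<open>k\<close> arises.\<close>

lemma one_in_local_hams: "1\<^sub>m D \<in> local_hams N d k"
proof -
  have "embed N d {} (1\<^sub>m (tdim d {})) = 1\<^sub>m D"
  proof (rule eq_matI)
    fix x y assume "x < dim_row (1\<^sub>m D :: complex mat)" "y < dim_col (1\<^sub>m D :: complex mat)"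
    then show "embed N d {} (1\<^sub>m (tdim d {})) $$ (x, y) = 1\<^sub>m D $$ (x, y)"
      using dig_eqI[of x y] by (auto simp: embed_def encode_def tdim_def)
  qed (auto simp: embed_def)
  moreover have "embed N d {} (1\<^sub>m (tdim d {})) \<in> local_terms N d k"
    unfolding local_terms_def by (intro CollectI exI[of _ "{}"] exI[of _ "1\<^sub>m (tdim d {})"]) auto
  ultimately show ?thesis using local_terms_subset_hams by auto
qed

lemma local_hams_all: "local_hams N d N = herm D"
proof
  show "local_hams N d N \<subseteq> herm D" using local_hams_subspace by (simp add: real_subspace_def)
  show "herm D \<subseteq> local_hams N d N"
  proof
    fix X assume X: "X \<in> herm D"
    have "embed N d {1..N} X = X"
      by (rule eq_matI) (use herm_carrier[OF X] encode_digit[of N d] d_pos in \<open>auto simp: embed_def\<close>)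
    moreover have "embed N d {1..N} X \<in> local_terms N d N"
      unfolding local_terms_def using X by (intro CollectI exI[of _ "{1..N}"] exI[of _ X]) auto
    ultimately show "X \<in> local_hams N d N" using local_terms_subset_hams by auto
  qed
qed

lemma embed_single_index:
  assumes "i \<in> {1..N}" "x < D" "y < D"
  shows "embed N d {i} b $$ (x, y) =
    (if \<forall>j\<in>{1..N} - {i}. dig x j = dig y j then b $$ (dig x i, dig y i) else 0)"
proof -
  have "{j \<in> {i}. i < j} = {}" by auto
  then have "place d {i} i = 1" unfolding place_def by (simp only: prod.empty)
  then have "encode d {i} f = f i" for f by (simp add: encode_def)
  then show ?thesis using assms by (simp add: embed_def)
qed

section \<open>Tensor products of eigenbases\<close>

definition tens :: "(nat \<Rightarrow> complex mat) \<Rightarrow> complex mat" where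
  "tens U = mat D D (\<lambda>(x, y). \<Prod>i\<in>{1..N}. U i $$ (dig x i, dig y i))"

lemma tens_carrier [simp]: "tens U \<in> carrier_mat D D"
  by (simp add: tens_def)

lemma prod_delta:
  assumes "x < D" "y < D"
  shows "(\<Prod>i\<in>{1..N}. if dig x i = dig y i then 1 else 0) = (if x = y then 1 else (0 :: complex))"
proof (cases "x = y")
  case False
  then obtain i where "i \<in> {1..N}" "dig x i \<noteq> dig y i" using dig_eqI assms by blast
  then show ?thesis using False by (auto simp: prod_zero_iff)
qed simp

text \<open>A function that is a product over the digits yields entries that are products over the
  units. Taking all factors 1 gives unitarity of \<open>tens U\<close>; taking one nontrivial factor
  gives \<open>embed_udiag\<close>.\<close>

lemma udiag_tens_index:
  assumes U: "\<And>i. i \<in> {1..N} \<Longrightarrow> U i \<in> carrier_mat (d i) (d i)" and xz: "x < D" "z < D"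
  shows "udiag (tens U) (\<lambda>y. \<Prod>i\<in>{1..N}. f i (dig y i)) $$ (x, z) =
    (\<Prod>i\<in>{1..N}. udiag (U i) (f i) $$ (dig x i, dig z i))"
proof -
  have "udiag (tens U) (\<lambda>y. \<Prod>i\<in>{1..N}. f i (dig y i)) $$ (x, z) =
      (\<Sum>y<D. \<Prod>i\<in>{1..N}. U i $$ (dig x i, dig y i) * complex_of_real (f i (dig y i)) * cnj (U i $$ (dig z i, dig y i)))"
    unfolding udiag_index[OF tens_carrier xz] using xz
    by (intro sum.cong refl) (simp add: tens_def prod.distrib)
  also have "\<dots> = (\<Prod>i\<in>{1..N}. \<Sum>a<d i. U i $$ (dig x i, a) * complex_of_real (f i a) * cnj (U i $$ (dig z i, a)))"
    by (rule sum_prod_digits[of "\<lambda>i a. U i $$ (dig x i, a) * complex_of_real (f i a) * cnj (U i $$ (dig z i, a))"])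
  also have "\<dots> = (\<Prod>i\<in>{1..N}. udiag (U i) (f i) $$ (dig x i, dig z i))"
    by (rule prod.cong[OF refl]) (simp add: udiag_index[OF U])
  finally show ?thesis .
qed

lemma tens_unitary:
  assumes U: "\<And>i. i \<in> {1..N} \<Longrightarrow> unitary_mat (d i) (U i)"
  shows "unitary_mat D (tens U)"
proof (rule unitary_matI_right[OF tens_carrier])
  have c: "\<And>i. i \<in> {1..N} \<Longrightarrow> U i \<in> carrier_mat (d i) (d i)" using U unitary_matD(1) by blast
  have "udiag (tens U) (\<lambda>y. \<Prod>i\<in>{1..N}. (\<lambda>i a. 1) i (dig y i)) = 1\<^sub>m D"
  proof (rule eq_matI)
    fix x z assume "x < dim_row (1\<^sub>m D :: complex mat)" "z < dim_col (1\<^sub>m D :: complex mat)"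
    then have xz: "x < D" "z < D" by auto
    have "udiag (tens U) (\<lambda>y. \<Prod>i\<in>{1..N}. (\<lambda>i a. 1) i (dig y i)) $$ (x, z) = (\<Prod>i\<in>{1..N}. udiag (U i) (\<lambda>_. 1) $$ (dig x i, dig z i))"
      by (rule udiag_tens_index[OF c xz])
    also have "\<dots> = (\<Prod>i\<in>{1..N}. if dig x i = dig z i then 1 else 0)"
      by (rule prod.cong[OF refl]) (simp add: udiag_const_one[OF U])
    finally show "udiag (tens U) (\<lambda>y. \<Prod>i\<in>{1..N}. (\<lambda>i a. 1) i (dig y i)) $$ (x, z) = 1\<^sub>m D $$ (x, z)"
      using prod_delta[OF xz] xz by simp
  qed (auto simp: tens_def)
  then show "tens U * mat_adjoint (tens U) = 1\<^sub>m D"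
    by (simp add: udiag_def carrier_matD(1)[OF tens_carrier] right_mult_one_mat[OF tens_carrier])
qed

lemma embed_udiag:
  assumes U: "\<And>i. i \<in> {1..N} \<Longrightarrow> unitary_mat (d i) (U i)" and i: "i \<in> {1..N}"
  shows "embed N d {i} (udiag (U i) h) = udiag (tens U) (\<lambda>y. h (dig y i))"
proof (rule eq_matI)
  have c: "\<And>i. i \<in> {1..N} \<Longrightarrow> U i \<in> carrier_mat (d i) (d i)" using U unitary_matD(1) by blast
  define f where "f j = (if j = i then h else (\<lambda>_. 1))" for j
  fix x z assume "x < dim_row (udiag (tens U) (\<lambda>y. h (dig y i)))" "z < dim_col (udiag (tens U) (\<lambda>y. h (dig y i)))"
  then have xz: "x < D" "z < D" by (auto simp: tens_def)
  have pf: "(\<Prod>j\<in>{1..N}. g j) = g i * (\<Prod>j\<in>{1..N} - {i}. g j)" for g :: "nat \<Rightarrow> 'b :: comm_monoid_mult"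
    using i by (intro prod.remove) auto
  have "(\<Prod>j\<in>{1..N}. f j (dig y j)) = h (dig y i)" for y
    unfolding pf by (simp add: f_def)
  then have "udiag (tens U) (\<lambda>y. h (dig y i)) $$ (x, z) = (\<Prod>j\<in>{1..N}. udiag (U j) (f j) $$ (dig x j, dig z j))"
    using udiag_tens_index[OF c xz, of f] by simp
  also have "\<dots> = udiag (U i) h $$ (dig x i, dig z i) * (\<Prod>j\<in>{1..N} - {i}. if dig x j = dig z j then 1 else 0)"
    unfolding pf by (intro arg_cong2[where f="(*)"] prod.cong) (auto simp: f_def udiag_const_one[OF U])
  also have "\<dots> = embed N d {i} (udiag (U i) h) $$ (x, z)"
    unfolding embed_single_index[OF i xz] by (auto simp: prod_zero_iff)
  finally show "embed N d {i} (udiag (U i) h) $$ (x, z) = udiag (tens U) (\<lambda>y. h (dig y i)) $$ (x, z)" by simp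
qed (auto simp: tens_def embed_def)

lemma embed_one: "i \<in> {1..N} \<Longrightarrow> embed N d {i} (1\<^sub>m (d i)) = 1\<^sub>m D"
  using embed_udiag[of "\<lambda>i. 1\<^sub>m (d i)" i "\<lambda>_. 1"] udiag_const_one[OF tens_unitary[of "\<lambda>i. 1\<^sub>m (d i)", OF unitary_mat_one]]
  by (simp add: unitary_mat_one udiag_const_one[OF unitary_mat_one])

lemma embed_psd:
  assumes i: "i \<in> {1..N}" and E: "psd (d i) E"
  shows "psd D (embed N d {i} E)"
proof -
  obtain U l where U: "unitary_mat (d i) U" "E = udiag U l" "\<And>a. a < d i \<Longrightarrow> 0 \<le> l a"
    using psd_spectral[OF E] by blast
  \<comment> \<open>The eigenbasis of \<open>E\<close> at unit \<open>i\<close> is completed by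
    standard bases at the other units.\<close>
  define W where "W j = (if j = i then U else 1\<^sub>m (d j))" for j
  have W: "unitary_mat (d j) (W j)" for j using U unitary_mat_one by (simp add: W_def)
  have "embed N d {i} E = udiag (tens W) (\<lambda>y. l (dig y i))"
  proof -
    have "W i = U" by (simp add: W_def)
    then show ?thesis using embed_udiag[of W i l, OF W i] U(2) by simp
  qed
  then show ?thesis using psd_udiag_iff[OF tens_unitary[of W, OF W]] U(3) i by simp
qed

section \<open>Marginals of single units\<close>

text \<open>\<open>marginal\<close> is a definite description: the entrywise partial trace
  \<open>m\<close> provides existence, and pairing with all Hermitian matrices provides
  uniqueness.\<close>

lemma marginal_props:
  assumes i: "i \<in> {1..N}" and rho: "\<rho> \<in> states D"
  shows "marginal N d {i} \<rho> \<in> states (d i)"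
    and "\<And>X. X \<in> herm (d i) \<Longrightarrow> hs_inner X (marginal N d {i} \<rho>) = hs_inner (embed N d {i} X) \<rho>"
proof -
  let ?k = "d i"
  have td: "tdim d {i} = ?k" by (simp add: tdim_def)
  note rc = states_carrier[OF rho]
  define R where "R x y \<longleftrightarrow> (\<forall>j\<in>{1..N} - {i}. dig x j = dig y j)" for x y
  have Rsym: "R x y = R y x" for x y unfolding R_def by metis
  \<comment> \<open>The partial trace, with \<open>R\<close> saying that two indices agree off unit
    \<open>i\<close>. The row index of \<open>\<rho>\<close> is called \<open>y\<close>, to match
    the order of factors in the trace of a product.\<close>
  define m where "m = mat ?k ?k (\<lambda>(a, b). \<Sum>x<D. \<Sum>y<D. if R x y \<and> dig x i = b \<and> dig y i = a then \<rho> $$ (y, x) else 0)"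
  have mc: "m \<in> carrier_mat ?k ?k" by (simp add: m_def)
  have mh: "m \<in> herm ?k"
  proof (rule hermI[OF mc])
    fix a b assume ab: "a < ?k" "b < ?k"
    have r: "cnj (\<rho> $$ (y, x)) = \<rho> $$ (x, y)" if "x < D" "y < D" for x y
      using states_herm[OF rho] that unfolding herm_iff by (metis complex_cnj_cnj)
    have "cnj (m $$ (b, a)) = (\<Sum>x<D. \<Sum>y<D. if R x y \<and> dig x i = a \<and> dig y i = b then \<rho> $$ (x, y) else 0)"
      using ab by (auto simp: m_def r intro!: sum.cong)
    also have "\<dots> = (\<Sum>y<D. \<Sum>x<D. if R x y \<and> dig x i = a \<and> dig y i = b then \<rho> $$ (x, y) else 0)"
      by (rule sum.swap)
    also have "\<dots> = m $$ (a, b)" using ab by (auto simp: m_def Rsym intro!: sum.cong)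
    finally show "m $$ (a, b) = cnj (m $$ (b, a))" by simp
  qed
  have inner: "hs_inner X m = hs_inner (embed N d {i} X) \<rho>" if X: "X \<in> herm ?k" for X
  proof -
    note Xc = herm_carrier[OF X]
    have "mtrace (X * m) = (\<Sum>a<?k. \<Sum>b<?k. \<Sum>x<D. \<Sum>y<D.
        if R x y \<and> dig x i = a \<and> dig y i = b then X $$ (a, b) * \<rho> $$ (y, x) else 0)"
      unfolding mtrace_mult[OF Xc mc]
      by (auto simp: m_def sum_distrib_left if_distrib[of "\<lambda>x. _ * x"] intro!: sum.cong cong: if_cong)
    also have "\<dots> = (\<Sum>a<?k. \<Sum>x<D. \<Sum>b<?k. \<Sum>y<D.
        if R x y \<and> dig x i = a \<and> dig y i = b then X $$ (a, b) * \<rho> $$ (y, x) else 0)"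
      by (rule sum.cong[OF refl], rule sum.swap)
    also have "\<dots> = (\<Sum>x<D. \<Sum>a<?k. \<Sum>b<?k. \<Sum>y<D.
        if R x y \<and> dig x i = a \<and> dig y i = b then X $$ (a, b) * \<rho> $$ (y, x) else 0)" by (rule sum.swap)
    also have "\<dots> = (\<Sum>x<D. \<Sum>a<?k. \<Sum>y<D. \<Sum>b<?k.
        if R x y \<and> dig x i = a \<and> dig y i = b then X $$ (a, b) * \<rho> $$ (y, x) else 0)"
      by (intro sum.cong[OF refl] sum.swap)
    also have "\<dots> = (\<Sum>x<D. \<Sum>y<D. \<Sum>a<?k. \<Sum>b<?k.
        if R x y \<and> dig x i = a \<and> dig y i = b then X $$ (a, b) * \<rho> $$ (y, x) else 0)"
      by (rule sum.cong[OF refl], rule sum.swap)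
    also have "\<dots> = (\<Sum>x<D. \<Sum>y<D. embed N d {i} X $$ (x, y) * \<rho> $$ (y, x))"
    proof (intro sum.cong refl)
      fix x y assume "x \<in> {..<D}" "y \<in> {..<D}"
      then have xy: "x < D" "y < D" by auto
      have "(\<Sum>a<?k. \<Sum>b<?k. if R x y \<and> dig x i = a \<and> dig y i = b then X $$ (a, b) * \<rho> $$ (y, x) else 0) =
          (\<Sum>a<?k. if a = dig x i then (\<Sum>b<?k. if b = dig y i then (if R x y then X $$ (a, b) * \<rho> $$ (y, x) else 0) else 0) else 0)"
        by (intro sum.cong refl) (auto intro!: sum.cong sum.neutral)
      also have "\<dots> = (if R x y then X $$ (dig x i, dig y i) * \<rho> $$ (y, x) else 0)"
        using i by (simp add: sum.delta)
      also have "\<dots> = embed N d {i} X $$ (x, y) * \<rho> $$ (y, x)"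
        unfolding embed_single_index[OF i xy] R_def by simp
      finally show "(\<Sum>a<?k. \<Sum>b<?k. if R x y \<and> dig x i = a \<and> dig y i = b then X $$ (a, b) * \<rho> $$ (y, x) else 0) =
        embed N d {i} X $$ (x, y) * \<rho> $$ (y, x)" .
    qed
    also have "\<dots> = mtrace (embed N d {i} X * \<rho>)" by (rule mtrace_mult[OF embed_carrier rc, symmetric])
    finally show ?thesis by (simp add: hs_inner_def)
  qed
  have ms: "m \<in> states ?k"
  proof (rule statesI)
    obtain U l where U: "unitary_mat ?k U" "m = udiag U l" using herm_spectral[OF mh] by blast
    \<comment> \<open>Positivity is inherited by duality: an eigenvalue is the pairing with a
      rank-one projection, whose embedding is positive semidefinite.\<close>
    have "0 \<le> l a" if a: "a < ?k" for a
    proof -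
      have p: "psd ?k (pr U a)" by (rule psd_pr[OF U(1)])
      have "l a = hs_inner m (pr U a)" unfolding U(2) by (rule hs_inner_pr_same[OF U(1) a, symmetric])
      also have "\<dots> = hs_inner (pr U a) m" by (rule hs_inner_commute[OF mc]) (use p psd_herm herm_carrier in blast)
      also have "\<dots> = hs_inner (embed N d {i} (pr U a)) \<rho>" by (rule inner[OF psd_herm[OF p]])
      also have "\<dots> \<ge> 0" by (rule hs_inner_psd_nonneg[OF embed_psd[OF i p] states_psd[OF rho]])
      finally show ?thesis .
    qed
    then show "psd ?k m" unfolding U(2) psd_udiag_iff[OF U(1)] by simp
    show "hs_inner (1\<^sub>m ?k) m = 1" using inner[OF herm_one] embed_one[OF i] states_trace[OF rho] by simp
  qed
  have "marginal N d {i} \<rho> = m" unfolding marginal_def td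
  proof (rule the_equality)
    show "m \<in> states ?k \<and> (\<forall>X\<in>herm ?k. hs_inner X m = hs_inner (embed N d {i} X) \<rho>)" using ms inner by blast
  next
    fix m' assume m': "m' \<in> states ?k \<and> (\<forall>X\<in>herm ?k. hs_inner X m' = hs_inner (embed N d {i} X) \<rho>)"
    then show "m' = m" using herm_fiber_unique[of m' ?k m] ms inner by simp
  qed
  then show "marginal N d {i} \<rho> \<in> states (d i)"
    and "\<And>X. X \<in> herm (d i) \<Longrightarrow> hs_inner X (marginal N d {i} \<rho>) = hs_inner (embed N d {i} X) \<rho>"
    using ms inner by auto
qed

section \<open>Hamiltonians without interaction\<close>

text \<open>The normal form of one-local Hamiltonians: one summand per unit, instead of a list with
  arbitrary repetitions.\<close>

definition local_sum :: "(nat \<Rightarrow> complex mat) \<Rightarrow> complex mat" where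
  "local_sum h = mat D D (\<lambda>(x, y). \<Sum>i\<in>{1..N}. embed N d {i} (h i) $$ (x, y))"

lemma local_sum_in_local_hams:
  assumes h: "\<And>i. i \<in> {1..N} \<Longrightarrow> h i \<in> herm (d i)"
  shows "local_sum h \<in> local_hams N d 1"
proof -
  define hs where "hs = map (\<lambda>i. embed N d {i} (h i)) [1..<Suc N]"
  have t: "set hs \<subseteq> local_terms N d 1"
  proof
    fix x assume "x \<in> set hs"
    then obtain i where "i \<in> {1..<Suc N}" and xi: "x = embed N d {i} (h i)"
      unfolding hs_def set_map set_upt by blast
    then have i: "i \<in> {1..N}" by auto
    then show "x \<in> local_terms N d 1" unfolding local_terms_def using h[OF i] xi
      by (intro CollectI exI[of _ "{i}"] exI[of _ "h i"]) (auto simp: tdim_def)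
  qed
  then have c: "set hs \<subseteq> carrier_mat D D" using local_terms_carrier by blast
  have "local_sum h = foldr (+) hs (0\<^sub>m D D)"
  proof (rule eq_matI)
    fix x y assume "x < dim_row (foldr (+) hs (0\<^sub>m D D))" "y < dim_col (foldr (+) hs (0\<^sub>m D D))"
    then have xy: "x < D" "y < D" using foldr_add_carrier[OF c] by auto
    have "foldr (+) hs (0\<^sub>m D D) $$ (x, y) = (\<Sum>i\<leftarrow>[1..<Suc N]. embed N d {i} (h i) $$ (x, y))"
      unfolding foldr_add_index[OF c xy] by (simp add: hs_def o_def)
    also have "\<dots> = (\<Sum>i\<in>{1..N}. embed N d {i} (h i) $$ (x, y))"
      by (subst interv_sum_list_conv_sum_set_nat) (simp only: set_upt atLeastLessThanSuc_atLeastAtMost)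
    finally show "local_sum h $$ (x, y) = foldr (+) hs (0\<^sub>m D D) $$ (x, y)" using xy by (simp add: local_sum_def)
  qed (use foldr_add_carrier[OF c] in \<open>auto simp: local_sum_def\<close>)
  then show ?thesis using t unfolding local_hams_def by blast
qed

text \<open>One-locality also admits the empty set of units, which contributes a real multiple of
  the identity; it is attributed to unit 1.\<close>

lemma one_local_term_cases:
  assumes N: "1 \<le> N" and t: "t \<in> local_terms N d 1"
  obtains i b where "i \<in> {1..N}" "b \<in> herm (d i)" "t = embed N d {i} b"
proof -
  obtain A b where A: "t = embed N d A b" "A \<subseteq> {1..N}" "card A \<le> 1" "b \<in> herm (tdim d A)"
    using t by (auto simp: local_terms_def)
  have fin: "finite A" using A(2) finite_subset by blast
  show ?thesis
  proof (cases "A = {}")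
    case True
    have one: "1 \<in> {1..N}" using N by simp
    have b: "b \<in> herm 1" using A(4) True by (simp add: tdim_def)
    have b0: "b $$ (0, 0) = complex_of_real (Re (b $$ (0, 0)))"
    proof -
      have "b $$ (0, 0) = cnj (b $$ (0, 0))" using b unfolding herm_iff by (meson less_one)
      from arg_cong[OF this, of Im] have "Im (b $$ (0, 0)) = - Im (b $$ (0, 0))" by simp
      then show ?thesis by (simp add: complex_eq_iff)
    qed
    let ?b = "complex_of_real (Re (b $$ (0, 0))) \<cdot>\<^sub>m 1\<^sub>m (d 1)"
    have "t = embed N d {1} ?b"
    proof (rule eq_matI)
      fix x y assume "x < dim_row (embed N d {1} ?b)" "y < dim_col (embed N d {1} ?b)"
      then have xy: "x < D" "y < D" by (auto simp: embed_def)
      have "t $$ (x, y) = (if \<forall>i\<in>{1..N}. dig x i = dig y i then b $$ (0, 0) else 0)"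
        using xy A(1) True by (simp add: embed_def encode_def)
      also have "\<dots> = embed N d {1} ?b $$ (x, y)"
        unfolding embed_single_index[OF one xy] using dig_less[OF one] b0 one by (auto simp del: dig_less)
      finally show "t $$ (x, y) = embed N d {1} ?b $$ (x, y)" .
    qed (auto simp: A(1) embed_def)
    then show ?thesis using that[OF one herm_smult[OF herm_one]] by blast
  next
    case False
    then have "card A = 1" using A(3) fin by (metis One_nat_def card_0_eq le_SucE le_zero_eq)
    then obtain i where "A = {i}" by (rule card_1_singletonE)
    then show ?thesis using that[of i b] A by (simp add: tdim_def)
  qed
qed

lemma embed_add_single:
  assumes i: "i \<in> {1..N}" and "a \<in> carrier_mat (d i) (d i)" "b \<in> carrier_mat (d i) (d i)" and xy: "x < D" "y < D"
  shows "embed N d {i} (a + b) $$ (x, y) = embed N d {i} a $$ (x, y) + embed N d {i} b $$ (x, y)"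
  unfolding embed_single_index[OF i xy] using assms dig_less[OF i] by simp

lemma one_local_hams_decompose:
  assumes N: "1 \<le> N" and H: "H \<in> local_hams N d 1"
  obtains h where "\<And>i. i \<in> {1..N} \<Longrightarrow> h i \<in> herm (d i)" "H = local_sum h"
proof -
  obtain hs where hs: "H = foldr (+) hs (0\<^sub>m D D)" "set hs \<subseteq> local_terms N d 1" using H by (auto simp: local_hams_def)
  have "\<exists>h. (\<forall>i\<in>{1..N}. h i \<in> herm (d i)) \<and> foldr (+) hs (0\<^sub>m D D) = local_sum h" using hs(2)
  proof (induction hs)
    case Nil
    have "foldr (+) [] (0\<^sub>m D D) = local_sum (\<lambda>i. 0\<^sub>m (d i) (d i))"
    proof (rule eq_matI)
      fix x y assume "x < dim_row (local_sum (\<lambda>i. 0\<^sub>m (d i) (d i)))" "y < dim_col (local_sum (\<lambda>i. 0\<^sub>m (d i) (d i)))"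
      then have xy: "x < D" "y < D" by (auto simp: local_sum_def)
      have "(\<Sum>i\<in>{1..N}. embed N d {i} (0\<^sub>m (d i) (d i)) $$ (x, y)) = 0"
        by (rule sum.neutral) (use embed_single_index xy in auto)
      then show "foldr (+) [] (0\<^sub>m D D) $$ (x, y) = local_sum (\<lambda>i. 0\<^sub>m (d i) (d i)) $$ (x, y)"
        using xy by (simp add: local_sum_def)
    qed (auto simp: local_sum_def)
    then show ?case by (intro exI[of _ "\<lambda>i. 0\<^sub>m (d i) (d i)"]) auto
  next
    case (Cons t hs)
    then obtain h where h: "\<forall>i\<in>{1..N}. h i \<in> herm (d i)" and eq: "foldr (+) hs (0\<^sub>m D D) = local_sum h" by auto
    have t: "t \<in> local_terms N d 1" using Cons by auto
    obtain i b where i: "i \<in> {1..N}" and b: "b \<in> herm (d i)" and tb: "t = embed N d {i} b"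
      using one_local_term_cases[OF N t] .
    define h' where "h' = h(i := b + h i)"
    have "foldr (+) (t # hs) (0\<^sub>m D D) = local_sum h'"
    proof (rule eq_matI)
      fix x y assume "x < dim_row (local_sum h')" "y < dim_col (local_sum h')"
      then have xy: "x < D" "y < D" by (auto simp: local_sum_def)
      have rem: "(\<Sum>j\<in>{1..N}. f j) = f i + (\<Sum>j\<in>{1..N} - {i}. f j)" for f :: "nat \<Rightarrow> complex"
        using i by (intro sum.remove) auto
      have "local_sum h' $$ (x, y) = embed N d {i} (b + h i) $$ (x, y) + (\<Sum>j\<in>{1..N} - {i}. embed N d {j} (h j) $$ (x, y))"
        using xy unfolding local_sum_def by (simp add: rem h'_def)
      also have "embed N d {i} (b + h i) $$ (x, y) = t $$ (x, y) + embed N d {i} (h i) $$ (x, y)"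
        unfolding tb by (rule embed_add_single) (use i b h xy herm_carrier in auto)
      finally have "local_sum h' $$ (x, y) = t $$ (x, y) + local_sum h $$ (x, y)"
        using xy unfolding local_sum_def by (simp add: rem)
      then show "foldr (+) (t # hs) (0\<^sub>m D D) $$ (x, y) = local_sum h' $$ (x, y)"
        using xy by (simp add: eq) (simp add: local_sum_def)
    qed (auto simp: eq local_sum_def)
    moreover have "\<forall>j\<in>{1..N}. h' j \<in> herm (d j)" using h b herm_add i by (simp add: h'_def)
    ultimately show ?case by blast
  qed
  then show ?thesis using that hs(1) by blast
qed

text \<open>In the tensor product of the local eigenbases the eigenvalues add, so their exponentials
  multiply and the partition function factorizes.\<close>

lemma free_energy_local_sum:
  assumes h: "\<And>i. i \<in> {1..N} \<Longrightarrow> h i \<in> herm (d i)"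
  shows "free_energy (local_sum h) = (\<Sum>i\<in>{1..N}. free_energy (h i))"
proof -
  have "\<forall>i. \<exists>U l. i \<in> {1..N} \<longrightarrow> unitary_mat (d i) U \<and> h i = udiag U l" using herm_spectral[OF h] by blast
  then obtain U l where U': "\<And>i. i \<in> {1..N} \<Longrightarrow> unitary_mat (d i) (U i)" "\<And>i. i \<in> {1..N} \<Longrightarrow> h i = udiag (U i) (l i)"
    by metis
  have Dp: "0 < D" using d_pos unfolding tdim_def by (intro prod_pos) force
  have dp: "0 < d i" if "i \<in> {1..N}" for i using d_pos[OF that] by simp
  have "local_sum h = udiag (tens U) (\<lambda>y. \<Sum>i\<in>{1..N}. l i (dig y i))"
  proof (rule eq_matI)
    fix x y assume "x < dim_row (udiag (tens U) (\<lambda>y. \<Sum>i\<in>{1..N}. l i (dig y i)))"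
      "y < dim_col (udiag (tens U) (\<lambda>y. \<Sum>i\<in>{1..N}. l i (dig y i)))"
    then have xy: "x < D" "y < D" by (auto simp: tens_def)
    have "local_sum h $$ (x, y) = (\<Sum>i\<in>{1..N}. udiag (tens U) (\<lambda>y. l i (dig y i)) $$ (x, y))"
      using xy U' embed_udiag[OF U'(1)] by (simp add: local_sum_def)
    also have "\<dots> = udiag (tens U) (\<lambda>y. \<Sum>i\<in>{1..N}. l i (dig y i)) $$ (x, y)"
      unfolding udiag_index[OF tens_carrier xy]
      by (subst sum.swap) (simp add: sum_distrib_left sum_distrib_right)
    finally show "local_sum h $$ (x, y) = udiag (tens U) (\<lambda>y. \<Sum>i\<in>{1..N}. l i (dig y i)) $$ (x, y)" .
  qed (auto simp: local_sum_def tens_def)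
  then have "free_energy (local_sum h) = ln (\<Sum>y<D. exp (\<Sum>i\<in>{1..N}. l i (dig y i)))"
    using gibbs_state_spectral(3)[OF tens_unitary[of U, OF U'(1)] Dp] by simp
  also have "(\<Sum>y<D. exp (\<Sum>i\<in>{1..N}. l i (dig y i))) = (\<Sum>y<D. \<Prod>i\<in>{1..N}. exp (l i (dig y i)))"
    by (simp add: exp_sum)
  also have "\<dots> = (\<Prod>i\<in>{1..N}. \<Sum>a<d i. exp (l i a))" by (rule sum_prod_digits[of "\<lambda>i a. exp (l i a)"])
  also have "ln \<dots> = (\<Sum>i\<in>{1..N}. ln (\<Sum>a<d i. exp (l i a)))"
  proof -
    have "0 < (\<Sum>a<d i. exp (l i a))" if "i \<in> {1..N}" for i
      using dp[OF that] by (intro sum_pos) auto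
    then show ?thesis by (intro ln_prod) force+
  qed
  also have "\<dots> = (\<Sum>i\<in>{1..N}. free_energy (h i))"
    using gibbs_state_spectral(3)[OF U'(1) dp] U'(2) by (intro sum.cong refl) simp
  finally show ?thesis .
qed

lemma hs_inner_local_sum:
  assumes rho: "\<rho> \<in> states D" and h: "\<And>i. i \<in> {1..N} \<Longrightarrow> h i \<in> herm (d i)"
  shows "hs_inner (local_sum h) \<rho> = (\<Sum>i\<in>{1..N}. hs_inner (h i) (marginal N d {i} \<rho>))"
proof -
  note rc = states_carrier[OF rho]
  have lc: "local_sum h \<in> carrier_mat D D" by (simp add: local_sum_def)
  have "hs_inner (local_sum h) \<rho> = (\<Sum>x<D. \<Sum>y<D. \<Sum>i\<in>{1..N}. Re (embed N d {i} (h i) $$ (x, y) * \<rho> $$ (y, x)))"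
    unfolding hs_inner_sum[OF lc rc]
    by (intro sum.cong refl) (simp add: local_sum_def sum_distrib_right sum_subtractf)
  also have "\<dots> = (\<Sum>x<D. \<Sum>i\<in>{1..N}. \<Sum>y<D. Re (embed N d {i} (h i) $$ (x, y) * \<rho> $$ (y, x)))"
    by (rule sum.cong[OF refl], rule sum.swap)
  also have "\<dots> = (\<Sum>i\<in>{1..N}. hs_inner (embed N d {i} (h i)) \<rho>)"
    unfolding hs_inner_sum[OF embed_carrier rc] by (rule sum.swap)
  also have "\<dots> = (\<Sum>i\<in>{1..N}. hs_inner (h i) (marginal N d {i} \<rho>))"
    using marginal_props(2)[OF _ rho h] by (intro sum.cong refl) simp
  finally show ?thesis .
qed

text \<open>No product state is constructed. Both sides are infima of free energy minus expectation,
  and this functional splits over the units; near-optimal Hamiltonians are passed from the units to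
  the whole and back.\<close>

theorem entropy_gibbs_proj_one_local:
  assumes N: "1 \<le> N" and rho: "\<rho> \<in> states D"
  shows "vn_entropy (gibbs_proj D (local_hams N d 1) \<rho>) = (\<Sum>i\<in>{1..N}. vn_entropy (marginal N d {i} \<rho>))"
proof (rule antisym)
  let ?E = "vn_entropy (gibbs_proj D (local_hams N d 1) \<rho>)"
  let ?m = "\<lambda>i. marginal N d {i} \<rho>"
  note lh = local_hams_subspace[of 1] one_in_local_hams[of 1] rho
  note m = marginal_props[OF _ rho]
  have split: "free_energy (local_sum h) - hs_inner (local_sum h) \<rho> = (\<Sum>i\<in>{1..N}. free_energy (h i) - hs_inner (h i) (?m i))"
    if "\<And>i. i \<in> {1..N} \<Longrightarrow> h i \<in> herm (d i)" for h
    using free_energy_local_sum[of h] hs_inner_local_sum[OF rho, of h] that by (simp add: sum_subtractf)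
  show "?E \<le> (\<Sum>i\<in>{1..N}. vn_entropy (?m i))"
  proof (rule field_le_epsilon)
    fix e :: real assume e: "0 < e"
    define \<eta> where "\<eta> = e / real N"
    have \<eta>: "0 < \<eta>" using e N by (simp add: \<eta>_def)
    \<comment> \<open>For a single unit with all Hermitian matrices the fiber of the marginal is the
      marginal alone, so its entropy can serve as the bound. The tolerance \<open>e / N\<close> adds
      up to \<open>e\<close> over the units.\<close>
    have "\<exists>h\<in>herm (d i). free_energy h - hs_inner h (?m i) < vn_entropy (?m i) + \<eta>" if i: "i \<in> {1..N}" for i
    proof (rule approximate_minimizer[OF herm_real_subspace herm_one m(1)[OF i] _ \<eta>])
      fix \<mu> assume "\<mu> \<in> fiber (d i) (herm (d i)) (?m i)"
      then have "\<mu> = ?m i" using herm_fiber_unique[of \<mu> "d i" "?m i"] m(1)[OF i] by (simp add: fiber_def)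
      then show "vn_entropy \<mu> \<le> vn_entropy (?m i)" by simp
    qed
    then obtain h where h: "\<And>i. i \<in> {1..N} \<Longrightarrow> h i \<in> herm (d i)"
      "\<And>i. i \<in> {1..N} \<Longrightarrow> free_energy (h i) - hs_inner (h i) (?m i) < vn_entropy (?m i) + \<eta>"
      by metis
    have "?E \<le> (\<Sum>i\<in>{1..N}. free_energy (h i) - hs_inner (h i) (?m i))"
      using entropy_gibbs_proj_le[OF lh local_sum_in_local_hams[of h, OF h(1)]] split[of h, OF h(1)] by simp
    also have "\<dots> \<le> (\<Sum>i\<in>{1..N}. vn_entropy (?m i) + \<eta>)"
      using h(2) by (intro sum_mono) (simp add: less_imp_le)
    also have "\<dots> = (\<Sum>i\<in>{1..N}. vn_entropy (?m i)) + e" using N by (simp add: sum.distrib \<eta>_def)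
    finally show "?E \<le> (\<Sum>i\<in>{1..N}. vn_entropy (?m i)) + e" .
  qed
  show "(\<Sum>i\<in>{1..N}. vn_entropy (?m i)) \<le> ?E"
  proof (rule field_le_epsilon)
    fix e :: real assume e: "0 < e"
    obtain X where X: "X \<in> local_hams N d 1" "free_energy X - hs_inner X \<rho> < ?E + e"
      using entropy_gibbs_proj_approx[OF lh e] by blast
    obtain h where h: "\<And>i. i \<in> {1..N} \<Longrightarrow> h i \<in> herm (d i)" "X = local_sum h"
      using one_local_hams_decompose[OF N X(1)] by blast
    have "(\<Sum>i\<in>{1..N}. vn_entropy (?m i)) \<le> (\<Sum>i\<in>{1..N}. free_energy (h i) - hs_inner (h i) (?m i))"
      by (rule sum_mono) (rule gibbs_variational[OF m(1) h(1)])
    also have "\<dots> = free_energy X - hs_inner X \<rho>" unfolding h(2) using split[of h, OF h(1)] by simp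
    finally show "(\<Sum>i\<in>{1..N}. vn_entropy (?m i)) \<le> ?E + e" using X(2) by simp
  qed
qed

end

section \<open>Telescoping and the three identities\<close>

lemma sum_telescope_Suc:
  fixes f :: "nat \<Rightarrow> real"
  assumes "1 \<le> N"
  shows "(\<Sum>k = 2..N. f (k - 1) - f k) = f 1 - f N"
  using assms by (induction N rule: nat_induct_at_least) auto

theorem mainTheorem1:
  fixes N :: nat and d :: "nat \<Rightarrow> nat" and \<rho> :: "complex mat"
  assumes "2 \<le> N"
    and "\<And>i. i \<in> {1..N} \<Longrightarrow> 1 \<le> d i"
    and "\<rho> \<in> states (tdim d {1..N})"
  shows "(\<forall>k \<in> {2..N - 1}.
            ereal (irreducible_correlation N d k \<rho>) =
              divergence_from (gibbs_family (local_hams N d (k - 1))) \<rho> -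
              divergence_from (gibbs_family (local_hams N d k)) \<rho>) \<and>
         ereal (irreducible_correlation N d N \<rho>) =
           divergence_from (gibbs_family (local_hams N d (N - 1))) \<rho> \<and>
         total_correlation N d \<rho> = (\<Sum>k = 2..N. irreducible_correlation N d k \<rho>)"
proof -
  interpret multipartite N d by unfold_locales (rule assms(2))
  define en where "en k = vn_entropy (gibbs_proj D (local_hams N d k) \<rho>)" for k
  have irr: "irreducible_correlation N d k \<rho> = en (k - 1) - en k" for k
    by (simp add: irreducible_correlation_def en_def)
  \<comment> \<open>All divergences are finite, so the extended real difference in the first
    identity is an ordinary one and the entropy of \<open>\<rho>\<close> cancels.\<close>
  have div: "divergence_from (gibbs_family (local_hams N d k)) \<rho> = ereal (en k - vn_entropy \<rho>)" for k
    unfolding en_def by (rule divergence_from_gibbs_family[OF local_hams_subspace one_in_local_hams assms(3)])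
  have "gibbs_proj D (local_hams N d N) \<rho> \<in> fiber D (local_hams N d N) \<rho>"
    by (rule gibbs_proj_max_entropy(1)[OF local_hams_subspace one_in_local_hams assms(3)])
  then have "gibbs_proj D (local_hams N d N) \<rho> = \<rho>"
    using herm_fiber_unique[of "gibbs_proj D (local_hams N d N) \<rho>" D \<rho>] assms(3)
    by (simp add: fiber_def local_hams_all)
  then have enN: "en N = vn_entropy \<rho>" by (simp add: en_def)
  have en1: "en 1 = (\<Sum>i\<in>{1..N}. vn_entropy (marginal N d {i} \<rho>))"
    unfolding en_def by (rule entropy_gibbs_proj_one_local[OF _ assms(3)]) (use assms(1) in simp)
  have "total_correlation N d \<rho> = en 1 - en N" by (simp only: total_correlation_def en1 enN)
  also have "\<dots> = (\<Sum>k = 2..N. irreducible_correlation N d k \<rho>)"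
    unfolding irr using assms(1) by (intro sum_telescope_Suc[symmetric]) simp
  finally show ?thesis unfolding irr div by (simp add: enN)
qed

end
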